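(* Let $m\ge 0$ and let $\mathscr{L}_m:H^1(\mathbb{R},\mathbb{C}^2)\to L^2(\mathbb{R},\mathbb{C}^2)$ be the closed operator $$(\mathscr{L}_m f)(x)=\begin{pmatrix} m & -\partial_x\\ \partial_x & -m\end{pmatrix}f(x)+i\,\mathrm{sgn}(x)f(x).$$ 1) If $m>0$, then the spectrum is purely continuous and $$\mathrm{Spec}(\mathscr{L}_m)=\mathrm{Spec}_{\mathrm c}(\mathscr{L}_m)=\{z\in\mathbb{C}:|\mathrm{Re}\,z|\ge m,\ |\mathrm{Im}\,z|=1\},$$ and all essential spectra coincide with it: $\mathrm{Spec}_{\mathrm{e}j}(\mathscr{L}_m)=\mathrm{Spec}(\mathscr{L}_m)$ for all $j\in\{1,2,3,4,5\}$. 2) If $m=0$, then $$\mathrm{Spec}_{\mathrm p}(\mathscr{L}_0)=\{z\in\mathbb{C}:|\mathrm{Im}\,z|<1\},\qquad \mathrm{Spec}_{\mathrm c}(\mathscr{L}_0)=\{z\in\mathbb{C}:|\mathrm{Im}\,z|=1\},$$ $\mathrm{Spec}(\mathscr{L}_0)=\{z\in\mathbb{C}:|\mathrm{Im}\,z|\le 1\}$, and $$\mathrm{Spec}_{\mathrm{e}j}(\mathscr{L}_0)=\{z\in\mathbb{C}:|\mathrm{Im}\,z|=1\}\ \text{ for all } j\in\{1,2,3,4\},\qquad \mathrm{Spec}_{\mathrm{e}5}(\mathscr{L}_0)=\mathrm{Spec}(\mathscr{L}_0).$$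
   Context: For a closed densely defined operator $\mathscr{L}$ on a Hilbert space $\mathcal{H}$: $\mathrm{Spec}_{\mathrm p}(\mathscr{L})$ is the set of $z$ such that $\mathscr{L}-z$ is not injective; $\mathrm{Spec}_{\mathrm c}(\mathscr{L})$ is the set of $z$ such that $\mathscr{L}-z$ is injective with dense range different from $\mathcal{H}$. The essential spectra $\mathrm{Spec}_{\mathrm{e}j}(\mathscr{L})$ are the sets of $z\in\mathbb{C}$ such that: ($j=1$) $\mathscr{L}-z$ is not semi-Fredholm; ($j=2$) $\mathscr{L}-z$ has a singular Weyl sequence, i.e. there are unit vectors $u_n\in\mathrm{Dom}(\mathscr{L})$ with $u_n\rightharpoonup0$ weakly and $(\mathscr{L}-z)u_n\to0$; ($j=3$) $\mathscr{L}-z$ is not Fredholm; ($j=4$) $\mathscr{L}-z$ is not Fredholm of index $0$; ($j=5$) either $z\in\mathrm{Spec}_{\mathrm{e}1}(\mathscr{L})$, or the resolvent set does not intersect the connected component of $\mathbb{C}\setminus\mathrm{Spec}_{\mathrm{e}1}(\mathscr{L})$ containing $z$. *)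

theory Defs
  imports "HOL-Analysis.Analysis" "HOL-Library.Extended_Nat"
begin

section \<open>Complex Hilbert spaces\<close>

text \<open>The inner product is conjugate-linear in the first argument.\<close>

class complex_hilbert_space = real_inner + complete_space +
  fixes scaleC :: "complex \<Rightarrow> 'a \<Rightarrow> 'a" (infixr "*\<^sub>C" 75)
    and cinner :: "'a \<Rightarrow> 'a \<Rightarrow> complex"
  assumes scaleC_add_right: "a *\<^sub>C (x + y) = a *\<^sub>C x + a *\<^sub>C y"
    and scaleC_add_left: "(a + b) *\<^sub>C x = a *\<^sub>C x + b *\<^sub>C x"
    and scaleC_scaleC: "a *\<^sub>C b *\<^sub>C x = (a * b) *\<^sub>C x"
    and scaleR_scaleC: "r *\<^sub>R x = complex_of_real r *\<^sub>C x"
    and cinner_commute: "cinner x y = cnj (cinner y x)"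
    and cinner_add_right: "cinner x (y + z) = cinner x y + cinner x z"
    and cinner_scaleC_right: "cinner x (a *\<^sub>C y) = a * cinner x y"
    and inner_eq_Re_cinner: "inner x y = Re (cinner x y)"

global_interpretation complex_vector:
  vector_space "scaleC :: complex \<Rightarrow> 'a \<Rightarrow> 'a::complex_hilbert_space"
  by unfold_locales
    (simp_all add: scaleC_add_right scaleC_add_left scaleC_scaleC,
     metis scaleR_one scaleR_scaleC of_real_1)


section \<open>Unbounded operators and their spectra\<close>

datatype 'a unbounded_op = Unbounded_Op (Dom: "'a set") (app: "'a \<Rightarrow> 'a")

context
  fixes T :: "'a::complex_hilbert_space unbounded_op"
begin

definition shift_op :: "complex \<Rightarrow> 'a unbounded_op" where
  "shift_op z = Unbounded_Op (Dom T) (\<lambda>u. app T u - z *\<^sub>C u)"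

definition ker_op :: "'a set" where
  "ker_op = {u \<in> Dom T. app T u = 0}"

definition ran_op :: "'a set" where
  "ran_op = app T ` Dom T"

definition nullity :: enat where
  "nullity = (if \<exists>B. finite B \<and> ker_op \<subseteq> complex_vector.span B
     then enat (complex_vector.dim ker_op) else \<infinity>)"

text \<open>The dimension of the quotient of the whole space by the range: a family spans the
  quotient iff, together with the range, it spans the whole space. The infimum is infinite if
  there is no such finite family.\<close>

definition deficiency :: enat where
  "deficiency =
     (INF B \<in> {B. finite B \<and> complex_vector.span (ran_op \<union> B) = UNIV}. enat (card B))"

definition semi_fredholm :: bool where
  "semi_fredholm \<longleftrightarrow> closed ran_op \<and> (nullity < \<infinity> \<or> deficiency < \<infinity>)"

definition fredholm :: bool where
  "fredholm \<longleftrightarrow> closed ran_op \<and> nullity < \<infinity> \<and> deficiency < \<infinity>"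

definition fredholm_index :: int where
  "fredholm_index = int (the_enat nullity) - int (the_enat deficiency)"

definition singular_weyl_sequence :: "(nat \<Rightarrow> 'a) \<Rightarrow> bool" where
  "singular_weyl_sequence u \<longleftrightarrow>
     (\<forall>n. u n \<in> Dom T \<and> norm (u n) = 1) \<and>
     (\<forall>v. (\<lambda>n. cinner v (u n)) \<longlonglongrightarrow> 0) \<and>
     (\<lambda>n. app T (u n)) \<longlonglongrightarrow> 0"

definition boundedly_invertible :: bool where
  "boundedly_invertible \<longleftrightarrow>
     bij_betw (app T) (Dom T) UNIV \<and>
     (\<exists>C. \<forall>v. norm (inv_into (Dom T) (app T) v) \<le> C * norm v)"

end

context
  fixes T :: "'a::complex_hilbert_space unbounded_op"
begin

definition resolvent_set :: "complex set" where
  "resolvent_set = {z. boundedly_invertible (shift_op T z)}"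

definition Spec :: "complex set" where
  "Spec = - resolvent_set"

definition Spec_p :: "complex set" where
  "Spec_p = {z. \<not> inj_on (app (shift_op T z)) (Dom T)}"

definition Spec_c :: "complex set" where
  "Spec_c = {z. inj_on (app (shift_op T z)) (Dom T) \<and>
     closure (ran_op (shift_op T z)) = UNIV \<and> ran_op (shift_op T z) \<noteq> UNIV}"

definition Spec_e1 :: "complex set" where
  "Spec_e1 = {z. \<not> semi_fredholm (shift_op T z)}"

definition Spec_e2 :: "complex set" where
  "Spec_e2 = {z. \<exists>u. singular_weyl_sequence (shift_op T z) u}"

definition Spec_e3 :: "complex set" where
  "Spec_e3 = {z. \<not> fredholm (shift_op T z)}"

definition Spec_e4 :: "complex set" where
  "Spec_e4 = {z. \<not> (fredholm (shift_op T z) \<and> fredholm_index (shift_op T z) = 0)}"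

definition Spec_e5 :: "complex set" where
  "Spec_e5 = {z. z \<in> Spec_e1 \<or>
     resolvent_set \<inter> connected_component_set (- Spec_e1) z = {}}"

end


section \<open>The Hilbert space of square-integrable functions with two complex components\<close>

definition square_integrable :: "(real \<Rightarrow> complex^2) \<Rightarrow> bool" where
  "square_integrable f \<longleftrightarrow>
     f \<in> borel_measurable lborel \<and> integrable lborel (\<lambda>x. (norm (f x))\<^sup>2)"

definition L2_eq :: "(real \<Rightarrow> complex^2) \<Rightarrow> (real \<Rightarrow> complex^2) \<Rightarrow> bool" where
  "L2_eq f g \<longleftrightarrow>
     square_integrable f \<and> square_integrable g \<and> (AE x in lborel. f x = g x)"

definition cdot :: "complex^2 \<Rightarrow> complex^2 \<Rightarrow> complex" where
  "cdot v w = (\<Sum>i\<in>UNIV. cnj (v $ i) * w $ i)"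

lemma norm_vec2: "(norm (v :: complex^2))\<^sup>2 = (cmod (v $ 1))\<^sup>2 + (cmod (v $ 2))\<^sup>2"
  by (simp add: norm_vec_def L2_set_def sum_2)

lemma cdot_2: "cdot v w = cnj (v $ 1) * w $ 1 + cnj (v $ 2) * w $ 2"
  by (simp add: cdot_def sum_2)

lemma inner_eq_Re_cdot: "inner v w = Re (cdot v w)"
  by (simp add: inner_vec_def cdot_def inner_complex_def)

lemma norm_smult: "norm (c *s (v :: complex^2)) = cmod c * norm v"
proof -
  have "(norm (c *s v))\<^sup>2 = (cmod c * norm v)\<^sup>2"
    by (simp add: norm_vec2 norm_mult power_mult_distrib algebra_simps)
  then show ?thesis by (simp add: power2_eq_iff_nonneg)
qed

lemma norm_cdot_le: "cmod (cdot v w) \<le> (norm v)\<^sup>2 + (norm w)\<^sup>2"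
proof -
  have *: "cmod (cnj a * b) \<le> (cmod a)\<^sup>2 + (cmod b)\<^sup>2" for a b
  proof -
    have "2 * (cmod a * cmod b) \<le> (cmod a)\<^sup>2 + (cmod b)\<^sup>2"
      using sum_squares_bound[of "cmod a" "cmod b"] by (simp add: mult.assoc)
    moreover have "0 \<le> cmod a * cmod b" by simp
    ultimately show ?thesis unfolding norm_mult complex_mod_cnj by linarith
  qed
  have "cmod (cdot v w) \<le> cmod (cnj (v $ 1) * w $ 1) + cmod (cnj (v $ 2) * w $ 2)"
    unfolding cdot_2 by (rule norm_triangle_ineq)
  also have "\<dots> \<le> (norm v)\<^sup>2 + (norm w)\<^sup>2"
    using *[of "v $ 1" "w $ 1"] *[of "v $ 2" "w $ 2"] by (simp add: norm_vec2)
  finally show ?thesis .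
qed

lemma measurable_nth2: "(\<lambda>v :: complex^2. v $ i) \<in> borel_measurable borel"
  by (intro borel_measurable_continuous_onI continuous_intros)

lemma measurable_vec_nth [measurable (raw)]:
  "f \<in> borel_measurable M \<Longrightarrow> (\<lambda>x. (f x :: complex^2) $ i) \<in> borel_measurable M"
  by (rule measurable_compose[OF _ measurable_nth2])

lemma measurable_vec_cnj [measurable (raw)]:
  "f \<in> borel_measurable M \<Longrightarrow> (\<lambda>x. cnj (f x)) \<in> borel_measurable M"
  by (rule measurable_compose[where g = cnj], assumption)
    (intro borel_measurable_continuous_onI continuous_on_cnj continuous_on_id)

lemma measurable_vec2:
  assumes "\<And>i. (\<lambda>x. f x $ i) \<in> borel_measurable M"
  shows "f \<in> M \<rightarrow>\<^sub>M (borel :: (complex^2) measure)"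
proof (subst borel_measurable_euclidean_space, intro ballI)
  fix b :: "complex^2" assume "b \<in> Basis"
  then obtain i u where b: "b = axis i u" by (auto simp: Basis_vec_def)
  have "(\<lambda>x. f x \<bullet> b) = (\<lambda>x. f x $ i \<bullet> u)" by (simp add: b inner_axis)
  then show "(\<lambda>x. f x \<bullet> b) \<in> borel_measurable M" using assms[of i] by simp
qed

lemma measurable_cdot [measurable]:
  assumes [measurable]: "f \<in> borel_measurable M" "g \<in> borel_measurable M"
  shows "(\<lambda>x. cdot (f x) (g x)) \<in> borel_measurable M"
  unfolding cdot_2 by measurable

lemma measurable_smult [measurable]:
  assumes [measurable]: "c \<in> borel_measurable M" "f \<in> M \<rightarrow>\<^sub>M (borel :: (complex^2) measure)"
  shows "(\<lambda>x. c x *s f x) \<in> M \<rightarrow>\<^sub>M (borel :: (complex^2) measure)"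
  by (rule measurable_vec2) simp

lemma square_integrable_bound:
  assumes "square_integrable f" "g \<in> borel_measurable lborel" "\<And>x. norm (g x) \<le> C * norm (f x)"
  shows "square_integrable g"
proof -
  have [measurable]: "g \<in> borel_measurable borel" using assms by simp
  have "integrable lborel (\<lambda>x. (norm (g x))\<^sup>2)"
  proof (rule Bochner_Integration.integrable_bound)
    show "integrable lborel (\<lambda>x. C\<^sup>2 * (norm (f x))\<^sup>2)"
      using assms by (simp add: square_integrable_def)
    have "(norm (g x))\<^sup>2 \<le> C\<^sup>2 * (norm (f x))\<^sup>2" for x
      using power_mono[OF assms(3), of x 2] by (simp add: power_mult_distrib)
    then show "AE x in lborel. norm ((norm (g x))\<^sup>2) \<le> norm (C\<^sup>2 * (norm (f x))\<^sup>2)" by auto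
  qed measurable
  then show ?thesis using assms by (simp add: square_integrable_def)
qed

lemma square_integrable_zero: "square_integrable (\<lambda>_. 0)"
  by (simp add: square_integrable_def)

lemma square_integrable_add:
  assumes "square_integrable f" "square_integrable g"
  shows "square_integrable (\<lambda>x. f x + g x)"
proof -
  have [measurable]: "f \<in> borel_measurable borel" "g \<in> borel_measurable borel"
    using assms by (auto simp: square_integrable_def)
  have "integrable lborel (\<lambda>x. (norm (f x + g x))\<^sup>2)"
  proof (rule Bochner_Integration.integrable_bound)
    show "integrable lborel (\<lambda>x. 2 * (norm (f x))\<^sup>2 + 2 * (norm (g x))\<^sup>2)"
      using assms by (simp add: square_integrable_def)
    have "(norm (f x + g x))\<^sup>2 \<le> 2 * (norm (f x))\<^sup>2 + 2 * (norm (g x))\<^sup>2" for x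
    proof -
      have "(norm (f x + g x))\<^sup>2 \<le> (norm (f x) + norm (g x))\<^sup>2"
        by (intro power_mono norm_triangle_ineq) simp
      also have "\<dots> \<le> 2 * (norm (f x))\<^sup>2 + 2 * (norm (g x))\<^sup>2"
        using sum_squares_bound[of "norm (f x)" "norm (g x)"] by (simp add: power2_sum)
      finally show ?thesis .
    qed
    then show "AE x in lborel. norm ((norm (f x + g x))\<^sup>2)
        \<le> norm (2 * (norm (f x))\<^sup>2 + 2 * (norm (g x))\<^sup>2)" by auto
  qed measurable
  then show ?thesis using assms by (simp add: square_integrable_def)
qed

lemma square_integrable_smult:
  assumes "square_integrable f"
  shows "square_integrable (\<lambda>x. c *s f x)"
proof (rule square_integrable_bound[OF assms, where C = "cmod c"])
  have [measurable]: "f \<in> borel_measurable borel" using assms by (simp add: square_integrable_def)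
  show "(\<lambda>x. c *s f x) \<in> borel_measurable lborel" by measurable
qed (simp add: norm_smult)

lemma square_integrable_scaleR:
  "square_integrable f \<Longrightarrow> square_integrable (\<lambda>x. (r :: real) *\<^sub>R f x)"
  by (rule square_integrable_bound[where C = "\<bar>r\<bar>"])
    (auto simp: square_integrable_def intro!: borel_measurable_scaleR)

lemma square_integrable_minus: "square_integrable f \<Longrightarrow> square_integrable (\<lambda>x. - f x)"
  by (rule square_integrable_bound[where C = 1])
    (auto simp: square_integrable_def intro!: borel_measurable_uminus)

lemma square_integrable_diff:
  "square_integrable f \<Longrightarrow> square_integrable g \<Longrightarrow> square_integrable (\<lambda>x. f x - g x)"
  using square_integrable_add[OF _ square_integrable_minus, of f g] by simp

lemma integrable_cdot:
  assumes "square_integrable f" "square_integrable g"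
  shows "integrable lborel (\<lambda>x. cdot (f x) (g x))"
proof (rule Bochner_Integration.integrable_bound)
  show "integrable lborel (\<lambda>x. (norm (f x))\<^sup>2 + (norm (g x))\<^sup>2)"
    using assms by (simp add: square_integrable_def)
  show "AE x in lborel. cmod (cdot (f x) (g x)) \<le> norm ((norm (f x))\<^sup>2 + (norm (g x))\<^sup>2)"
    using norm_cdot_le by auto
  show "(\<lambda>x. cdot (f x) (g x)) \<in> borel_measurable lborel"
    using assms by (auto simp: square_integrable_def intro!: measurable_cdot)
qed

lemma part_equivp_L2_eq: "part_equivp L2_eq"
proof (rule part_equivpI)
  have "L2_eq (\<lambda>_. 0) (\<lambda>_. 0)"
    unfolding L2_eq_def by (intro conjI square_integrable_zero AE_I2 refl)
  then show "\<exists>f. L2_eq f f" by blast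
  show "symp L2_eq"
  proof (rule sympI)
    fix f g assume *: "L2_eq f g"
    then have "AE x in lborel. f x = g x" by (simp only: L2_eq_def)
    then have "AE x in lborel. g x = f x" by eventually_elim simp
    with * show "L2_eq g f" by (simp only: L2_eq_def simp_thms)
  qed
  show "transp L2_eq"
  proof (rule transpI)
    fix f g h assume *: "L2_eq f g" "L2_eq g h"
    then have "AE x in lborel. f x = g x" "AE x in lborel. g x = h x"
      by (simp_all only: L2_eq_def)
    then have "AE x in lborel. f x = h x" by eventually_elim simp
    with * show "L2_eq f h" by (simp only: L2_eq_def simp_thms)
  qed
qed

quotient_type L2 = "real \<Rightarrow> complex^2" / partial: L2_eq
  by (rule part_equivp_L2_eq)

lemma AE_eq_integral:
  fixes u v :: "real \<Rightarrow> 'b::{banach, second_countable_topology}"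
  assumes "AE x in lborel. u x = v x"
    and "u \<in> borel_measurable lborel" "v \<in> borel_measurable lborel"
  shows "integral\<^sup>L lborel u = integral\<^sup>L lborel v"
  using assms by (intro integral_cong_AE) auto

instantiation L2 :: real_inner
begin

lift_definition zero_L2 :: L2 is "\<lambda>_. 0"
  by (simp add: L2_eq_def square_integrable_zero)

lift_definition plus_L2 :: "L2 \<Rightarrow> L2 \<Rightarrow> L2" is "\<lambda>f g x. f x + g x"
  by (auto simp: L2_eq_def square_integrable_add)

lift_definition uminus_L2 :: "L2 \<Rightarrow> L2" is "\<lambda>f x. - f x"
  by (auto simp: L2_eq_def square_integrable_minus)

lift_definition minus_L2 :: "L2 \<Rightarrow> L2 \<Rightarrow> L2" is "\<lambda>f g x. f x - g x"
  by (auto simp: L2_eq_def square_integrable_diff)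

lift_definition scaleR_L2 :: "real \<Rightarrow> L2 \<Rightarrow> L2" is "\<lambda>r f x. r *\<^sub>R f x"
  by (auto simp: L2_eq_def square_integrable_scaleR)

lift_definition inner_L2 :: "L2 \<Rightarrow> L2 \<Rightarrow> real" is "\<lambda>f g. \<integral>x. f x \<bullet> g x \<partial>lborel"
  by (rule AE_eq_integral) (auto simp: L2_eq_def square_integrable_def)

definition norm_L2 :: "L2 \<Rightarrow> real" where "norm_L2 f = sqrt (f \<bullet> f)"

definition dist_L2 :: "L2 \<Rightarrow> L2 \<Rightarrow> real" where "dist_L2 f g = norm (f - g)"

definition sgn_L2 :: "L2 \<Rightarrow> L2" where "sgn_L2 f = inverse (norm f) *\<^sub>R f"

definition uniformity_L2 :: "(L2 \<times> L2) filter" where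
  "uniformity_L2 = (INF e\<in>{0<..}. principal {(x, y). dist x y < e})"

definition open_L2 :: "L2 set \<Rightarrow> bool" where
  "open_L2 U \<longleftrightarrow> (\<forall>x\<in>U. \<forall>\<^sub>F (x', y) in uniformity. x' = x \<longrightarrow> y \<in> U)"

lemma integrable_inner_L2:
  assumes "square_integrable f" "square_integrable g"
  shows "integrable lborel (\<lambda>x. f x \<bullet> g x)"
  using integrable_Re[OF integrable_cdot[OF assms]] by (simp add: inner_eq_Re_cdot)

instance
proof
  fix f g h :: L2 and r s :: real
  show "f + g + h = f + (g + h)" 
    by transfer (auto simp: L2_eq_def square_integrable_add add.assoc)
  show "f + g = g + f"
    by transfer (auto simp: L2_eq_def square_integrable_add add.commute)
  show "0 + f = f" by transfer (auto simp: L2_eq_def)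
  show "- f + f = 0" by transfer (auto simp: L2_eq_def square_integrable_zero)
  show "f - g = f + - g" by transfer (auto simp: L2_eq_def square_integrable_diff)
  show "r *\<^sub>R (f + g) = r *\<^sub>R f + r *\<^sub>R g"
    by transfer (auto simp: L2_eq_def square_integrable_add square_integrable_scaleR scaleR_add_right)
  show "(r + s) *\<^sub>R f = r *\<^sub>R f + s *\<^sub>R f"
    by transfer (auto simp: L2_eq_def square_integrable_add square_integrable_scaleR scaleR_add_left)
  show "r *\<^sub>R s *\<^sub>R f = (r * s) *\<^sub>R f"
    by transfer (auto simp: L2_eq_def square_integrable_scaleR)
  show "1 *\<^sub>R f = f" by transfer (auto simp: L2_eq_def)
  show "dist f g = norm (f - g)" by (rule dist_L2_def)
  show "sgn f = inverse (norm f) *\<^sub>R f" by (rule sgn_L2_def)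
  show "uniformity = (INF e\<in>{0<..}. principal {(x :: L2, y). dist x y < e})"
    by (rule uniformity_L2_def)
  show "open U = (\<forall>x\<in>U. \<forall>\<^sub>F (x', y) in uniformity. x' = x \<longrightarrow> y \<in> U)" for U :: "L2 set"
    by (rule open_L2_def)
  show "f \<bullet> g = g \<bullet> f" by transfer (simp add: inner_commute)
  show "(f + g) \<bullet> h = f \<bullet> h + g \<bullet> h"
    by transfer (simp add: L2_eq_def inner_add_left integrable_inner_L2)
  show "r *\<^sub>R f \<bullet> g = r * (f \<bullet> g)"
    by transfer (simp add: L2_eq_def)
  show "0 \<le> f \<bullet> f" by transfer simp
  show "(f \<bullet> f = 0) = (f = 0)"
  proof transfer
    fix f assume "L2_eq f f"
    then have sf: "square_integrable f" by (simp add: L2_eq_def)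
    have "(\<integral>x. f x \<bullet> f x \<partial>lborel) = 0 \<longleftrightarrow> (AE x in lborel. f x \<bullet> f x = 0)"
      by (rule integral_nonneg_eq_0_iff_AE) (auto intro: integrable_inner_L2 sf)
    then show "((\<integral>x. f x \<bullet> f x \<partial>lborel) = 0) = L2_eq f (\<lambda>_. 0)"
      using sf by (simp add: L2_eq_def square_integrable_zero)
  qed
  show "norm f = sqrt (f \<bullet> f)" by (rule norm_L2_def)
qed

end

text \<open>Completeness (Riesz--Fischer).\<close>

lemma norm_L2_square:
  assumes "square_integrable f"
  shows "ennreal ((norm (abs_L2 f))\<^sup>2) = (\<integral>\<^sup>+x. ennreal ((norm (f x))\<^sup>2) \<partial>lborel)"
proof -
  have "L2_eq f f" using assms by (simp add: L2_eq_def)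
  then have "(norm (abs_L2 f))\<^sup>2 = (\<integral>x. (norm (f x))\<^sup>2 \<partial>lborel)"
    by (simp add: power2_norm_eq_inner inner_L2.abs_eq)
  then show ?thesis using assms by (simp add: square_integrable_def nn_integral_eq_integral)
qed

lemma diff_abs_L2:
  assumes "square_integrable f" "square_integrable g"
  shows "abs_L2 f - abs_L2 g = abs_L2 (\<lambda>x. f x - g x)"
  using assms by (intro minus_L2.abs_eq) (auto simp: L2_eq_def)

lemma square_integrableI:
  assumes [measurable]: "f \<in> borel_measurable borel"
    and "(\<integral>\<^sup>+x. ennreal ((norm (f x))\<^sup>2) \<partial>lborel) < \<infinity>"
  shows "square_integrable f"
  using assms(2) by (auto simp: square_integrable_def intro!: integrableI_nonneg)

lemma square_integrable_rep: "square_integrable (rep_L2 f)"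
  using Quotient_rep_reflp[OF Quotient_L2, of f] by (simp add: L2_eq_def)

lemma half_power_square: "((1/2::real) ^ n)\<^sup>2 = (1/4) ^ n"
proof -
  have "((1/2::real) ^ n)\<^sup>2 = ((1/2) * (1/2)) ^ n"
    by (simp only: power2_eq_square power_mult_distrib)
  then show ?thesis by simp
qed

lemma L2_fast_Cauchy_convergent:
  fixes X :: "nat \<Rightarrow> L2"
  assumes "\<And>n m. n \<le> m \<Longrightarrow> (norm (X m - X n))\<^sup>2 \<le> (1/4) ^ n"
  shows "convergent X"
proof -
  define F where "F n = rep_L2 (X n)" for n
  have sq: "square_integrable (F n)" for n by (simp add: F_def square_integrable_rep)
  have X: "X n = abs_L2 (F n)" for n
    by (simp add: F_def Quotient_abs_rep[OF Quotient_L2])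
  have [measurable]: "F n \<in> borel_measurable borel" for n
    using sq[of n] by (simp add: square_integrable_def)
  have bound: "(\<integral>\<^sup>+x. ennreal ((norm (F m x - F n x))\<^sup>2) \<partial>lborel) \<le> ennreal ((1/4) ^ n)"
    if "n \<le> m" for n m
    using assms[OF that] norm_L2_square[OF square_integrable_diff[OF sq sq], of m n]
    by (simp add: X diff_abs_L2 sq ennreal_leI flip: norm_L2_square[OF square_integrable_diff[OF sq sq]])
  define D where "D n x = 2 ^ n * (norm (F (Suc n) x - F n x))\<^sup>2" for n x
  have "(\<integral>\<^sup>+x. (\<Sum>n. ennreal (D n x)) \<partial>lborel) = (\<Sum>n. \<integral>\<^sup>+x. ennreal (D n x) \<partial>lborel)"
    by (rule nn_integral_suminf) (simp add: D_def)
  also have "\<dots> \<le> (\<Sum>n. ennreal ((1/2) ^ n))"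
  proof (rule suminf_le)
    fix n
    have "(\<integral>\<^sup>+x. ennreal (D n x) \<partial>lborel)
        = ennreal (2 ^ n) * (\<integral>\<^sup>+x. ennreal ((norm (F (Suc n) x - F n x))\<^sup>2) \<partial>lborel)"
      unfolding D_def by (subst nn_integral_cmult[symmetric]) (auto simp: ennreal_mult)
    also have "\<dots> \<le> ennreal (2 ^ n) * ennreal ((1/4) ^ n)"
      by (intro mult_left_mono bound) auto
    also have "\<dots> = ennreal ((1/2) ^ n)"
      by (simp flip: ennreal_mult power_mult_distrib)
    finally show "(\<integral>\<^sup>+x. ennreal (D n x) \<partial>lborel) \<le> ennreal ((1/2) ^ n)" .
  qed auto
  also have "\<dots> < \<infinity>"
    by (subst suminf_ennreal_eq[OF _ geometric_sums]) auto
  finally have "AE x in lborel. (\<Sum>n. ennreal (D n x)) \<noteq> \<infinity>"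
    by (intro nn_integral_noteq_infinite) (auto simp: D_def)
  then have conv: "AE x in lborel. convergent (\<lambda>n. F n x)"
  proof eventually_elim
    case (elim x)
    have "summable (\<lambda>n. D n x)"
      using elim by (intro summable_suminf_not_top) (auto simp: D_def)
    then have "(\<lambda>n. D n x) \<longlonglongrightarrow> 0" by (rule summable_LIMSEQ_zero)
    then have "eventually (\<lambda>n. D n x < 1) sequentially"
      by (rule order_tendstoD) simp
    then obtain N where N: "D n x < 1" if "n \<ge> N" for n
      by (auto simp: eventually_sequentially)
    have "norm (F (Suc n) x - F n x) \<le> (1 / sqrt 2) ^ n" if "n \<ge> N" for n
    proof (rule power2_le_imp_le)
      have "2 ^ n * (norm (F (Suc n) x - F n x))\<^sup>2 \<le> 1"
        using N[OF that] by (simp add: D_def)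
      then have "(norm (F (Suc n) x - F n x))\<^sup>2 \<le> 1 / 2 ^ n"
        by (simp add: field_simps)
      also have "\<dots> = ((1 / sqrt 2)\<^sup>2) ^ n"
        by (simp add: power_divide)
      also have "\<dots> = ((1 / sqrt 2) ^ n)\<^sup>2"
        by (simp only: power2_eq_square power_mult_distrib)
      finally show "(norm (F (Suc n) x - F n x))\<^sup>2 \<le> ((1 / sqrt 2) ^ n)\<^sup>2" .
    qed simp
    moreover have "summable (\<lambda>n. (1 / sqrt 2) ^ n :: real)"
      by (rule summable_geometric) simp
    ultimately have "summable (\<lambda>n. F (Suc n) x - F n x)"
      by (rule summable_comparison_test'[rotated])
    then have "convergent (\<lambda>n. \<Sum>k<n. F (Suc k) x - F k x)"
      by (simp only: summable_iff_convergent)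
    then have "convergent (\<lambda>n. (\<Sum>k<n. F (Suc k) x - F k x) + F 0 x)"
      by (rule convergent_add[OF _ convergent_const])
    moreover have "(\<Sum>k<n. F (Suc k) x - F k x) + F 0 x = F n x" for n
      using sum_lessThan_telescope[of "\<lambda>k. F k x" n] by simp
    ultimately show ?case by simp
  qed
  define G where "G x = lim (\<lambda>n. F n x)" for x
  have [measurable]: "G \<in> borel_measurable borel"
    unfolding G_def by measurable
  have close: "(\<integral>\<^sup>+x. ennreal ((norm (G x - F n x))\<^sup>2) \<partial>lborel) \<le> ennreal ((1/4) ^ n)" for n
  proof -
    have "(\<integral>\<^sup>+x. ennreal ((norm (G x - F n x))\<^sup>2) \<partial>lborel)
        = (\<integral>\<^sup>+x. liminf (\<lambda>m. ennreal ((norm (F m x - F n x))\<^sup>2)) \<partial>lborel)"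
    proof (rule nn_integral_cong_AE)
      show "AE x in lborel. ennreal ((norm (G x - F n x))\<^sup>2)
          = liminf (\<lambda>m. ennreal ((norm (F m x - F n x))\<^sup>2))"
        using conv
      proof eventually_elim
        case (elim x)
        then have "(\<lambda>m. F m x) \<longlonglongrightarrow> G x" by (simp add: G_def convergent_LIMSEQ_iff)
        then have "(\<lambda>m. ennreal ((norm (F m x - F n x))\<^sup>2)) \<longlonglongrightarrow> ennreal ((norm (G x - F n x))\<^sup>2)"
          by (intro tendsto_ennrealI tendsto_power tendsto_norm tendsto_diff tendsto_const)
        then show ?case
          by (intro lim_imp_Liminf[symmetric] trivial_limit_sequentially)
      qed
    qed
    also have "\<dots> \<le> liminf (\<lambda>m. \<integral>\<^sup>+x. ennreal ((norm (F m x - F n x))\<^sup>2) \<partial>lborel)"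
      by (rule nn_integral_liminf) simp
    also have "\<dots> \<le> limsup (\<lambda>m. \<integral>\<^sup>+x. ennreal ((norm (F m x - F n x))\<^sup>2) \<partial>lborel)"
      by (rule Liminf_le_Limsup) simp
    also have "\<dots> \<le> ennreal ((1/4) ^ n)"
      by (rule Limsup_bounded, rule eventually_sequentiallyI[of n], rule bound)
    finally show ?thesis .
  qed
  have "square_integrable (\<lambda>x. G x - F 0 x)"
    using close[of 0] by (intro square_integrableI) (auto intro: le_less_trans)
  then have "square_integrable (\<lambda>x. (G x - F 0 x) + F 0 x)"
    by (rule square_integrable_add[OF _ sq])
  then have sqG: "square_integrable G" by simp
  have "norm (X n - abs_L2 G) \<le> (1/2) ^ n" for n
  proof (rule power2_le_imp_le)
    have "ennreal ((norm (abs_L2 G - X n))\<^sup>2) \<le> ennreal ((1/4) ^ n)"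
      using close[of n] norm_L2_square[OF square_integrable_diff[OF sqG sq]]
      by (simp add: X diff_abs_L2 sq sqG)
    then have "(norm (abs_L2 G - X n))\<^sup>2 \<le> (1/4) ^ n"
      by (subst (asm) ennreal_le_iff) simp_all
    then show "(norm (X n - abs_L2 G))\<^sup>2 \<le> ((1/2) ^ n)\<^sup>2"
      by (simp only: half_power_square norm_minus_commute[of "X n"])
  qed simp
  then have "eventually (\<lambda>n. norm (X n - abs_L2 G) \<le> (1/2) ^ n) sequentially"
    by (rule always_eventually[OF allI])
  moreover have "(\<lambda>n. (1/2 :: real) ^ n) \<longlonglongrightarrow> 0"
    by (rule LIMSEQ_power_zero) simp
  ultimately have "(\<lambda>n. X n - abs_L2 G) \<longlonglongrightarrow> 0"
    by (rule Lim_null_comparison)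
  then have "X \<longlonglongrightarrow> abs_L2 G" by (rule LIM_zero_cancel)
  then show ?thesis by (rule convergentI)
qed

instance L2 :: complete_space
proof
  fix X :: "nat \<Rightarrow> L2" assume X: "Cauchy X"
  have "\<forall>n. \<exists>N. \<forall>m\<ge>N. \<forall>k\<ge>N. norm (X m - X k) < (1/2) ^ n"
    by (intro allI CauchyD[OF X]) simp
  from choice[OF this] obtain N
    where N: "\<forall>n. \<forall>m\<ge>N n. \<forall>k\<ge>N n. norm (X m - X k) < (1/2) ^ n" ..
  define r where "r n = (\<Sum>k\<le>n. N k) + n" for n
  have N_le: "N n \<le> r n" for n
    using member_le_sum[of n "{..n}" N] by (simp add: r_def)
  have mono: "strict_mono r" by (simp add: strict_mono_Suc_iff r_def)
  have r: "norm (X m - X (r n)) < (1/2) ^ n" if "r n \<le> m" for n m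
    using N[rule_format, of n m "r n"] N_le[of n] that by simp
  have "convergent (X \<circ> r)"
  proof (rule L2_fast_Cauchy_convergent)
    fix n m :: nat assume "n \<le> m"
    then have "norm (X (r m) - X (r n)) < (1/2) ^ n"
      by (intro r) (simp add: strict_mono_less_eq mono)
    then have "(norm (X (r m) - X (r n)))\<^sup>2 \<le> ((1/2) ^ n)\<^sup>2"
      by (intro power_mono) auto
    then show "(norm ((X \<circ> r) m - (X \<circ> r) n))\<^sup>2 \<le> (1/4) ^ n"
      by (simp only: half_power_square comp_apply)
  qed
  then obtain L where "(X \<circ> r) \<longlonglongrightarrow> L" by (auto simp only: convergent_def)
  with X mono have "X \<longlonglongrightarrow> L" by (rule Cauchy_converges_subseq)
  then show "convergent X" by (rule convergentI)
qed

instantiation L2 :: complex_hilbert_space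
begin

lift_definition scaleC_L2 :: "complex \<Rightarrow> L2 \<Rightarrow> L2" is "\<lambda>c f x. c *s f x"
  by (auto simp: L2_eq_def square_integrable_smult)

lift_definition cinner_L2 :: "L2 \<Rightarrow> L2 \<Rightarrow> complex" is "\<lambda>f g. \<integral>x. cdot (f x) (g x) \<partial>lborel"
proof (rule AE_eq_integral)
  fix f f' g g' assume *: "L2_eq f f'" "L2_eq g g'"
  then show "AE x in lborel. cdot (f x) (g x) = cdot (f' x) (g' x)"
    by (auto simp: L2_eq_def)
  show "(\<lambda>x. cdot (f x) (g x)) \<in> borel_measurable lborel"
    and "(\<lambda>x. cdot (f' x) (g' x)) \<in> borel_measurable lborel"
    using * by (auto simp: L2_eq_def square_integrable_def intro!: measurable_cdot)
qed

instance
proof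
  fix f g h :: L2 and a b :: complex and r :: real
  show "a *\<^sub>C (f + g) = a *\<^sub>C f + a *\<^sub>C g"
    by transfer (auto simp: L2_eq_def square_integrable_add square_integrable_smult vector_add_ldistrib)
  show "(a + b) *\<^sub>C f = a *\<^sub>C f + b *\<^sub>C f"
    by transfer (auto simp: L2_eq_def square_integrable_add square_integrable_smult vector_sadd_rdistrib)
  show "a *\<^sub>C b *\<^sub>C f = (a * b) *\<^sub>C f"
    by transfer (auto simp: L2_eq_def square_integrable_smult vector_smult_assoc)
  have *: "r *\<^sub>R v = complex_of_real r *s v" for r :: real and v :: "complex^2"
    by (simp add: vec_eq_iff scaleR_conv_of_real[where 'a = complex])
  show "r *\<^sub>R f = complex_of_real r *\<^sub>C f"
    by transfer (auto simp: L2_eq_def square_integrable_smult square_integrable_scaleR *)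
  have cdot_commute: "cdot v w = cnj (cdot w v)" for v w
    by (simp add: cdot_2 mult.commute)
  have "(\<integral>x. cdot (f x) (g x) \<partial>lborel) = cnj (\<integral>x. cdot (g x) (f x) \<partial>lborel)"
    for f g :: "real \<Rightarrow> complex^2"
    unfolding Bochner_Integration.integral_cnj[symmetric]
    by (rule Bochner_Integration.integral_cong[OF refl cdot_commute])
  then show "cinner f g = cnj (cinner g f)"
    by transfer
  have "cdot u (v + w) = cdot u v + cdot u w" for u v w
    by (simp add: cdot_2 algebra_simps)
  then show "cinner f (g + h) = cinner f g + cinner f h"
    by transfer (simp add: L2_eq_def integrable_cdot)
  have "cdot v (a *s w) = a * cdot v w" for v w
    by (simp add: cdot_2 algebra_simps)
  then show "cinner f (a *\<^sub>C g) = a * cinner f g"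
    by transfer simp
  show "f \<bullet> g = Re (cinner f g)"
    by transfer (simp add: L2_eq_def inner_eq_Re_cdot integral_Re integrable_cdot)
qed

end


section \<open>The Dirac operator with complex dislocation\<close>

text \<open>Real-valued test functions suffice: the condition defining a weak derivative is linear
  over the complex numbers in the test function.\<close>

definition test_functions :: "(real \<Rightarrow> real) set" where
  "test_functions =
     {\<phi>. (\<forall>k. (deriv ^^ k) \<phi> differentiable_on UNIV) \<and> compact (closure {x. \<phi> x \<noteq> 0})}"

lemma test_function_measurable:
  assumes "\<phi> \<in> test_functions"
  shows "\<phi> \<in> borel_measurable borel" "deriv \<phi> \<in> borel_measurable borel"
proof -
  have *: "(deriv ^^ k) \<phi> \<in> borel_measurable borel" for k
    using assms unfolding test_functions_def
    by (intro borel_measurable_continuous_onI differentiable_imp_continuous_on) auto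
  show "\<phi> \<in> borel_measurable borel" "deriv \<phi> \<in> borel_measurable borel"
    using *[of 0] *[of 1] by simp_all
qed

lift_definition has_weak_derivative :: "L2 \<Rightarrow> L2 \<Rightarrow> bool" is
  "\<lambda>f g. \<forall>\<phi>\<in>test_functions.
     (\<integral>x. deriv \<phi> x *\<^sub>R f x \<partial>lborel) = - (\<integral>x. \<phi> x *\<^sub>R g x \<partial>lborel)"
proof -
  fix f f' g g' assume *: "L2_eq f f'" "L2_eq g g'"
  have "(\<integral>x. deriv \<phi> x *\<^sub>R f x \<partial>lborel) = (\<integral>x. deriv \<phi> x *\<^sub>R f' x \<partial>lborel)"
    "(\<integral>x. \<phi> x *\<^sub>R g x \<partial>lborel) = (\<integral>x. \<phi> x *\<^sub>R g' x \<partial>lborel)" if "\<phi> \<in> test_functions" for \<phi>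
    using * test_function_measurable[OF that]
    by (auto simp: L2_eq_def square_integrable_def intro!: AE_eq_integral)
  then show "(\<forall>\<phi>\<in>test_functions.
      (\<integral>x. deriv \<phi> x *\<^sub>R f x \<partial>lborel) = - (\<integral>x. \<phi> x *\<^sub>R g x \<partial>lborel)) =
    (\<forall>\<phi>\<in>test_functions.
      (\<integral>x. deriv \<phi> x *\<^sub>R f' x \<partial>lborel) = - (\<integral>x. \<phi> x *\<^sub>R g' x \<partial>lborel))"
    by simp
qed

definition H1 :: "L2 set" where
  "H1 = {f. \<exists>g. has_weak_derivative f g}"

definition weak_derivative :: "L2 \<Rightarrow> L2" where
  "weak_derivative f = (THE g. has_weak_derivative f g)"

text \<open>The differential expression, with \<open>g\<close> in place of the derivative of \<open>f\<close>.\<close>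

lift_definition dirac_expression :: "real \<Rightarrow> L2 \<Rightarrow> L2 \<Rightarrow> L2" is
  "\<lambda>m f g x. vector [complex_of_real m * f x $ 1 - g x $ 2,
                      g x $ 1 - complex_of_real m * f x $ 2]
             + (\<i> * complex_of_real (sgn x)) *s f x"
proof -
  fix m :: real and f f' g g' assume *: "L2_eq f f'" "L2_eq g g'"
  let ?E = "\<lambda>f g (x :: real). vector [complex_of_real m * f x $ 1 - g x $ 2,
      g x $ 1 - complex_of_real m * f x $ 2] + (\<i> * complex_of_real (sgn x)) *s f x :: complex^2"
  have sq: "square_integrable (?E f g)" if "square_integrable f" "square_integrable g" for f g
  proof -
    have [measurable]: "f \<in> borel_measurable borel" "g \<in> borel_measurable borel"
      using that by (auto simp: square_integrable_def)
    let ?A = "\<lambda>x. vector [complex_of_real m * f x $ 1, - complex_of_real m * f x $ 2] :: complex^2"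
    let ?B = "\<lambda>x. vector [- g x $ 2, g x $ 1] :: complex^2"
    let ?C = "\<lambda>x. (\<i> * complex_of_real (sgn x)) *s f x"
    have meas: "(\<lambda>x. vector [u x, v x] :: complex^2) \<in> borel_measurable lborel"
      if "u \<in> borel_measurable borel" "v \<in> borel_measurable borel" for u v
    proof (rule measurable_vec2)
      show "(\<lambda>x. (vector [u x, v x] :: complex^2) $ i) \<in> borel_measurable lborel" for i
        using that exhaust_2[of i] by auto
    qed
    have "norm (?A x) \<le> \<bar>m\<bar> * norm (f x)" for x
      by (rule power2_le_imp_le)
        (simp_all add: norm_vec2 norm_mult power_mult_distrib algebra_simps)
    then have "square_integrable ?A"
      by (rule square_integrable_bound[OF that(1) meas, rotated 2]) measurable
    moreover have "norm (?B x) \<le> 1 * norm (g x)" for x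
      by (rule power2_le_imp_le) (simp_all add: norm_vec2)
    then have "square_integrable ?B"
      by (rule square_integrable_bound[OF that(2) meas, rotated 2]) measurable
    moreover have "square_integrable ?C"
    proof (rule square_integrable_bound[OF that(1), where C = 1])
      show "norm (?C x) \<le> 1 * norm (f x)" for x
        by (simp add: norm_smult norm_mult sgn_if)
    qed measurable
    ultimately have "square_integrable (\<lambda>x. ?A x + ?B x + ?C x)"
      by (intro square_integrable_add)
    moreover have "(\<lambda>x. ?A x + ?B x + ?C x) = ?E f g"
      by (auto simp: fun_eq_iff vec_eq_iff forall_2)
    ultimately show ?thesis by simp
  qed
  have "AE x in lborel. f x = f' x" "AE x in lborel. g x = g' x"
    using * by (auto simp: L2_eq_def)
  then have "AE x in lborel. ?E f g x = ?E f' g' x"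
    by eventually_elim simp
  then show "L2_eq (?E f g) (?E f' g')"
    using * sq by (auto simp: L2_eq_def)
qed

definition dirac_op :: "real \<Rightarrow> L2 unbounded_op" where
  "dirac_op m = Unbounded_Op H1 (\<lambda>f. dirac_expression m f (weak_derivative f))"

end

theory Submission
  imports Defs "HOL-Real_Asymp.Real_Asymp"
begin

text \<open>
  With \<open>w = z - \<i> sgn x\<close>, the equation \<open>(L - z) f = h\<close> reads
  \<open>f\<^sub>1' = (m + w) f\<^sub>2 + h\<^sub>2\<close>, \<open>f\<^sub>2' = (m - w) f\<^sub>1 - h\<^sub>1\<close>: a system with constant coefficients on each
  half-line, with rates \<open>\<plusminus>\<mu>\<close> where \<open>\<mu>\<^sup>2 = m\<^sup>2 - w\<^sup>2\<close>. A purely imaginary \<open>\<mu>\<close> on one of the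
  half-lines means that \<open>z\<close> lies on the two lines \<open>\<bar>Re z\<bar> \<ge> m\<close>, \<open>\<bar>Im z\<bar> = 1\<close>.

  Off these lines, the energy identity (\<open>half_line_energy\<close>) bounds \<open>f\<close> by \<open>h\<close> and \<open>f(0)\<close>, and on each
  side it bounds by \<open>h\<close> alone the component of \<open>f(0)\<close> along the growing direction
  (\<open>half_line_estimate\<close>, \<open>dirac_estimate\<close>). These two components determine \<open>f(0)\<close> unless \<open>m = 0\<close> and
  \<open>\<bar>Im z\<bar> < 1\<close> (\<open>nondegenerate_estimate\<close>, \<open>massive_regular\<close>, \<open>massless_regular\<close>). In that strip they
  are proportional; the decaying solutions of both sides then match and form a one-dimensional kernel,
  modulo which the estimate persists (\<open>massless_strip\<close>). On the lines there is no kernel: the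
  quadratic invariants of the two half-lines force \<open>f(0) = 0\<close> if \<open>m > 0\<close> (\<open>massive_injective\<close>), and
  the norm is conserved on one half-line if \<open>m = 0\<close> (\<open>massless_injective\<close>). There a resonant source
  leads to logarithmic growth, so \<open>L - z\<close> is not onto (\<open>half_line_not_solvable\<close>).

  The passage from estimates to spectra uses a symmetry. The operator \<open>D\<close> without the dislocation
  has real coefficients and is self-adjoint, so the adjoint of \<open>L = D + \<i> sgn\<close> is \<open>J L J\<close> with the
  complex conjugation \<open>J\<close>. Hence the orthogonal complement of the range of \<open>L - z\<close> is the conjugated
  kernel. An estimate modulo the kernel closes the range; then nullity and deficiency agree, the
  index is zero, and a trivial kernel gives a bounded inverse. On the lines the range is dense but
  not everything; so it is not closed, and the symmetry turns approximate null vectors into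
  singular Weyl sequences (locale \<open>conjugation_symmetric_op\<close>).

  The analysis rests on the description of Sobolev functions on the line by their absolutely
  continuous representatives (\<open>weak_derivative_imp_primitive\<close>), for which the product rule
  (\<open>primitive_product\<close>) yields every energy identity, invariant and symmetry used below.
\<close>


section \<open>Complex Hilbert spaces\<close>

lemma cinner_add_left: "cinner (x + y) z = cinner x z + cinner y z"
  for x y z :: "'a::complex_hilbert_space"
  using cinner_commute[of "x + y" z] cinner_commute[of x z] cinner_commute[of y z]
  by (simp add: cinner_add_right)

lemma cinner_scaleC_left: "cinner (a *\<^sub>C x) y = cnj a * cinner x y"
  for x y :: "'a::complex_hilbert_space"
  using cinner_commute[of "a *\<^sub>C x" y] cinner_commute[of x y]
  by (simp add: cinner_scaleC_right)

lemma cinner_zero_right [simp]: "cinner x 0 = 0"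
  for x :: "'a::complex_hilbert_space"
  using cinner_add_right[of x 0 0] by simp

lemma cinner_zero_left [simp]: "cinner 0 x = 0"
  for x :: "'a::complex_hilbert_space"
  using cinner_add_left[of 0 0 x] by simp

lemma cinner_minus_right: "cinner x (- y) = - cinner x y"
  for x y :: "'a::complex_hilbert_space"
  using cinner_add_right[of x y "- y"] by (simp add: add_eq_0_iff)

lemma cinner_diff_right: "cinner x (y - z) = cinner x y - cinner x z"
  for x y z :: "'a::complex_hilbert_space"
  using cinner_add_right[of x y "- z"] by (simp add: cinner_minus_right)

lemma cinner_diff_left: "cinner (x - y) z = cinner x z - cinner y z"
  for x y z :: "'a::complex_hilbert_space"
  using cinner_commute[of "x - y" z] cinner_commute[of x z] cinner_commute[of y z]
  by (simp add: cinner_diff_right)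

lemma cinner_self: "cinner x x = complex_of_real ((norm x)\<^sup>2)"
  for x :: "'a::complex_hilbert_space"
proof -
  have "Im (cinner x x) = 0"
    using arg_cong[OF cinner_commute[of x x], of Im] by simp
  then show ?thesis
    by (simp add: complex_eq_iff power2_norm_eq_inner inner_eq_Re_cinner)
qed

lemma norm_scaleC: "norm (a *\<^sub>C x) = cmod a * norm x"
  for x :: "'a::complex_hilbert_space"
proof -
  have "complex_of_real ((norm (a *\<^sub>C x))\<^sup>2) = complex_of_real ((cmod a * norm x)\<^sup>2)"
    unfolding cinner_self[symmetric] cinner_scaleC_left cinner_scaleC_right
    by (simp add: cinner_self power_mult_distrib complex_norm_square[unfolded of_real_power])
  then show ?thesis
    by (simp only: of_real_eq_iff) (simp add: power2_eq_iff_nonneg)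
qed

lemma cmod_cinner_le: "cmod (cinner x y) \<le> norm x * norm y"
  for x y :: "'a::complex_hilbert_space"
proof (cases "cinner x y = 0")
  case False
  \<comment> \<open>a phase that makes the inner product real\<close>
  define c where "c = cnj (sgn (cinner x y))"
  have c: "cmod c = 1" using False by (simp add: c_def norm_sgn)
  have "c * cinner x y = complex_of_real (cmod (cinner x y))"
    using False complex_norm_square[of "cinner x y"]
    by (simp add: c_def sgn_eq field_simps power2_eq_square)
  then have "cmod (cinner x y) = inner x (c *\<^sub>C y)"
    by (simp add: inner_eq_Re_cinner cinner_scaleC_right)
  also have "\<dots> \<le> norm x * norm (c *\<^sub>C y)" by (rule norm_cauchy_schwarz)
  finally show ?thesis by (simp add: norm_scaleC c)
qed simp

lemma scaleC_minus_one: "(- 1) *\<^sub>C x = - x" for x :: "'a::complex_hilbert_space"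
  by (simp add: complex_vector.scale_minus_left)

lemma tendsto_cinner_right:
  fixes v :: "'a::complex_hilbert_space"
  assumes "u \<longlonglongrightarrow> x"
  shows "(\<lambda>n. cinner v (u n)) \<longlonglongrightarrow> cinner v x"
proof -
  have "(\<lambda>n. u n - x) \<longlonglongrightarrow> 0" using assms by (rule LIM_zero)
  then have "(\<lambda>n. norm v * norm (u n - x)) \<longlonglongrightarrow> 0"
    by (intro tendsto_mult_right_zero tendsto_norm_zero)
  then have "(\<lambda>n. cinner v (u n - x)) \<longlonglongrightarrow> 0"
    by (rule Lim_null_comparison[rotated]) (simp add: cmod_cinner_le)
  then show ?thesis
    by (intro LIM_zero_cancel[where l = "cinner v x"]) (simp add: cinner_diff_right)
qed

text \<open>By the parallelogram law, a minimizing sequence for the distance is a Cauchy sequence; its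
  limit is the foot of the perpendicular.\<close>

lemma orthogonal_projection:
  fixes S :: "'a::{real_inner, complete_space} set"
  assumes S: "subspace S" "closed S"
  shows "\<exists>s\<in>S. \<forall>y\<in>S. inner (h - s) y = 0"
proof -
  define d where "d = Inf ((\<lambda>s. norm (h - s)) ` S)"
  have "0 \<in> S" using S by (simp add: subspace_0)
  have bdd: "bdd_below ((\<lambda>s. norm (h - s)) ` S)" by (rule bdd_belowI[of _ 0]) auto
  have d_le: "d \<le> norm (h - s)" if "s \<in> S" for s
    unfolding d_def using that bdd by (intro cInf_lower) auto
  have d0: "0 \<le> d" unfolding d_def using \<open>0 \<in> S\<close> by (intro cInf_greatest) auto
  have "\<exists>s\<in>S. (norm (h - s))\<^sup>2 < d\<^sup>2 + e" if "e > 0" for e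
  proof -
    have "d < sqrt (d\<^sup>2 + e)" using that d0 by (intro real_less_rsqrt) simp
    then obtain s where s: "s \<in> S" "norm (h - s) < sqrt (d\<^sup>2 + e)"
      unfolding d_def using cInf_lessD[of "(\<lambda>s. norm (h - s)) ` S"] \<open>0 \<in> S\<close> by blast
    have "(norm (h - s))\<^sup>2 < (sqrt (d\<^sup>2 + e))\<^sup>2" using s(2) by (intro power_strict_mono) auto
    also have "\<dots> = d\<^sup>2 + e" using that by simp
    finally show ?thesis using s(1) by blast
  qed
  then have "\<forall>n. \<exists>s\<in>S. (norm (h - s))\<^sup>2 < d\<^sup>2 + inverse (Suc n)" by simp
  then obtain s where s: "\<And>n. s n \<in> S" "\<And>n. (norm (h - s n))\<^sup>2 < d\<^sup>2 + inverse (Suc n)"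
    by metis
  have close: "(norm (s k - s n))\<^sup>2 \<le> 2 * inverse (Suc k) + 2 * inverse (Suc n)" for k n
  proof -
    have mid: "(1/2) *\<^sub>R (s k + s n) \<in> S"
      using S s by (intro subspace_scale subspace_add) auto
    have "d\<^sup>2 \<le> (norm (h - (1/2) *\<^sub>R (s k + s n)))\<^sup>2"
      using d_le[OF mid] d0 by (intro power_mono)
    moreover have "(norm (s k - s n))\<^sup>2 = 2 * (norm (h - s k))\<^sup>2 + 2 * (norm (h - s n))\<^sup>2
        - 4 * (norm (h - (1/2) *\<^sub>R (s k + s n)))\<^sup>2"
      by (simp add: power2_norm_eq_inner inner_diff_left inner_diff_right inner_add_left
          inner_add_right inner_commute field_simps)
    ultimately show ?thesis using s(2)[of k] s(2)[of n] by linarith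
  qed
  have "Cauchy s"
  proof (rule CauchyI)
    fix e :: real assume "e > 0"
    then obtain N where N: "inverse (Suc N) < e\<^sup>2 / 4"
      using reals_Archimedean[of "e\<^sup>2 / 4"] by auto
    have "norm (s k - s n) < e" if "k \<ge> N" "n \<ge> N" for k n
    proof (rule power_less_imp_less_base)
      have "inverse (real (Suc k)) \<le> inverse (Suc N)" "inverse (real (Suc n)) \<le> inverse (Suc N)"
        using that by (auto intro!: le_imp_inverse_le)
      then show "(norm (s k - s n))\<^sup>2 < e\<^sup>2" using close[of k n] N by linarith
    qed (use \<open>e > 0\<close> in simp)
    then show "\<exists>M. \<forall>m\<ge>M. \<forall>n\<ge>M. norm (s m - s n) < e" by blast
  qed
  then obtain x where x: "s \<longlonglongrightarrow> x" using Cauchy_convergent_iff convergent_def by blast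
  have xS: "x \<in> S" using S(2) s(1) x by (metis closed_sequentially)
  have "(\<lambda>n. (norm (h - s n))\<^sup>2) \<longlonglongrightarrow> (norm (h - x))\<^sup>2" by (intro tendsto_intros x)
  moreover have "(\<lambda>n. d\<^sup>2 + inverse (real (Suc n))) \<longlonglongrightarrow> d\<^sup>2 + 0"
    by (intro tendsto_intros LIMSEQ_inverse_real_of_nat)
  ultimately have xd: "(norm (h - x))\<^sup>2 \<le> d\<^sup>2 + 0"
    by (rule LIMSEQ_le) (use s(2) less_imp_le in blast)
  have "inner (h - x) y = 0" if y: "y \<in> S" for y
  proof (cases "y = 0")
    case False
    define t where "t = inner (h - x) y / inner y y"
    have "x + t *\<^sub>R y \<in> S" using S xS y by (intro subspace_add subspace_scale)
    then have "d\<^sup>2 \<le> (norm (h - (x + t *\<^sub>R y)))\<^sup>2"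
      using d_le d0 by (intro power_mono) auto
    also have "\<dots> = (norm (h - x))\<^sup>2 - 2 * t * inner (h - x) y + t * t * inner y y"
      by (simp add: power2_norm_eq_inner inner_diff_left inner_diff_right inner_add_left
          inner_add_right inner_commute algebra_simps)
    also have "\<dots> = (norm (h - x))\<^sup>2 - (inner (h - x) y)\<^sup>2 / inner y y"
      using False by (simp add: t_def field_simps power2_eq_square)
    finally have "(inner (h - x) y)\<^sup>2 / inner y y \<le> 0" using xd by linarith
    then show ?thesis using False inner_ge_zero[of y]
      by (simp add: divide_le_0_iff less_le)
  qed simp
  with xS show ?thesis by blast
qed

lemma complex_subspaceI:
  "complex_vector.subspace S \<Longrightarrow> subspace S" for S :: "'a::complex_hilbert_space set"
  by (simp add: complex_vector.subspace_def subspace_def scaleR_scaleC)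

lemma subspace_closure:
  fixes S :: "'a::real_normed_vector set"
  assumes S: "subspace S"
  shows "subspace (closure S)"
  unfolding subspace_def
proof (intro conjI ballI allI)
  show "0 \<in> closure S" using S closure_subset subspace_0 by blast
next
  fix x y assume "x \<in> closure S" "y \<in> closure S"
  then obtain f g where "\<And>n. f n \<in> S" "f \<longlonglongrightarrow> x" "\<And>n. g n \<in> S" "g \<longlonglongrightarrow> y"
    unfolding closure_sequential by blast
  then have "\<And>n. f n + g n \<in> S" "(\<lambda>n. f n + g n) \<longlonglongrightarrow> x + y"
    by (auto intro: tendsto_add subspace_add[OF S])
  then show "x + y \<in> closure S"
    unfolding closure_sequential by (intro exI[of _ "\<lambda>n. f n + g n"]) blast
next
  fix c x assume "x \<in> closure S"
  then obtain f where "\<And>n. f n \<in> S" "f \<longlonglongrightarrow> x" unfolding closure_sequential by blast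
  then have "\<And>n. c *\<^sub>R f n \<in> S" "(\<lambda>n. c *\<^sub>R f n) \<longlonglongrightarrow> c *\<^sub>R x"
    by (auto intro: tendsto_intros subspace_scale[OF S])
  then show "c *\<^sub>R x \<in> closure S"
    unfolding closure_sequential by (intro exI[of _ "\<lambda>n. c *\<^sub>R f n"]) blast
qed

lemma orthogonal_decomposition:
  fixes S :: "'a::complex_hilbert_space set"
  assumes S: "complex_vector.subspace S"
  obtains s t where "h = s + t" "s \<in> closure S" "\<And>y. y \<in> S \<Longrightarrow> cinner t y = 0"
proof -
  obtain s where s: "s \<in> closure S" "\<forall>y\<in>closure S. inner (h - s) y = 0"
    using orthogonal_projection[OF subspace_closure[OF complex_subspaceI[OF S]] closed_closure] by blast
  have "cinner (h - s) y = 0" if y: "y \<in> S" for y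
  proof -
    have "y \<in> closure S" "\<i> *\<^sub>C y \<in> closure S"
      using y closure_subset complex_vector.subspace_scale[OF S] by blast+
    then have "inner (h - s) y = 0" "inner (h - s) (\<i> *\<^sub>C y) = 0" using s(2) by auto
    then show ?thesis
      by (simp add: inner_eq_Re_cinner cinner_scaleC_right complex_eq_iff)
  qed
  then show thesis using s(1) by (intro that[of s "h - s"]) auto
qed


section \<open>Closed operators symmetric with respect to a conjugation\<close>

text \<open>The last two assumptions express, without mentioning adjoints, what is used of the identity
  \<open>S\<^sup>* = J S J\<close>: the operator \<open>J S J\<close> is contained in the adjoint of \<open>S\<close>, and the kernel of the
  adjoint is no larger than that of \<open>J S J\<close>.\<close>

locale conjugation_symmetric_op =
  fixes S :: "'a::complex_hilbert_space unbounded_op" and J :: "'a \<Rightarrow> 'a"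
  assumes subspace_Dom: "complex_vector.subspace (Dom S)"
    and app_add: "u \<in> Dom S \<Longrightarrow> v \<in> Dom S \<Longrightarrow> app S (u + v) = app S u + app S v"
    and app_scaleC: "u \<in> Dom S \<Longrightarrow> app S (c *\<^sub>C u) = c *\<^sub>C app S u"
    and closed_op: "(\<And>n. f n \<in> Dom S) \<Longrightarrow> f \<longlonglongrightarrow> u \<Longrightarrow> (\<lambda>n. app S (f n)) \<longlonglongrightarrow> w \<Longrightarrow>
      u \<in> Dom S \<and> app S u = w"
    and J_J: "J (J x) = x"
    and J_diff: "J (x - y) = J x - J y"
    and J_scaleC: "J (c *\<^sub>C x) = cnj c *\<^sub>C J x"
    and norm_J: "norm (J x) = norm x"
    and symmetric: "u \<in> Dom S \<Longrightarrow> w \<in> Dom S \<Longrightarrow> cinner (J (app S w)) u = cinner (J w) (app S u)"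
    and orthogonal_ran: "(\<And>u. u \<in> Dom S \<Longrightarrow> cinner v (app S u) = 0) \<Longrightarrow> J v \<in> ker_op S"
begin

lemma Dom_diff: "u \<in> Dom S \<Longrightarrow> v \<in> Dom S \<Longrightarrow> u - v \<in> Dom S"
  by (rule complex_vector.subspace_diff[OF subspace_Dom])

lemma Dom_scaleC: "u \<in> Dom S \<Longrightarrow> c *\<^sub>C u \<in> Dom S"
  by (rule complex_vector.subspace_scale[OF subspace_Dom])

lemma zero_Dom: "0 \<in> Dom S"
  by (rule complex_vector.subspace_0[OF subspace_Dom])

lemma app_zero: "app S 0 = 0"
  using app_scaleC[OF zero_Dom, of 0] by simp

lemma app_diff:
  assumes "u \<in> Dom S" "v \<in> Dom S"
  shows "app S (u - v) = app S u - app S v"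
  using app_add[OF assms(1) Dom_scaleC[OF assms(2)], of "- 1"] app_scaleC[OF assms(2), of "- 1"]
  by (simp add: scaleC_minus_one)

lemma J_zero: "J 0 = 0"
  using J_diff[of 0 0] by simp

lemma subspace_ran: "complex_vector.subspace (ran_op S)"
proof (rule complex_vector.subspaceI)
  show "0 \<in> ran_op S" unfolding ran_op_def using app_zero zero_Dom by force
  show "x + y \<in> ran_op S" if "x \<in> ran_op S" "y \<in> ran_op S" for x y
  proof -
    from that obtain u v where uv: "u \<in> Dom S" "v \<in> Dom S" "x = app S u" "y = app S v"
      by (auto simp: ran_op_def)
    then have "x + y = app S (u + v)" "u + v \<in> Dom S"
      by (simp_all add: app_add complex_vector.subspace_add[OF subspace_Dom])
    then show ?thesis by (auto simp: ran_op_def)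
  qed
  show "c *\<^sub>C x \<in> ran_op S" if "x \<in> ran_op S" for c x
  proof -
    from that obtain u where u: "u \<in> Dom S" "x = app S u"
      by (auto simp: ran_op_def)
    then have "c *\<^sub>C x = app S (c *\<^sub>C u)" "c *\<^sub>C u \<in> Dom S"
      by (simp_all add: app_scaleC Dom_scaleC)
    then show ?thesis by (auto simp: ran_op_def)
  qed
qed

lemma subspace_ker: "complex_vector.subspace (ker_op S)"
  by (rule complex_vector.subspaceI)
    (auto simp: ker_op_def zero_Dom app_zero app_add app_scaleC Dom_scaleC
      complex_vector.subspace_add[OF subspace_Dom])

lemma inj_iff_ker: "inj_on (app S) (Dom S) \<longleftrightarrow> ker_op S = {0}"
proof
  assume "inj_on (app S) (Dom S)"
  then show "ker_op S = {0}"
    using app_zero zero_Dom by (auto simp: ker_op_def inj_on_def)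
next
  assume ker: "ker_op S = {0}"
  show "inj_on (app S) (Dom S)"
  proof (rule inj_onI)
    fix u v assume "u \<in> Dom S" "v \<in> Dom S" "app S u = app S v"
    then have "u - v \<in> ker_op S" by (simp add: ker_op_def Dom_diff app_diff)
    then show "u = v" using ker by simp
  qed
qed

text \<open>What is orthogonal to the range is conjugate to an element of the kernel; so a closed range
  misses only the conjugated kernel.\<close>

lemma closed_ran_decomposition:
  assumes "closed (ran_op S)"
  obtains s k where "h = s + J k" "s \<in> ran_op S" "k \<in> ker_op S"
proof -
  obtain s t where st: "h = s + t" "s \<in> ran_op S" "\<And>y. y \<in> ran_op S \<Longrightarrow> cinner t y = 0"
    using orthogonal_decomposition[OF subspace_ran, of h] closure_closed[OF assms] by metis
  then have "J t \<in> ker_op S" by (intro orthogonal_ran) (auto simp: ran_op_def)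
  then show thesis using st by (intro that[of s "J t"]) (auto simp: J_J)
qed

lemma cinner_J_ker_ran:
  assumes "k \<in> ker_op S" "y \<in> ran_op S"
  shows "cinner (J k) y = 0"
  using assms symmetric[of _ k] by (auto simp: ker_op_def ran_op_def J_zero)

lemma dense_ran:
  assumes "ker_op S = {0}"
  shows "closure (ran_op S) = UNIV"
proof -
  have "h \<in> closure (ran_op S)" for h
  proof -
    obtain s t where st: "h = s + t" "s \<in> closure (ran_op S)" "\<And>y. y \<in> ran_op S \<Longrightarrow> cinner t y = 0"
      using orthogonal_decomposition[OF subspace_ran, of h] by blast
    have "J t \<in> ker_op S" by (intro orthogonal_ran st(3)) (auto simp: ran_op_def)
    then have "t = 0" using assms J_J[of t] J_zero by simp
    then show ?thesis using st by simp
  qed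
  then show ?thesis by blast
qed

text \<open>The estimate only controls the distance to the kernel; the component orthogonal to the
  kernel is then bounded by the image, so a convergent sequence of images has convergent
  preimages.\<close>

lemma closed_ran:
  assumes C: "\<And>u. u \<in> Dom S \<Longrightarrow> \<exists>k\<in>ker_op S. norm (u - k) \<le> C * norm (app S u)"
  shows "closed (ran_op S)"
proof -
  have closed_ker: "closed (ker_op S)"
  proof (unfold closed_sequential_limits, intro allI impI)
    fix f l assume f: "(\<forall>n. f n \<in> ker_op S) \<and> f \<longlonglongrightarrow> l"
    then have "l \<in> Dom S \<and> app S l = 0"
      by (intro closed_op[of f]) (auto simp: ker_op_def)
    then show "l \<in> ker_op S" by (simp add: ker_op_def)
  qed
  \<comment> \<open>On the part of the domain orthogonal to the kernel, the distance to the kernel is the norm.\<close>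
  define D where "D = {u \<in> Dom S. \<forall>k\<in>ker_op S. cinner u k = 0}"
  have D_diff: "u - v \<in> D" if "u \<in> D" "v \<in> D" for u v
    using that by (auto simp: D_def Dom_diff cinner_diff_left)
  have bound: "norm u \<le> C * norm (app S u)" if u: "u \<in> D" for u
  proof -
    obtain k where k: "k \<in> ker_op S" "norm (u - k) \<le> C * norm (app S u)"
      using C[of u] u by (auto simp: D_def)
    have "cinner u k = 0" using u k by (simp add: D_def)
    then have "inner u k = 0" by (simp add: inner_eq_Re_cinner)
    then have "(norm u)\<^sup>2 \<le> (norm (u - k))\<^sup>2"
      by (simp add: power2_norm_eq_inner inner_diff_left inner_diff_right inner_commute)
    then have "norm u \<le> norm (u - k)" by (rule power2_le_imp_le) simp
    with k(2) show ?thesis by simp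
  qed
  have ex: "\<exists>u\<in>D. app S u = y" if "y \<in> ran_op S" for y
  proof -
    from that obtain w where w: "w \<in> Dom S" "y = app S w" by (auto simp: ran_op_def)
    obtain s t where st: "w = s + t" "s \<in> ker_op S" "\<And>k. k \<in> ker_op S \<Longrightarrow> cinner t k = 0"
      using orthogonal_decomposition[OF subspace_ker, of w] closure_closed[OF closed_ker] by metis
    have s: "s \<in> Dom S" "app S s = 0" using st(2) by (auto simp: ker_op_def)
    have t: "t = w - s" using st(1) by simp
    have "t \<in> Dom S" "app S t = y" unfolding t using s w by (simp_all add: Dom_diff app_diff)
    then show ?thesis using st(3) by (auto simp: D_def)
  qed
  show ?thesis
  proof (unfold closed_sequential_limits, intro allI impI)
    fix y l assume y: "(\<forall>n. y n \<in> ran_op S) \<and> y \<longlonglongrightarrow> l"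
    then have "\<forall>n. \<exists>u. u \<in> D \<and> app S u = y n" using ex by blast
    from choice[OF this] obtain u where "\<forall>n. u n \<in> D \<and> app S (u n) = y n" ..
    then have u: "\<And>n. u n \<in> D" "\<And>n. app S (u n) = y n" by auto
    have uD: "u n \<in> Dom S" for n using u(1)[of n] by (simp add: D_def)
    have "Cauchy y" using y LIMSEQ_imp_Cauchy by blast
    have "Cauchy u"
    proof (rule CauchyI)
      fix e :: real assume e: "e > 0"
      define e' where "e' = e / (\<bar>C\<bar> + 1)"
      have "e' > 0" using e by (simp add: e'_def add_nonneg_pos)
      then obtain N where N: "\<And>m n. m \<ge> N \<Longrightarrow> n \<ge> N \<Longrightarrow> norm (y m - y n) < e'"
        using CauchyD[OF \<open>Cauchy y\<close>] by blast
      have "norm (u m - u n) < e" if mn: "m \<ge> N" "n \<ge> N" for m n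
      proof -
        have "norm (u m - u n) \<le> C * norm (y m - y n)"
          using bound[OF D_diff[OF u(1) u(1)], of m n] by (simp add: app_diff uD u(2))
        also have "\<dots> \<le> (\<bar>C\<bar> + 1) * norm (y m - y n)" by (intro mult_right_mono) auto
        also have "\<dots> < (\<bar>C\<bar> + 1) * e'" using N[OF mn] by (intro mult_strict_left_mono) auto
        also have "\<dots> = e" by (simp add: e'_def add_nonneg_eq_0_iff)
        finally show ?thesis .
      qed
      then show "\<exists>M. \<forall>m\<ge>M. \<forall>n\<ge>M. norm (u m - u n) < e" by blast
    qed
    then obtain x where x: "u \<longlonglongrightarrow> x" using Cauchy_convergent_iff convergent_def by blast
    have "x \<in> Dom S \<and> app S x = l"
      using uD x y by (intro closed_op[of u]) (simp_all add: u(2))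
    then show "l \<in> ran_op S" by (auto simp: ran_op_def)
  qed
qed

lemma nullity_zero: "ker_op S = {0} \<Longrightarrow> nullity S = 0"
proof -
  assume ker: "ker_op S = {0}"
  have "complex_vector.dim {0::'a} = complex_vector.dim (complex_vector.span {} :: 'a set)"
    by (simp only: complex_vector.span_empty)
  also have "\<dots> = card ({} :: 'a set)"
    by (rule complex_vector.dim_span_eq_card_independent[OF complex_vector.independent_empty])
  finally have "complex_vector.dim {0::'a} = 0" by simp
  moreover have "{0::'a} \<subseteq> complex_vector.span {}" by simp
  ultimately show ?thesis unfolding nullity_def ker
    by (auto simp: zero_enat_def)
qed

lemma deficiency_zero_iff: "deficiency S = 0 \<longleftrightarrow> ran_op S = UNIV"
proof
  assume "ran_op S = UNIV"
  then have "deficiency S \<le> enat (card ({} :: 'a set))" unfolding deficiency_def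
    by (intro INF_lower) auto
  then show "deficiency S = 0" by (simp flip: zero_enat_def)
next
  assume 0: "deficiency S = 0"
  have "\<exists>B. finite B \<and> complex_vector.span (ran_op S \<union> B) = UNIV \<and> card B = 0"
  proof (rule ccontr)
    assume *: "\<not> ?thesis"
    have "1 \<le> deficiency S" unfolding deficiency_def
      using * by (intro INF_greatest) (auto simp: one_enat_def Suc_le_eq)
    with 0 show False by simp
  qed
  then have "complex_vector.span (ran_op S) = UNIV" by auto
  then show "ran_op S = UNIV" using subspace_ran by (simp add: complex_vector.span_eq_iff[THEN iffD2])
qed

definition bounded_below_mod_ker :: bool where
  "bounded_below_mod_ker \<longleftrightarrow>
     (\<exists>C. \<forall>u\<in>Dom S. \<exists>k\<in>ker_op S. norm (u - k) \<le> C * norm (app S u))"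

text \<open>Such a sequence approaches the kernel; weak and strong convergence agree in a
  one-dimensional kernel, which contradicts the normalization.\<close>

lemma no_singular_weyl_sequence:
  assumes bb: bounded_below_mod_ker
    and ker: "ker_op S = complex_vector.span {k0}"
  shows "\<not> singular_weyl_sequence S u"
proof
  assume "singular_weyl_sequence S u"
  then have u: "\<And>n. u n \<in> Dom S" "\<And>n. norm (u n) = 1"
    and weak: "\<And>v. (\<lambda>n. cinner v (u n)) \<longlonglongrightarrow> 0" and lim: "(\<lambda>n. app S (u n)) \<longlonglongrightarrow> 0"
    by (auto simp: singular_weyl_sequence_def)
  obtain C where C: "\<And>u. u \<in> Dom S \<Longrightarrow> \<exists>k\<in>ker_op S. norm (u - k) \<le> C * norm (app S u)"
    using bb by (auto simp: bounded_below_mod_ker_def)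
  then have "\<forall>n. \<exists>k\<in>ker_op S. norm (u n - k) \<le> C * norm (app S (u n))" using u by blast
  then obtain k where k: "\<And>n. k n \<in> ker_op S" "\<And>n. norm (u n - k n) \<le> C * norm (app S (u n))"
    by metis
  have "(\<lambda>n. C * norm (app S (u n))) \<longlonglongrightarrow> 0"
    using lim by (intro tendsto_mult_right_zero tendsto_norm_zero)
  then have uk: "(\<lambda>n. u n - k n) \<longlonglongrightarrow> 0"
    by (rule Lim_null_comparison[rotated]) (simp add: k(2))
  have "(\<lambda>n. cinner k0 (u n) - cinner k0 (u n - k n)) \<longlonglongrightarrow> 0 - cinner k0 0"
    by (intro tendsto_diff weak tendsto_cinner_right uk)
  then have k0: "(\<lambda>n. cinner k0 (k n)) \<longlonglongrightarrow> 0" by (simp add: cinner_diff_right)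
  have "\<forall>n. \<exists>c. k n = c *\<^sub>C k0"
    using k(1) unfolding ker complex_vector.span_singleton by blast
  then obtain c where c: "\<And>n. k n = c n *\<^sub>C k0" by metis
  have "cmod (cinner k0 (k n)) = norm k0 * norm (k n)" for n
    by (simp add: c cinner_scaleC_right cinner_self norm_mult norm_scaleC power2_eq_square
        flip: of_real_power)
  then have *: "(\<lambda>n. norm k0 * norm (k n)) \<longlonglongrightarrow> 0"
    using tendsto_norm_zero[OF k0] by simp
  have "(\<lambda>n. norm (k n)) \<longlonglongrightarrow> 0"
  proof (cases "k0 = 0")
    case False
    then show ?thesis using tendsto_mult_right[OF *, of "inverse (norm k0)"]
      by (simp flip: mult.assoc)
  qed (simp add: c)
  then have "k \<longlonglongrightarrow> 0" by (rule tendsto_norm_zero_cancel)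
  then have "(\<lambda>n. (u n - k n) + k n) \<longlonglongrightarrow> 0 + 0"
    by (rule tendsto_add[OF uk])
  then have "(\<lambda>n. norm (u n)) \<longlonglongrightarrow> 0" by (intro tendsto_norm_zero) simp
  then show False by (simp add: u(2) LIMSEQ_const_iff)
qed

text \<open>The estimate closes the range and the trivial kernel makes it dense; so the operator is onto,
  and the same estimate bounds its inverse.\<close>

lemma bounded_inverse:
  assumes bb: bounded_below_mod_ker and ker: "ker_op S = {0}"
  shows "boundedly_invertible S" "ran_op S = UNIV" "fredholm S" "fredholm_index S = 0"
    "\<not> singular_weyl_sequence S u"
proof -
  obtain C where "\<And>u. u \<in> Dom S \<Longrightarrow> \<exists>k\<in>ker_op S. norm (u - k) \<le> C * norm (app S u)"
    using bb by (auto simp: bounded_below_mod_ker_def)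
  then have C: "\<And>u. u \<in> Dom S \<Longrightarrow> norm u \<le> C * norm (app S u)" and cl: "closed (ran_op S)"
    using ker closed_ran[of C] by auto
  show ran: "ran_op S = UNIV" using dense_ran[OF ker] cl by simp
  then have bij: "bij_betw (app S) (Dom S) UNIV"
    using inj_iff_ker ker by (simp add: bij_betw_def ran_op_def)
  have "norm (inv_into (Dom S) (app S) v) \<le> C * norm v" for v
  proof -
    have v: "v \<in> app S ` Dom S" using ran by (simp add: ran_op_def)
    show ?thesis using C[OF inv_into_into[OF v]] by (simp add: f_inv_into_f[OF v])
  qed
  then show "boundedly_invertible S" using bij by (auto simp: boundedly_invertible_def)
  show "fredholm S" "fredholm_index S = 0"
    using cl nullity_zero[OF ker] deficiency_zero_iff ran
    by (simp_all add: fredholm_def fredholm_index_def zero_enat_def)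
  show "\<not> singular_weyl_sequence S u"
    by (rule no_singular_weyl_sequence[OF bb, of 0]) (simp only: ker complex_vector.span_singleton, force)
qed

text \<open>The orthogonal complement of the closed range is the conjugated kernel, so it has the same
  dimension as the kernel.\<close>

lemma one_dimensional_kernel:
  assumes bb: bounded_below_mod_ker and ker: "ker_op S = complex_vector.span {k}" and "k \<noteq> 0"
  shows "fredholm S" "fredholm_index S = 0" "\<not> singular_weyl_sequence S u"
proof -
  obtain C where C: "\<And>u. u \<in> Dom S \<Longrightarrow> \<exists>k\<in>ker_op S. norm (u - k) \<le> C * norm (app S u)"
    using bb by (auto simp: bounded_below_mod_ker_def)
  have cl: "closed (ran_op S)" by (rule closed_ran[OF C])
  have "complex_vector.dim (ker_op S) = card {k}"
    unfolding ker by (rule complex_vector.dim_span_eq_card_independent)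
      (simp add: \<open>k \<noteq> 0\<close> complex_vector.dependent_single)
  then have null: "nullity S = 1"
  proof -
    have "\<exists>B. finite B \<and> ker_op S \<subseteq> complex_vector.span B"
      using ker by (intro exI[of _ "{k}"]) simp
    then show ?thesis
      unfolding nullity_def by (simp add: \<open>complex_vector.dim (ker_op S) = card {k}\<close> one_enat_def)
  qed
  have "h \<in> complex_vector.span (ran_op S \<union> {J k})" for h
  proof -
    obtain s k' where sk: "h = s + J k'" "s \<in> ran_op S" "k' \<in> ker_op S"
      using closed_ran_decomposition[OF cl, of h] by blast
    then obtain c where "k' = c *\<^sub>C k" unfolding ker complex_vector.span_singleton by blast
    then have "h = s + cnj c *\<^sub>C J k" using sk(1) by (simp add: J_scaleC)
    moreover have "s \<in> complex_vector.span (ran_op S \<union> {J k})"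
      using sk(2) by (intro complex_vector.span_base) simp
    moreover have "cnj c *\<^sub>C J k \<in> complex_vector.span (ran_op S \<union> {J k})"
      by (intro complex_vector.span_scale complex_vector.span_base) simp
    ultimately show ?thesis by (simp only: complex_vector.span_add)
  qed
  then have "deficiency S \<le> enat (card {J k})" unfolding deficiency_def
    by (intro INF_lower) auto
  moreover have "deficiency S \<noteq> 0"
  proof
    assume "deficiency S = 0"
    then have "J k \<in> ran_op S" using deficiency_zero_iff by simp
    moreover have "k \<in> ker_op S" unfolding ker by (simp add: complex_vector.span_base)
    ultimately have "cinner (J k) (J k) = 0" by (simp add: cinner_J_ker_ran)
    then have "J k = 0" by (simp add: cinner_self flip: of_real_power)
    then show False using norm_J[of k] \<open>k \<noteq> 0\<close> by simp
  qed
  ultimately have "deficiency S = 1"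
  proof -
    assume "deficiency S \<le> enat (card {J k})" "deficiency S \<noteq> 0"
    then obtain n where "deficiency S = enat n" "n \<le> 1" "n \<noteq> 0"
      by (cases "deficiency S") (simp_all add: zero_enat_def)
    then show ?thesis by (simp add: one_enat_def)
  qed
  then show "fredholm S" "fredholm_index S = 0"
    using cl null by (simp_all add: fredholm_def fredholm_index_def one_enat_def)
  show "\<not> singular_weyl_sequence S u" by (rule no_singular_weyl_sequence[OF bb ker])
qed

text \<open>An operator that is bounded below would have a closed range; so there are unit vectors with
  images tending to zero. They converge weakly to zero: by symmetry, their inner products with
  the conjugates of range vectors tend to zero, and these conjugates are dense.\<close>

lemma injective_not_surjective:
  assumes ker: "ker_op S = {0}" and ran: "ran_op S \<noteq> UNIV"
  shows "\<not> closed (ran_op S)" "\<exists>u. singular_weyl_sequence S u"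
proof -
  show not_closed: "\<not> closed (ran_op S)" using dense_ran[OF ker] ran by (metis closure_closed)
  have "\<exists>u\<in>Dom S. norm u > real n * norm (app S u)" for n :: nat
  proof (rule ccontr)
    assume *: "\<not> ?thesis"
    have "\<exists>k\<in>ker_op S. norm (u - k) \<le> real n * norm (app S u)" if "u \<in> Dom S" for u
      using * that unfolding ker by (simp add: not_less)
    then have "closed (ran_op S)" by (rule closed_ran)
    with not_closed show False by simp
  qed
  then obtain f where f: "\<And>n. f n \<in> Dom S" "\<And>n::nat. norm (f n) > real n * norm (app S (f n))"
    by metis
  have pos: "norm (f n) > 0" for n
    by (rule le_less_trans[OF _ f(2)]) simp
  define u where "u n = complex_of_real (inverse (norm (f n))) *\<^sub>C f n" for n
  have uD: "u n \<in> Dom S" for n by (simp add: u_def Dom_scaleC f)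
  have un: "norm (u n) = 1" for n using pos[of n] by (simp add: u_def norm_scaleC norm_inverse)
  have Su: "real n * norm (app S (u n)) \<le> 1" for n
  proof -
    have "real n * norm (app S (u n)) = real n * norm (app S (f n)) / norm (f n)"
      by (simp add: u_def app_scaleC f norm_scaleC norm_inverse divide_inverse)
    also have "\<dots> \<le> 1" using f(2)[of n] pos[of n] by (simp add: divide_le_eq)
    finally show ?thesis .
  qed
  have Su0: "(\<lambda>n. app S (u n)) \<longlonglongrightarrow> 0"
  proof (rule Lim_null_comparison)
    show "\<forall>\<^sub>F n in sequentially. norm (app S (u n)) \<le> 1 / real n"
      using Su by (auto intro!: eventually_sequentiallyI[of 1] simp: field_simps)
  qed (rule lim_1_over_n)
  have "(\<lambda>n. cinner v (u n)) \<longlonglongrightarrow> 0" for v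
  proof (rule tendsto_norm_zero_cancel, rule order_tendstoI)
    show "\<forall>\<^sub>F n in sequentially. a < norm (cinner v (u n))" if "a < 0" for a
      using that by (intro always_eventually allI) (meson less_le_trans norm_ge_zero)
    fix e :: real assume e: "0 < e"
    have "J v \<in> closure (ran_op S)" using dense_ran[OF ker] by simp
    then obtain y where y: "y \<in> ran_op S" "dist y (J v) < e / 2"
      using closure_approachable[of "J v"] e by (metis half_gt_zero)
    then obtain w where w: "w \<in> Dom S" "y = app S w" by (auto simp: ran_op_def)
    have close: "norm (v - J y) < e / 2"
      using y(2) norm_J[of "J v - y"] by (simp add: J_diff J_J dist_norm norm_minus_commute)
    have "(\<lambda>n. norm (cinner (J w) (app S (u n)))) \<longlonglongrightarrow> norm (cinner (J w) 0)"
      by (intro tendsto_norm tendsto_cinner_right Su0)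
    then have "\<forall>\<^sub>F n in sequentially. norm (cinner (J w) (app S (u n))) < e / 2"
      using e by (intro order_tendstoD(2)) auto
    then show "\<forall>\<^sub>F n in sequentially. norm (cinner v (u n)) < e"
    proof eventually_elim
      case (elim n)
      have "cinner v (u n) = cinner (v - J y) (u n) + cinner (J y) (u n)"
        by (simp add: cinner_diff_left)
      also have "cinner (J y) (u n) = cinner (J w) (app S (u n))"
        unfolding w(2) by (rule symmetric[OF uD w(1)])
      finally have "norm (cinner v (u n)) \<le> norm (cinner (v - J y) (u n)) + norm (cinner (J w) (app S (u n)))"
        by (metis norm_triangle_ineq)
      also have "norm (cinner (v - J y) (u n)) \<le> norm (v - J y)"
        using cmod_cinner_le[of "v - J y" "u n"] by (simp add: un)
      finally show ?case using elim close by linarith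
    qed
  qed
  then show "\<exists>u. singular_weyl_sequence S u"
    using uD un Su0 unfolding singular_weyl_sequence_def by blast
qed

end

section \<open>Primitives of locally integrable functions\<close>

text \<open>\<open>F\<close> is locally absolutely continuous with derivative \<open>f\<close>, expressed by the fundamental
  theorem of calculus.\<close>

definition is_primitive :: "(real \<Rightarrow> 'a::euclidean_space) \<Rightarrow> (real \<Rightarrow> 'a) \<Rightarrow> bool" where
  "is_primitive F f \<longleftrightarrow> f \<in> borel_measurable borel \<and>
     (\<forall>a b. a \<le> b \<longrightarrow>
       has_bochner_integral lborel (\<lambda>x. indicator {a..b} x *\<^sub>R f x) (F b - F a))"

lemma primitive_measurable: "is_primitive F f \<Longrightarrow> f \<in> borel_measurable borel"
  by (simp add: is_primitive_def)

lemma primitive_integrable: "is_primitive F f \<Longrightarrow> set_integrable lborel {a..b} f"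
  by (cases "a \<le> b") (auto simp: is_primitive_def set_integrable_def has_bochner_integral_iff)

lemma primitive_integral: "is_primitive F f \<Longrightarrow> a \<le> b \<Longrightarrow> (LBINT x:{a..b}. f x) = F b - F a"
  by (auto simp: is_primitive_def set_lebesgue_integral_def has_bochner_integral_iff)

lemma is_primitiveI:
  assumes "f \<in> borel_measurable borel" "\<And>a b. a \<le> b \<Longrightarrow> set_integrable lborel {a..b} f"
    and "\<And>a b. a \<le> b \<Longrightarrow> (LBINT x:{a..b}. f x) = F b - F a"
  shows "is_primitive F f"
  using assms
  by (auto simp: is_primitive_def set_lebesgue_integral_def set_integrable_def has_bochner_integral_iff)

lemma primitive_add:
  "is_primitive F f \<Longrightarrow> is_primitive G g \<Longrightarrow> is_primitive (\<lambda>x. F x + G x) (\<lambda>x. f x + g x)"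
  unfolding is_primitive_def
  by (auto simp: scaleR_add_right add_diff_add)

lemma primitive_bounded_linear:
  fixes T :: "'a::euclidean_space \<Rightarrow> 'b::euclidean_space"
  assumes T: "bounded_linear T" and "is_primitive F f"
  shows "is_primitive (\<lambda>x. T (F x)) (\<lambda>x. T (f x))"
proof -
  interpret bounded_linear T by (rule T)
  have [measurable]: "T \<in> borel_measurable borel"
    by (intro borel_measurable_continuous_onI linear_continuous_on T)
  show ?thesis
    using assms(2) unfolding is_primitive_def
    by (auto simp: scaleR[symmetric] diff[symmetric] intro!: has_bochner_integral_bounded_linear[OF T])
qed

lemma primitive_diff:
  assumes "is_primitive F f" "is_primitive G g"
  shows "is_primitive (\<lambda>x. F x - G x) (\<lambda>x. f x - g x)"
  using primitive_add[OF assms(1) primitive_bounded_linear[OF bounded_linear_minus[OF bounded_linear_ident] assms(2)]]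
  by simp

lemma primitive_cmult:
  fixes F f :: "real \<Rightarrow> complex"
  shows "is_primitive F f \<Longrightarrow> is_primitive (\<lambda>x. c * F x) (\<lambda>x. c * f x)"
  by (rule primitive_bounded_linear[OF bounded_linear_mult_right])

lemma primitive_const: "is_primitive (\<lambda>x. c) (\<lambda>x. 0)"
  by (auto simp: is_primitive_def has_bochner_integral_zero)

lemma primitive_cong_AE:
  assumes F: "is_primitive F f" and g: "g \<in> borel_measurable borel" and fg: "AE x in lborel. f x = g x"
  shows "is_primitive F g"
proof -
  note [measurable] = primitive_measurable[OF F] g
  have "has_bochner_integral lborel (\<lambda>x. indicator {a..b} x *\<^sub>R g x) (F b - F a)" if "a \<le> b" for a b
  proof -
    have "has_bochner_integral lborel (\<lambda>x. indicator {a..b} x *\<^sub>R f x) (F b - F a)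
        = has_bochner_integral lborel (\<lambda>x. indicator {a..b} x *\<^sub>R g x) (F b - F a)"
    proof (rule has_bochner_integral_cong_AE)
      show "AE x in lborel. indicator {a..b} x *\<^sub>R f x = indicator {a..b} x *\<^sub>R g x"
        using fg by eventually_elim simp
    qed measurable
    then show ?thesis using F that by (simp add: is_primitive_def)
  qed
  then show ?thesis using g by (simp add: is_primitive_def)
qed

lemma primitive_derivative:
  fixes F :: "real \<Rightarrow> 'a::euclidean_space"
  assumes "\<And>x. (F has_vector_derivative f x) (at x)" "continuous_on UNIV f"
  shows "is_primitive F f"
  unfolding is_primitive_def
proof (intro conjI allI impI)
  show "f \<in> borel_measurable borel" using assms(2) by (rule borel_measurable_continuous_onI)
  show "has_bochner_integral lborel (\<lambda>x. indicator {a..b} x *\<^sub>R f x) (F b - F a)" if "a \<le> b" for a b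
  proof (rule has_bochner_integral_FTC_Icc[OF that])
    show "(F has_vector_derivative f x) (at x within {a..b})" for x
      using assms(1) by (rule has_vector_derivative_at_within)
    show "continuous_on {a..b} f" using assms(2) by (rule continuous_on_subset) simp
  qed
qed

lemma primitive_reflect:
  assumes "is_primitive F f"
  shows "is_primitive (\<lambda>x. F (- x)) (\<lambda>x. - f (- x))"
proof -
  note [measurable] = primitive_measurable[OF assms]
  have "has_bochner_integral lborel (\<lambda>x. indicator {a..b} x *\<^sub>R (- f (- x))) (F (- b) - F (- a))"
    if "a \<le> b" for a b
  proof -
    have "has_bochner_integral lborel (\<lambda>x. - (indicator {-b..-a} x *\<^sub>R f x)) (- (F (- a) - F (- b)))"
      using assms that unfolding is_primitive_def by (intro has_bochner_integral_minus) auto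
    then have "has_bochner_integral lborel (\<lambda>x. - (indicator {-b..-a} (0 + (- 1) * x) *\<^sub>R f (0 + (- 1) * x)))
        ((- (F (- a) - F (- b))) /\<^sub>R \<bar>- 1\<bar>)"
      by (subst lborel_has_bochner_integral_real_affine_iff[of "- 1", symmetric]) auto
    moreover have "indicator {-b..-a} (- x) = (indicator {a..b} x :: real)" for x :: real
      by (auto simp: indicator_def)
    ultimately show ?thesis by simp
  qed
  then show ?thesis unfolding is_primitive_def by auto
qed

lemma primitive_continuous:
  assumes "is_primitive F f"
  shows "continuous_on UNIV F"
proof -
  have "isCont F x" for x
  proof -
    have *: "F y = F (x - 1) + integral {x-1..y} f" if "y \<in> {x-1..x+1}" for y
      using primitive_integral[OF assms, of "x-1" y] that
        set_borel_integral_eq_integral(2)[OF primitive_integrable[OF assms, of "x-1" y]] by simp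
    have "f integrable_on {x-1..x+1}"
      by (rule set_borel_integral_eq_integral(1)[OF primitive_integrable[OF assms]])
    then have "continuous_on {x-1..x+1} (\<lambda>y. F (x - 1) + integral {x-1..y} f)"
      by (intro continuous_on_add[OF continuous_on_const] indefinite_integral_continuous_1)
    then have "continuous_on {x-1..x+1} F"
      by (rule continuous_on_eq) (rule *[symmetric])
    then have "continuous_on {x-1<..<x+1} F" by (rule continuous_on_subset) auto
    then show ?thesis by (simp add: continuous_on_eq_continuous_at)
  qed
  then show ?thesis by (simp add: continuous_at_imp_continuous_on)
qed

lemma set_integral_Icc_split:
  fixes f :: "real \<Rightarrow> 'a::euclidean_space"
  assumes "set_integrable lborel {a..c} f" "a \<le> b" "b \<le> c"
  shows "(LBINT x:{a..c}. f x) = (LBINT x:{a..b}. f x) + (LBINT x:{b..c}. f x)"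
proof -
  have "AE x in lborel. x \<noteq> b" by (rule AE_lborel_singleton)
  then have "AE x in lborel. \<not> (x \<in> {a..b} \<and> x \<in> {b..c})" by eventually_elim auto
  moreover have "{a..c} = {a..b} \<union> {b..c}" using assms by auto
  ultimately show ?thesis
    using assms by (auto intro!: set_integral_Un_AE intro: set_integrable_subset)
qed

lemma bilinear_measurable:
  fixes prod :: "'a::euclidean_space \<Rightarrow> 'b::euclidean_space \<Rightarrow> 'c::euclidean_space"
  assumes "bounded_bilinear prod" and [measurable]: "u \<in> borel_measurable borel" "v \<in> borel_measurable borel"
  shows "(\<lambda>x. prod (u x) (v x)) \<in> borel_measurable borel"
proof -
  have "(\<lambda>p. prod (fst p) (snd p)) \<in> borel_measurable (borel :: ('a \<times> 'b) measure)"
    by (intro borel_measurable_continuous_onI bounded_bilinear.continuous_on[OF assms(1)] continuous_intros)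
  from measurable_compose[OF _ this, of "\<lambda>x. (u x, v x)"] show ?thesis by simp
qed

lemma set_integrable_bilinear:
  fixes prod :: "'a::euclidean_space \<Rightarrow> 'b::euclidean_space \<Rightarrow> 'c::euclidean_space"
  assumes bil: "bounded_bilinear prod" and F: "is_primitive F f" and H: "continuous_on UNIV H"
  shows "set_integrable lborel {a..b} (\<lambda>x. prod (f x) (H x))"
proof -
  have [measurable]: "(\<lambda>x. prod (f x) (H x)) \<in> borel_measurable borel"
    by (rule bilinear_measurable[OF bil primitive_measurable[OF F] borel_measurable_continuous_onI[OF H]])
  obtain K where K: "K > 0" "\<And>x y. norm (prod x y) \<le> norm x * norm y * K"
    using bounded_bilinear.pos_bounded[OF bil] by blast
  have "bounded (H ` {a..b})"
    by (intro compact_imp_bounded compact_continuous_image continuous_on_subset[OF H]) auto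
  then obtain M where M: "M > 0" "\<And>x. x \<in> {a..b} \<Longrightarrow> norm (H x) \<le> M"
    by (auto simp: bounded_pos)
  have M': "norm (prod (f x) (H x)) \<le> norm ((M * K) *\<^sub>R f x)" if "x \<in> {a..b}" for x
  proof -
    have "norm (prod (f x) (H x)) \<le> norm (f x) * norm (H x) * K" by (rule K)
    also have "\<dots> \<le> norm (f x) * M * K"
      using M that K by (intro mult_right_mono mult_left_mono) auto
    finally show ?thesis using M K by (simp add: mult_ac)
  qed
  show ?thesis
    by (rule set_integrable_bound[where f = "\<lambda>x. (M * K) *\<^sub>R f x"])
      (use primitive_integrable[OF F] M' in \<open>auto simp: set_borel_measurable_def\<close>)
qed

text \<open>The product rule. The defect of the identity on an interval is additive, and on a short
  interval it is at most the oscillation of the factors times the integral of the derivatives;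
  by bisection it is arbitrarily small on every interval.\<close>

lemma primitive_product:
  fixes prod :: "'a::euclidean_space \<Rightarrow> 'b::euclidean_space \<Rightarrow> 'c::euclidean_space" (infixl "\<star>" 70)
  assumes bil: "bounded_bilinear prod" and F: "is_primitive F f" and G: "is_primitive G g"
  shows "is_primitive (\<lambda>x. F x \<star> G x) (\<lambda>x. f x \<star> G x + F x \<star> g x)"
proof -
  interpret bounded_bilinear prod by (rule bil)
  have cF: "continuous_on UNIV F" and cG: "continuous_on UNIV G"
    using F G by (auto intro: primitive_continuous)
  have [measurable]: "f \<in> borel_measurable borel" "g \<in> borel_measurable borel"
    "F \<in> borel_measurable borel" "G \<in> borel_measurable borel"
    using F G cF cG by (auto intro: primitive_measurable borel_measurable_continuous_onI)
  have int1: "set_integrable lborel {a..b} (\<lambda>x. f x \<star> H x)" if "continuous_on UNIV H" for a b H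
    by (rule set_integrable_bilinear[OF bil F that])
  have int2: "set_integrable lborel {a..b} (\<lambda>x. H x \<star> g x)" if "continuous_on UNIV H" for a b H
    using set_integrable_bilinear[OF flip G that] by simp
  obtain K where K: "K > 0" "\<And>x y. norm (x \<star> y) \<le> norm x * norm y * K"
    using pos_bounded by blast
  have int: "set_integrable lborel {a..b} (\<lambda>x. f x \<star> G x + F x \<star> g x)" for a b
    using int1[OF cG] int2[OF cF] by (rule set_integral_add(1))
  define k where "k x = norm (f x) + norm (g x)" for x
  have kint: "set_integrable lborel {a..b} k" for a b
    unfolding k_def
    using set_integrable_norm[OF primitive_integrable[OF F]] set_integrable_norm[OF primitive_integrable[OF G]]
    by (intro set_integral_add(1))
  define E where "E a b = F b \<star> G b - F a \<star> G a - (LBINT x:{a..b}. f x \<star> G x + F x \<star> g x)" for a b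
  have small: "norm (E a b) \<le> e * (LBINT x:{a..b}. k x)" if ab: "a \<le> b" and e: "e > 0" for a b e
    using ab
  proof (induction a b rule: Bolzano)
    case (trans a b c)
    have "E a c = E a b + E b c"
      unfolding E_def using set_integral_Icc_split[OF int trans(3,4)] by simp
    then have "norm (E a c) \<le> norm (E a b) + norm (E b c)" by (simp add: norm_triangle_ineq)
    also have "\<dots> \<le> e * (LBINT x:{a..b}. k x) + e * (LBINT x:{b..c}. k x)"
      using trans by (intro add_mono) auto
    also have "\<dots> = e * (LBINT x:{a..c}. k x)"
      using set_integral_Icc_split[OF kint trans(3,4)] by (simp add: distrib_left)
    finally show ?case .
  next
    case (local x)
    define e' where "e' = e / (2 * K)"
    have e': "e' > 0" using e K by (simp add: e'_def)
    have "isCont F x" "isCont G x" using cF cG by (auto simp: continuous_on_eq_continuous_at)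
    then have "\<exists>d>0. \<forall>y. dist y x < d \<longrightarrow> dist (F y) (F x) < e'"
      "\<exists>d>0. \<forall>y. dist y x < d \<longrightarrow> dist (G y) (G x) < e'"
      using e' by (simp_all add: continuous_at_eps_delta)
    then obtain d1 d2 where d: "d1 > 0" "\<And>y. dist y x < d1 \<Longrightarrow> dist (F y) (F x) < e'"
      "d2 > 0" "\<And>y. dist y x < d2 \<Longrightarrow> dist (G y) (G x) < e'"
      by blast
    have "norm (E s t) \<le> e * (LBINT x:{s..t}. k x)"
      if st: "s \<le> x" "x \<le> t" "t - s < min d1 d2" for s t
    proof -
      have close: "norm (F s - F y) \<le> 2 * e'" "norm (G t - G y) \<le> 2 * e'" if y: "y \<in> {s..t}" for y
      proof -
        have "dist (F s) (F x) < e'" "dist (F y) (F x) < e'"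
          "dist (G t) (G x) < e'" "dist (G y) (G x) < e'"
          using st y by (auto intro!: d simp: dist_real_def)
        then show "norm (F s - F y) \<le> 2 * e'" "norm (G t - G y) \<le> 2 * e'"
          using dist_triangle2[of "F s" "F y" "F x"] dist_triangle2[of "G t" "G y" "G x"]
          by (auto simp: dist_norm)
      qed
      have "s \<le> t" using st by simp
      have i1: "(LBINT y:{s..t}. f y \<star> G t) = (F t - F s) \<star> G t"
        unfolding primitive_integral[OF F \<open>s \<le> t\<close>, symmetric]
        using primitive_integrable[OF F, of s t] bounded_linear_left[of "G t"]
        unfolding set_lebesgue_integral_def set_integrable_def
        by (subst integral_bounded_linear[symmetric]) (auto simp: scaleR_left)
      have i2: "(LBINT y:{s..t}. F s \<star> g y) = F s \<star> (G t - G s)"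
        unfolding primitive_integral[OF G \<open>s \<le> t\<close>, symmetric]
        using primitive_integrable[OF G, of s t] bounded_linear_right[of "F s"]
        unfolding set_lebesgue_integral_def set_integrable_def
        by (subst integral_bounded_linear[symmetric]) (auto simp: scaleR_right)
      have d1: "set_integrable lborel {s..t} (\<lambda>y. f y \<star> (G t - G y))"
        by (intro int1 continuous_on_diff continuous_on_const cG)
      have d2: "set_integrable lborel {s..t} (\<lambda>y. (F s - F y) \<star> g y)"
        by (intro int2 continuous_on_diff continuous_on_const cF)
      have "E s t = (F t - F s) \<star> G t + F s \<star> (G t - G s) - (LBINT x:{s..t}. f x \<star> G x + F x \<star> g x)"
        by (simp add: E_def diff_left diff_right)
      also have "(LBINT x:{s..t}. f x \<star> G x + F x \<star> g x) =
          (LBINT x:{s..t}. f x \<star> G x) + (LBINT x:{s..t}. F x \<star> g x)"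
        using int1[OF cG] int2[OF cF] by (rule set_integral_add(2))
      finally have "E s t = ((LBINT y:{s..t}. f y \<star> G t) - (LBINT x:{s..t}. f x \<star> G x))
          + ((LBINT y:{s..t}. F s \<star> g y) - (LBINT x:{s..t}. F x \<star> g x))"
        by (simp add: i1 i2)
      also have "\<dots> = (LBINT y:{s..t}. f y \<star> G t - f y \<star> G y) + (LBINT y:{s..t}. F s \<star> g y - F y \<star> g y)"
        using int1[OF cG, of s t] int2[OF cF, of s t]
          int1[OF continuous_on_const[of UNIV "G t"], of s t] int2[OF continuous_on_const[of UNIV "F s"], of s t]
        by (simp add: set_integral_diff(2))
      also have "\<dots> = (LBINT y:{s..t}. (f y \<star> (G t - G y)) + ((F s - F y) \<star> g y))"
        using d1 d2 by (subst set_integral_add(2)) (simp_all add: diff_left diff_right)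
      finally have E: "E s t = (LBINT y:{s..t}. (f y \<star> (G t - G y)) + ((F s - F y) \<star> g y))" .
      have b: "norm ((f y \<star> (G t - G y)) + ((F s - F y) \<star> g y)) \<le> e * k y" if y: "y \<in> {s..t}" for y
      proof -
        have "norm ((f y \<star> (G t - G y)) + ((F s - F y) \<star> g y))
            \<le> norm (f y) * norm (G t - G y) * K + norm (F s - F y) * norm (g y) * K"
          by (intro norm_triangle_le add_mono K)
        also have "\<dots> \<le> norm (f y) * (2 * e') * K + (2 * e') * norm (g y) * K"
          using close[OF y] K e' by (intro add_mono mult_right_mono mult_left_mono) auto
        also have "\<dots> = e * k y" using K by (simp add: e'_def k_def field_simps)
        finally show ?thesis .
      qed
      have "norm (E s t) \<le> (LBINT y:{s..t}. norm ((f y \<star> (G t - G y)) + ((F s - F y) \<star> g y)))"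
        unfolding E set_lebesgue_integral_def
        by (rule order_trans[OF integral_norm_bound]) simp
      also have "\<dots> \<le> (LBINT y:{s..t}. e * k y)"
        by (intro set_integral_mono set_integrable_norm set_integral_add(1) d1 d2
            set_integrable_mult_right kint impI b)
      finally show ?thesis by simp
    qed
    then show ?case using d by (intro exI[of _ "min d1 d2"]) auto
  qed
  have "E a b = 0" if "a \<le> b" for a b
  proof -
    have "norm (E a b) \<le> 0 + e" if "e > 0" for e
    proof -
      define c where "c = (LBINT x:{a..b}. k x) + 1"
      have "0 \<le> (LBINT x:{a..b}. k x)"
        unfolding set_lebesgue_integral_def k_def by (intro integral_nonneg_AE) auto
      then have "c > 0" by (simp add: c_def)
      have "norm (E a b) \<le> (e / c) * (LBINT x:{a..b}. k x)"
        using \<open>a \<le> b\<close> \<open>c > 0\<close> \<open>e > 0\<close> by (intro small) auto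
      also have "\<dots> \<le> (e / c) * c" using \<open>c > 0\<close> \<open>e > 0\<close> by (intro mult_left_mono) (auto simp: c_def)
      finally show ?thesis using \<open>c > 0\<close> by simp
    qed
    then have "norm (E a b) \<le> 0" by (rule field_le_epsilon)
    then show ?thesis by simp
  qed
  moreover have "(\<lambda>x. f x \<star> G x + F x \<star> g x) \<in> borel_measurable borel"
    by (rule borel_measurable_add; rule bilinear_measurable[OF bil]; measurable)
  ultimately show ?thesis
    using int by (intro is_primitiveI) (auto simp: E_def)
qed

section \<open>Smooth functions and test functions\<close>

definition smooth :: "(real \<Rightarrow> real) \<Rightarrow> bool" where
  "smooth f \<longleftrightarrow> (\<forall>k. (deriv ^^ k) f differentiable_on UNIV)"

text \<open>If a family of functions is closed under differentiation, iterated derivatives never leave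
  it; this replaces formulas for higher derivatives.\<close>

lemma smooth_family:
  assumes step: "\<And>f. f \<in> X \<Longrightarrow> \<exists>f'\<in>X. \<forall>x. (f has_real_derivative f' x) (at x)" and "f \<in> X"
  shows "smooth f"
proof -
  have "(deriv ^^ k) f \<in> X" for k
  proof (induction k)
    case (Suc k)
    then obtain f' where f': "f' \<in> X" "\<And>x. ((deriv ^^ k) f has_real_derivative f' x) (at x)"
      using step by blast
    then have "(deriv ^^ Suc k) f = f'" by (auto simp: fun_eq_iff DERIV_imp_deriv)
    then show ?case using f' by simp
  qed (simp add: assms)
  then show ?thesis unfolding smooth_def differentiable_on_def
    using step by (meson differentiable_at_withinI field_differentiable_def field_differentiable_imp_differentiable)
qed

lemma smooth_deriv: "smooth f \<Longrightarrow> smooth (deriv f)"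
  unfolding smooth_def by (metis funpow_Suc_right comp_apply)

lemma smooth_has_derivative: "smooth f \<Longrightarrow> (f has_real_derivative deriv f x) (at x)"
  unfolding smooth_def differentiable_on_def
  by (metis DERIV_deriv_iff_real_differentiable UNIV_I funpow_0)

lemma smooth_continuous: "smooth f \<Longrightarrow> continuous_on UNIV f"
  by (meson DERIV_isCont continuous_at_imp_continuous_on smooth_has_derivative)

lemma smooth_affine_compose:
  assumes "smooth f"
  shows "smooth (\<lambda>x. f (a * x + b))"
proof (rule smooth_family)
  let ?X = "{(\<lambda>x. c * g (a * x + b)) |c g. smooth g}"
  have "(\<lambda>x. f (a * x + b)) = (\<lambda>x. 1 * f (a * x + b))" by simp
  then show "(\<lambda>x. f (a * x + b)) \<in> ?X" using assms by blast
  fix h assume "h \<in> ?X"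
  then obtain c g where h: "h = (\<lambda>x. c * g (a * x + b))" and g: "smooth g" by blast
  have "(h has_real_derivative (c * a) * deriv g (a * x + b)) (at x)" for x
    unfolding h
    by (rule derivative_eq_intros refl DERIV_chain2[OF smooth_has_derivative[OF g]])+ simp
  moreover have "(\<lambda>x. (c * a) * deriv g (a * x + b)) \<in> ?X" using smooth_deriv[OF g] by blast
  ultimately show "\<exists>h'\<in>?X. \<forall>x. (h has_real_derivative h' x) (at x)"
    by (intro bexI[where x = "\<lambda>x. (c * a) * deriv g (a * x + b)"] allI)
qed

text \<open>The Leibniz rule leads from products of smooth functions to sums of such products, and not
  beyond.\<close>

inductive_set product_sums :: "(real \<Rightarrow> real) set" where
  product: "smooth f \<Longrightarrow> smooth g \<Longrightarrow> (\<lambda>x. f x * g x) \<in> product_sums"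
| sum: "p \<in> product_sums \<Longrightarrow> q \<in> product_sums \<Longrightarrow> (\<lambda>x. p x + q x) \<in> product_sums"

lemma smooth_mult:
  assumes "smooth f" "smooth g"
  shows "smooth (\<lambda>x. f x * g x)"
proof (rule smooth_family[where X = product_sums])
  show "(\<lambda>x. f x * g x) \<in> product_sums" using assms by (rule product_sums.product)
  fix h assume "h \<in> product_sums"
  then show "\<exists>h'\<in>product_sums. \<forall>x. (h has_real_derivative h' x) (at x)"
  proof induction
    case (product f g)
    then have "((\<lambda>x. f x * g x) has_real_derivative deriv f x * g x + f x * deriv g x) (at x)" for x
      by (auto intro!: derivative_eq_intros smooth_has_derivative)
    moreover have "(\<lambda>x. deriv f x * g x + f x * deriv g x) \<in> product_sums"
      using product by (intro product_sums.intros smooth_deriv)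
    ultimately show ?case
      by (intro bexI[where x = "\<lambda>x. deriv f x * g x + f x * deriv g x"] allI)
  next
    case (sum p q)
    then obtain p' q' where "p' \<in> product_sums" "\<forall>x. (p has_real_derivative p' x) (at x)"
      "q' \<in> product_sums" "\<forall>x. (q has_real_derivative q' x) (at x)" by blast
    then have "\<forall>x. ((\<lambda>x. p x + q x) has_real_derivative p' x + q' x) (at x)"
      "(\<lambda>x. p' x + q' x) \<in> product_sums"
      by (auto intro!: derivative_intros product_sums.sum)
    then show ?case by (intro bexI[where x = "\<lambda>x. p' x + q' x"])
  qed
qed

lemma smooth_diff:
  assumes "smooth f" "smooth g"
  shows "smooth (\<lambda>x. f x - g x)"
proof (rule smooth_family[where X = "{\<lambda>x. f x - g x |f g. smooth f \<and> smooth g}"])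
  show "(\<lambda>x. f x - g x) \<in> {\<lambda>x. f x - g x |f g. smooth f \<and> smooth g}" using assms by blast
  fix h assume "h \<in> {\<lambda>x. f x - g x |f g. smooth f \<and> smooth g}"
  then obtain f g where fg: "h = (\<lambda>x. f x - g x)" "smooth f" "smooth g" by blast
  then have "\<forall>x. (h has_real_derivative deriv f x - deriv g x) (at x)"
    by (auto intro!: derivative_intros smooth_has_derivative)
  moreover have "(\<lambda>x. deriv f x - deriv g x) \<in> {\<lambda>x. f x - g x |f g. smooth f \<and> smooth g}"
    using fg smooth_deriv by blast
  ultimately show "\<exists>h'\<in>{\<lambda>x. f x - g x |f g. smooth f \<and> smooth g}. \<forall>x. (h has_real_derivative h' x) (at x)"
    by (intro bexI[where x = "\<lambda>x. deriv f x - deriv g x"])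
qed

lemma smooth_antiderivative:
  assumes "smooth f'" and f: "\<And>x. (f has_real_derivative f' x) (at x)"
  shows "smooth f"
proof (rule smooth_family[where X = "insert f {g. smooth g}"])
  fix g assume "g \<in> insert f {g. smooth g}"
  then show "\<exists>g'\<in>insert f {g. smooth g}. \<forall>x. (g has_real_derivative g' x) (at x)"
    using assms smooth_deriv smooth_has_derivative by blast
qed simp

definition flat_exp :: "real \<Rightarrow> real" where
  "flat_exp x = (if x \<le> 0 then 0 else exp (- (1 / x)))"

lemma flat_exp_pow_tendsto: "((\<lambda>h. (1 / h) ^ k * flat_exp h) \<longlongrightarrow> 0) (at 0)"
proof -
  have "((\<lambda>h. (1 / h) ^ k / exp (1 / h)) \<longlongrightarrow> 0) (at_right (0::real))"
    by (rule filterlim_compose[OF tendsto_power_div_exp_0 ])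
      (use filterlim_inverse_at_top_right in \<open>simp add: inverse_eq_divide\<close>)
  then have "((\<lambda>h. (1 / h) ^ k * flat_exp h) \<longlongrightarrow> 0) (at_right 0)"
    by (rule Lim_transform_eventually)
      (auto simp: flat_exp_def exp_minus field_simps eventually_at_right_less intro!: eventually_mono[OF eventually_at_right_less])
  moreover have "((\<lambda>h. (1 / h) ^ k * flat_exp h) \<longlongrightarrow> 0) (at_left 0)"
    by (rule Lim_transform_eventually[OF tendsto_const])
      (auto simp: flat_exp_def eventually_at_left_field intro!: exI[of _ "-1"])
  ultimately show ?thesis by (simp add: filterlim_split_at)
qed

text \<open>Away from the origin, the derivatives of \<open>flat_exp\<close> are polynomials in \<open>1/x\<close> times
  \<open>flat_exp\<close>; such products are closed under differentiation also at the origin.\<close>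

lemma smooth_flat_exp: "smooth flat_exp"
proof (rule smooth_family)
  let ?X = "{\<lambda>x. poly p (1 / x) * flat_exp x |p. True}"
  have "flat_exp = (\<lambda>x. poly 1 (1 / x) * flat_exp x)" by simp
  then show "flat_exp \<in> ?X" by blast
  have poly0: "((\<lambda>h. poly p (1 / h) * flat_exp h) \<longlongrightarrow> 0) (at 0)" for p
  proof -
    have "((\<lambda>h. \<Sum>i\<le>degree p. coeff p i * ((1 / h) ^ i * flat_exp h)) \<longlongrightarrow> (\<Sum>i\<le>degree p. coeff p i * 0)) (at 0)"
      by (intro tendsto_sum tendsto_mult tendsto_const flat_exp_pow_tendsto)
    then show ?thesis by (simp add: poly_altdef sum_distrib_right mult.assoc)
  qed
  fix h assume "h \<in> ?X"
  then obtain p where h: "h = (\<lambda>x. poly p (1 / x) * flat_exp x)" by blast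
  define q where "q = [:0, 0, 1:] * (p - pderiv p)"
  have "(h has_real_derivative poly q (1 / x) * flat_exp x) (at x)" for x
  proof (cases x "0::real" rule: linorder_cases)
    case less
    have "((\<lambda>x. 0) has_real_derivative 0) (at x)" by simp
    then have "(h has_real_derivative 0) (at x)"
      by (rule has_field_derivative_transform_within_open[where S = "{..<0}"])
        (use less in \<open>auto simp: h flat_exp_def\<close>)
    then show ?thesis using less by (simp add: flat_exp_def)
  next
    case equal
    have "((\<lambda>y. (h y - h 0) / (y - 0)) \<longlongrightarrow> 0) (at 0)"
      using poly0[of "[:0, 1:] * p"] by (simp add: h flat_exp_def field_simps)
    then show ?thesis using equal by (simp add: has_field_derivative_iff flat_exp_def)
  next
    case greater
    have "((\<lambda>x. poly p (1 / x) * exp (- (1 / x))) has_real_derivative poly q (1 / x) * flat_exp x) (at x)"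
      using greater
      by (auto intro!: derivative_eq_intros DERIV_chain2[OF poly_DERIV] simp: q_def flat_exp_def field_simps power2_eq_square)
    then show ?thesis
      by (rule has_field_derivative_transform_within_open[where S = "{0<..}"])
        (use greater in \<open>auto simp: h flat_exp_def\<close>)
  qed
  then show "\<exists>h'\<in>?X. \<forall>x. (h has_real_derivative h' x) (at x)"
    by (intro bexI[of _ "\<lambda>x. poly q (1 / x) * flat_exp x"]) auto
qed

text \<open>The factor \<open>n\<close> makes both flanks steep: for \<open>n \<rightarrow> \<infinity>\<close> the function tends boundedly to the
  indicator function of the open interval.\<close>

definition bump :: "real \<Rightarrow> real \<Rightarrow> nat \<Rightarrow> real \<Rightarrow> real" where
  "bump s t n x = flat_exp (real n * (x - s)) * flat_exp (real n * (t - x))"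

lemma smooth_bump: "smooth (bump s t n)"
proof -
  have "smooth (\<lambda>x. flat_exp (real n * x + (- (real n * s))) * flat_exp ((- real n) * x + real n * t))"
    by (intro smooth_mult smooth_affine_compose smooth_flat_exp)
  then show ?thesis by (simp add: bump_def[abs_def] algebra_simps)
qed

lemma flat_exp_bounds: "0 \<le> flat_exp x" "flat_exp x \<le> 1"
  by (auto simp: flat_exp_def)

lemma bump_bounds: "0 \<le> bump s t n x" "bump s t n x \<le> 1"
  by (auto simp: bump_def flat_exp_bounds mult_le_one)

lemma bump_outside: "x \<notin> {s<..<t} \<Longrightarrow> bump s t n x = 0"
  by (cases "n = 0") (auto simp: bump_def flat_exp_def mult_nonneg_nonpos zero_less_mult_iff not_le)

lemma bump_pos: "x \<in> {s<..<t} \<Longrightarrow> n > 0 \<Longrightarrow> bump s t n x > 0"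
  by (auto simp: bump_def flat_exp_def not_le mult_le_0_iff)

lemma flat_exp_scaled_tendsto: "x > 0 \<Longrightarrow> (\<lambda>n. flat_exp (real n * x)) \<longlonglongrightarrow> 1"
proof -
  assume x: "x > 0"
  have "(\<lambda>n. exp (- (1 / (real n * x)))) \<longlonglongrightarrow> 1" using x by real_asymp
  then show ?thesis
    by (rule Lim_transform_eventually)
      (use x in \<open>auto simp: flat_exp_def mult_le_0_iff intro!: eventually_sequentiallyI[of 1]\<close>)
qed

lemma bump_tendsto: "(\<lambda>n. bump s t n x) \<longlonglongrightarrow> indicator {s<..<t} x"
proof (cases "x \<in> {s<..<t}")
  case True
  then have "(\<lambda>n. flat_exp (real n * (x - s)) * flat_exp (real n * (t - x))) \<longlonglongrightarrow> 1 * 1"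
    by (intro tendsto_mult flat_exp_scaled_tendsto) auto
  then show ?thesis using True by (simp add: bump_def)
qed (simp add: bump_outside)

lemma test_functionI:
  assumes "smooth f" "\<And>x. x \<notin> {a..b} \<Longrightarrow> f x = 0"
  shows "f \<in> test_functions"
proof -
  have "closure {x. f x \<noteq> 0} \<subseteq> {a..b}"
    using assms(2) by (intro closure_minimal subsetI) (blast, simp)
  then have "compact (closure {x. f x \<noteq> 0})"
    by (meson bounded_closed_interval bounded_subset closed_closure compact_eq_bounded_closed)
  then show ?thesis using assms(1) by (simp add: test_functions_def smooth_def)
qed

lemma test_functionE:
  assumes "f \<in> test_functions"
  obtains N where "smooth f" "N > 0" "\<And>x. x \<notin> {-N..N} \<Longrightarrow> f x = 0" "\<And>x. x \<notin> {-N..N} \<Longrightarrow> deriv f x = 0"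
proof -
  have s: "smooth f" and "compact (closure {x. f x \<noteq> 0})"
    using assms by (auto simp: test_functions_def smooth_def)
  then obtain N where N: "N > 0" "\<And>x. x \<in> closure {x. f x \<noteq> 0} \<Longrightarrow> norm x \<le> N"
    using compact_imp_bounded bounded_pos by metis
  have 0: "f x = 0" if "x \<notin> {-N..N}" for x
    using N(2)[of x] closure_subset[of "{x. f x \<noteq> 0}"] that by force
  have "deriv f x = 0" if "x \<notin> {-N..N}" for x
  proof (rule DERIV_imp_deriv)
    have "((\<lambda>x. 0) has_real_derivative 0) (at x)" by simp
    then show "(f has_real_derivative 0) (at x)"
      by (rule has_field_derivative_transform_within_open[where S = "- {-N..N}"])
        (use that 0 in \<open>auto intro: open_Compl\<close>)
  qed
  then show thesis using s N 0 by (intro that[of N])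
qed

lemma bump_test_function: "bump s t n \<in> test_functions"
  by (rule test_functionI[OF smooth_bump, of s t]) (auto simp: bump_outside)

section \<open>The lemma of du Bois-Reymond\<close>

lemma smooth_measurable: "smooth f \<Longrightarrow> f \<in> borel_measurable borel"
  by (intro borel_measurable_continuous_onI smooth_continuous)

lemma smooth_primitive: "smooth f \<Longrightarrow> is_primitive f (deriv f)"
  by (intro primitive_derivative smooth_continuous smooth_deriv)
    (simp flip: has_real_derivative_iff_has_vector_derivative add: smooth_has_derivative)

lemma smooth_bounded:
  assumes "smooth f" "\<And>x. x \<notin> {-N..N} \<Longrightarrow> f x = 0"
  obtains M where "M > 0" "\<And>x. \<bar>f x\<bar> \<le> M"
proof -
  have "bounded (f ` {-N..N})"
    by (intro compact_imp_bounded compact_continuous_image continuous_on_subset[OF smooth_continuous[OF assms(1)]]) auto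
  then obtain M where M: "M > 0" "\<And>x. x \<in> {-N..N} \<Longrightarrow> \<bar>f x\<bar> \<le> M"
    by (auto simp: bounded_pos)
  then have "\<bar>f x\<bar> \<le> M" for x using assms(2)[of x] by (cases "x \<in> {-N..N}") auto
  then show thesis using M that by blast
qed

lemma integrable_smooth_scaleR:
  fixes d :: "real \<Rightarrow> 'a::euclidean_space"
  assumes f: "smooth f" "\<And>x. x \<notin> {-N..N} \<Longrightarrow> f x = 0"
    and d: "d \<in> borel_measurable borel" "set_integrable lborel {-N..N} d"
  shows "integrable lborel (\<lambda>x. f x *\<^sub>R d x)"
proof -
  obtain M where M: "M > 0" "\<And>x. \<bar>f x\<bar> \<le> M" by (rule smooth_bounded[OF f]) auto
  note [measurable] = d(1) smooth_measurable[OF f(1)]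
  show ?thesis
  proof (rule Bochner_Integration.integrable_bound)
    show "integrable lborel (\<lambda>x. M *\<^sub>R (indicator {-N..N} x *\<^sub>R d x))"
      using d(2) unfolding set_integrable_def by (rule integrable_scaleR_right)
    have "norm (f x *\<^sub>R d x) \<le> norm (M *\<^sub>R (indicator {-N..N} x *\<^sub>R d x))" for x
      using M f(2)[of x] by (cases "x \<in> {-N..N}") (auto intro!: mult_right_mono simp: abs_of_pos)
    then show "AE x in lborel. norm (f x *\<^sub>R d x) \<le> norm (M *\<^sub>R (indicator {-N..N} x *\<^sub>R d x))" by simp
  qed measurable
qed

lemma test_function_by_parts:
  fixes G :: "real \<Rightarrow> 'a::euclidean_space"
  assumes "\<phi> \<in> test_functions" and G: "is_primitive G g"
  shows "(\<integral>x. deriv \<phi> x *\<^sub>R G x \<partial>lborel) = - (\<integral>x. \<phi> x *\<^sub>R g x \<partial>lborel)"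
proof -
  obtain N where s: "smooth \<phi>" and N: "N > 0" "\<And>x. x \<notin> {-N..N} \<Longrightarrow> \<phi> x = 0" "\<And>x. x \<notin> {-N..N} \<Longrightarrow> deriv \<phi> x = 0"
    using test_functionE[OF assms(1)] by metis
  have int1: "integrable lborel (\<lambda>x. deriv \<phi> x *\<^sub>R G x)"
  proof (rule integrable_smooth_scaleR[OF smooth_deriv[OF s] N(3)])
    show "G \<in> borel_measurable borel" by (intro borel_measurable_continuous_onI primitive_continuous[OF G])
    show "set_integrable lborel {-N..N} G"
      by (intro borel_integrable_atLeastAtMost' continuous_on_subset[OF primitive_continuous[OF G]]) simp
  qed
  have int2: "integrable lborel (\<lambda>x. \<phi> x *\<^sub>R g x)"
    by (intro integrable_smooth_scaleR[OF s N(2)] primitive_measurable[OF G] primitive_integrable[OF G])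
  have "is_primitive (\<lambda>x. \<phi> x *\<^sub>R G x) (\<lambda>x. deriv \<phi> x *\<^sub>R G x + \<phi> x *\<^sub>R g x)"
    by (intro primitive_product[OF bounded_bilinear_scaleR] smooth_primitive s G)
  then have "(LBINT x:{-(N+1)..N+1}. deriv \<phi> x *\<^sub>R G x + \<phi> x *\<^sub>R g x) = \<phi> (N+1) *\<^sub>R G (N+1) - \<phi> (-(N+1)) *\<^sub>R G (-(N+1))"
    using N(1) by (intro primitive_integral) auto
  also have "\<dots> = 0" using N(1,2) by simp
  also have "(LBINT x:{-(N+1)..N+1}. deriv \<phi> x *\<^sub>R G x + \<phi> x *\<^sub>R g x) = (\<integral>x. deriv \<phi> x *\<^sub>R G x + \<phi> x *\<^sub>R g x \<partial>lborel)"
    unfolding set_lebesgue_integral_def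
  proof (rule Bochner_Integration.integral_cong[OF refl])
    fix x
    show "indicat_real {-(N+1)..N+1} x *\<^sub>R (deriv \<phi> x *\<^sub>R G x + \<phi> x *\<^sub>R g x) = deriv \<phi> x *\<^sub>R G x + \<phi> x *\<^sub>R g x"
      using N(2,3)[of x] by (cases "x \<in> {-(N+1)..N+1}") auto
  qed
  also have "\<dots> = (\<integral>x. deriv \<phi> x *\<^sub>R G x \<partial>lborel) + (\<integral>x. \<phi> x *\<^sub>R g x \<partial>lborel)"
    using int1 int2 by (rule Bochner_Integration.integral_add)
  finally show ?thesis by (simp add: add_eq_0_iff2)
qed

lemma sets_borel_eq_open_intervals:
  "sets borel = sigma_sets UNIV (range (\<lambda>(a, b). {a <..< b::real}))"
  by (subst borel_eq_box) (simp add: box_real[abs_def])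

lemma Int_stable_open_intervals: "Int_stable (range (\<lambda>(a, b). {a <..< b::real}))"
proof (rule Int_stableI)
  fix A B :: "real set"
  assume "A \<in> range (\<lambda>(a, b). {a <..< b})" "B \<in> range (\<lambda>(a, b). {a <..< b})"
  then obtain a b c d where "A = {a<..<b}" "B = {c<..<d}" by auto
  then have "A \<inter> B = (\<lambda>(a, b). {a <..< b}) (max a c, min b d)" by simp
  then show "A \<inter> B \<in> range (\<lambda>(a, b). {a <..< b})" by blast
qed

text \<open>The sets on which the integral vanishes form a Dynkin system, which contains the open
  intervals.\<close>

lemma AE_zero_if_interval_integrals_zero:
  fixes e :: "real \<Rightarrow> 'a::euclidean_space"
  assumes int: "\<And>a b. set_integrable lborel {a..b} e"
    and zero: "\<And>a b. (LBINT x:{a<..<b}. e x) = 0"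
  shows "AE x in lborel. e x = 0"
proof -
  have "AE x in lborel. indicator {-real N<..<real N} x *\<^sub>R e x = 0" for N
  proof (rule sigma_finite_measure.density_zero[OF lborel.sigma_finite_measure_axioms])
    let ?e = "\<lambda>x. indicator {-real N<..<real N} x *\<^sub>R e x"
    have "set_integrable lborel {-real N<..<real N} e"
      by (rule set_integrable_subset[OF int[of "- real N" "real N"]]) auto
    then show eN: "integrable lborel ?e" by (simp add: set_integrable_def)
    have eN_set: "set_integrable lborel A ?e" if "A \<in> sets borel" for A
      unfolding set_integrable_def using _ eN by (rule integrable_mult_indicator) (use that in simp)
    fix A :: "real set" assume "A \<in> sets lborel"
    then have A: "A \<in> sigma_sets UNIV (range (\<lambda>(a, b). {a <..< b::real}))"
      by (simp flip: sets_borel_eq_open_intervals)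
    have sub: "range (\<lambda>(a, b). {a <..< b::real}) \<subseteq> Pow UNIV" by simp
    from Int_stable_open_intervals sub A show "(LINT x:A|lborel. ?e x) = 0"
    proof (induction rule: sigma_sets_induct_disjoint)
      case (basic A)
      then obtain a b where A: "A = {a<..<b}" by auto
      have "(LBINT x:A. ?e x) = (LBINT x:{max a (- real N)<..<min b (real N)}. e x)"
        unfolding set_lebesgue_integral_def A
        by (intro Bochner_Integration.integral_cong refl) (auto simp: indicator_def)
      then show ?case using zero by simp
    next
      case empty
      then show ?case by (simp add: set_lebesgue_integral_def)
    next
      case (compl A)
      then have A: "A \<in> sets borel" by (simp add: sets_borel_eq_open_intervals)
      have "(LBINT x:A. ?e x) + (LBINT x:UNIV - A. ?e x) = (LBINT x:A \<union> (UNIV - A). ?e x)"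
        using A eN_set by (intro set_integral_Un[symmetric]) auto
      also have "\<dots> = (LBINT x:{-real N<..<real N}. e x)"
        by (simp add: set_lebesgue_integral_def Un_Diff_cancel)
      finally show ?case using compl zero by simp
    next
      case (union A)
      then have A: "A i \<in> sets lborel" for i by (auto simp: sets_borel_eq_open_intervals)
      have "(LBINT x:(\<Union>i. A i). ?e x) = (\<Sum>i. (LBINT x:A i. ?e x))"
        using A union(1) eN_set by (intro lebesgue_integral_countable_add) (auto simp: disjoint_family_on_def)
      then show ?case using union by simp
    qed
  qed
  then have "AE x in lborel. \<forall>N. indicator {-real N<..<real N} x *\<^sub>R e x = 0"
    unfolding AE_all_countable by blast
  then show ?thesis
  proof eventually_elim
    case (elim x)
    obtain N where "\<bar>x\<bar> < real N" using reals_Archimedean2 by blast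
    then show ?case using elim[rule_format, of N] by (simp add: indicator_def abs_less_iff split: if_splits)
  qed
qed

lemma fundamental_lemma:
  fixes e :: "real \<Rightarrow> 'a::euclidean_space"
  assumes e: "e \<in> borel_measurable borel" "\<And>a b. set_integrable lborel {a..b} e"
    and zero: "\<And>s t n. (\<integral>x. bump s t n x *\<^sub>R e x \<partial>lborel) = 0"
  shows "AE x in lborel. e x = 0"
proof (rule AE_zero_if_interval_integrals_zero[OF e(2)])
  fix s t :: real
  note [measurable] = e(1) smooth_measurable[OF smooth_bump]
  have "(\<lambda>n. \<integral>x. bump s t n x *\<^sub>R e x \<partial>lborel) \<longlonglongrightarrow> (\<integral>x. indicator {s<..<t} x *\<^sub>R e x \<partial>lborel)"
  proof (rule integral_dominated_convergence)
    show "integrable lborel (\<lambda>x. norm (indicator {s..t} x *\<^sub>R e x))"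
      using e(2)[of s t] unfolding set_integrable_def by (rule integrable_norm)
    show "AE x in lborel. (\<lambda>n. bump s t n x *\<^sub>R e x) \<longlonglongrightarrow> indicator {s<..<t} x *\<^sub>R e x"
      by (intro AE_I2 tendsto_scaleR bump_tendsto tendsto_const)
    have "norm (bump s t n x *\<^sub>R e x) \<le> norm (indicator {s..t} x *\<^sub>R e x)" for n x
      using bump_bounds[of s t n x] bump_outside[of x s t n]
      by (cases "x \<in> {s<..<t}") (auto intro!: mult_left_le_one_le)
    then show "AE x in lborel. norm (bump s t n x *\<^sub>R e x) \<le> norm (indicator {s..t} x *\<^sub>R e x)" for n
      by simp
  qed measurable
  then show "(LBINT x:{s<..<t}. e x) = 0"
    by (simp add: zero set_lebesgue_integral_def LIMSEQ_const_iff)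
qed

text \<open>The vanishing integral makes the antiderivative zero also to the right of the support.\<close>

lemma test_antiderivative:
  assumes s: "smooth \<psi>" and N: "\<And>x. x \<notin> {-N<..<N} \<Longrightarrow> \<psi> x = 0" "0 \<le> N"
    and zero: "(\<integral>x. \<psi> x \<partial>lborel) = 0"
  obtains \<phi> where "\<phi> \<in> test_functions" "deriv \<phi> = \<psi>"
proof -
  have "\<exists>F. \<forall>x :: real. -\<infinity> < ereal x \<longrightarrow> ereal x < \<infinity> \<longrightarrow> (F has_vector_derivative \<psi> x) (at x)"
    using smooth_continuous[OF s]
    by (intro einterval_antiderivative) (auto simp: continuous_on_eq_continuous_at)
  then obtain F where F: "\<And>x. (F has_real_derivative \<psi> x) (at x)"
    by (auto simp: has_real_derivative_iff_has_vector_derivative)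
  have prim: "is_primitive F \<psi>"
    by (intro primitive_derivative smooth_continuous[OF s])
      (use F in \<open>simp add: has_real_derivative_iff_has_vector_derivative\<close>)
  have left: "F x = F (-N)" if "x \<le> - N" for x
  proof -
    have "(LBINT y:{x..-N}. \<psi> y) = (LBINT y:{x..-N}. 0)"
      by (intro set_lebesgue_integral_cong) (use N in auto)
    then show ?thesis using primitive_integral[OF prim that] by simp
  qed
  have right: "F x = F N" if "N \<le> x" for x
  proof -
    have "(LBINT y:{N..x}. \<psi> y) = (LBINT y:{N..x}. 0)"
      by (intro set_lebesgue_integral_cong) (use N in auto)
    then show ?thesis using primitive_integral[OF prim that] by simp
  qed
  have "(LBINT y:{-N..N}. \<psi> y) = (\<integral>x. \<psi> x \<partial>lborel)"
    unfolding set_lebesgue_integral_def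
  proof (rule Bochner_Integration.integral_cong[OF refl])
    show "indicat_real {-N..N} x *\<^sub>R \<psi> x = \<psi> x" for x using N(1)[of x] by (cases "x \<in> {-N..N}") auto
  qed
  then have mid: "F N = F (-N)" using primitive_integral[OF prim, of "-N" N] N(2) zero by simp
  define \<phi> where "\<phi> x = F x - F (-N)" for x
  have d: "(\<phi> has_real_derivative \<psi> x) (at x)" for x
    unfolding \<phi>_def[abs_def] using DERIV_diff[OF F[of x] DERIV_const[of "F (-N)"]] by simp
  have "\<phi> \<in> test_functions"
  proof (rule test_functionI[of _ "-N" N])
    show "smooth \<phi>" by (rule smooth_antiderivative[OF s d])
    show "\<phi> x = 0" if "x \<notin> {-N..N}" for x
      using that left[of x] right[of x] mid by (cases "x \<le> -N") (auto simp: \<phi>_def)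
  qed
  moreover have "deriv \<phi> = \<psi>" using d by (auto intro!: DERIV_imp_deriv)
  ultimately show thesis by (rule that)
qed

lemma set_integrable_const_Icc: "set_integrable lborel {a..b::real} (\<lambda>x. c :: 'a::euclidean_space)"
  by (intro borel_integrable_atLeastAtMost') simp

lemma integrable_bump_scaleR:
  fixes h :: "real \<Rightarrow> 'a::euclidean_space"
  assumes "h \<in> borel_measurable borel" "\<And>a b. set_integrable lborel {a..b} h"
  shows "integrable lborel (\<lambda>x. bump s t n x *\<^sub>R h x)"
proof (rule integrable_smooth_scaleR[where N = "max \<bar>s\<bar> \<bar>t\<bar>"])
  show "bump s t n x = 0" if "x \<notin> {- max \<bar>s\<bar> \<bar>t\<bar>..max \<bar>s\<bar> \<bar>t\<bar>}" for x
    using that by (intro bump_outside) auto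
qed (simp_all add: smooth_bump assms)

text \<open>Subtracting from a bump function a multiple of a fixed one gives the derivative of a test
  function; so the integral of \<open>d\<close> against a bump function is proportional to the mass of the
  latter.\<close>

lemma du_Bois_Reymond:
  fixes d :: "real \<Rightarrow> 'a::euclidean_space"
  assumes d: "d \<in> borel_measurable borel" "\<And>a b. set_integrable lborel {a..b} d"
    and zero: "\<And>\<phi>. \<phi> \<in> test_functions \<Longrightarrow> (\<integral>x. deriv \<phi> x *\<^sub>R d x \<partial>lborel) = 0"
  obtains c where "AE x in lborel. d x = c"
proof -
  have int1: "integrable lborel (bump s t n)" for s t n
    using integrable_bump_scaleR[of "\<lambda>x. 1::real" s t n, OF _ set_integrable_const_Icc] by simp
  define I where "I = (\<integral>x. bump 0 1 1 x \<partial>lborel)"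
  have "I \<noteq> 0"
  proof
    assume "I = 0"
    then have "AE x in lborel. bump 0 1 1 x = 0"
      unfolding I_def using int1 bump_bounds by (subst (asm) integral_nonneg_eq_0_iff_AE) auto
    then have "AE x in lborel. x \<notin> {0<..<1::real}"
    proof eventually_elim
      case (elim x)
      then show ?case using bump_pos[of x 0 1 1] by auto
    qed
    then have "emeasure lborel {0<..<1::real} = 0"
      by (subst (asm) AE_iff_measurable[of "{0<..<1}"]) auto
    then show False by simp
  qed
  define c where "c = (1 / I) *\<^sub>R (\<integral>x. bump 0 1 1 x *\<^sub>R d x \<partial>lborel)"
  have "AE x in lborel. d x - c = 0"
  proof (rule fundamental_lemma)
    show "(\<lambda>x. d x - c) \<in> borel_measurable borel" using d by simp
    show "set_integrable lborel {a..b} (\<lambda>x. d x - c)" for a b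
      by (intro set_integral_diff(1) d set_integrable_const_Icc)
    fix s t n
    define b where "b = (\<integral>x. bump s t n x \<partial>lborel)"
    define N where "N = max (max \<bar>s\<bar> \<bar>t\<bar>) 1 + 1"
    define \<psi> where "\<psi> x = bump s t n x - (b / I) * bump 0 1 1 x" for x
    have sI: "smooth (\<lambda>x. (b / I) * bump 0 1 1 x)"
    proof (rule smooth_family[where X = "{\<lambda>x. (b / I) * g x |g. smooth g}"])
      fix h assume "h \<in> {\<lambda>x. (b / I) * g x |g. smooth g}"
      then obtain g where g: "h = (\<lambda>x. (b / I) * g x)" "smooth g" by blast
      then show "\<exists>h'\<in>{\<lambda>x. (b / I) * g x |g. smooth g}. \<forall>x. (h has_real_derivative h' x) (at x)"
        by (intro bexI[where x = "\<lambda>x. (b / I) * deriv g x"])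
          (use smooth_deriv DERIV_cmult[OF smooth_has_derivative] in blast)+
    qed (use smooth_bump in blast)
    have "smooth \<psi>" unfolding \<psi>_def[abs_def] by (intro smooth_diff smooth_bump sI)
    moreover have "\<psi> x = 0" if "x \<notin> {-N<..<N}" for x
    proof -
      have "x \<notin> {s<..<t}" "x \<notin> {0<..<1}" using that by (auto simp: N_def)
      then show ?thesis by (simp add: \<psi>_def bump_outside)
    qed
    moreover have "0 \<le> N" by (simp add: N_def)
    moreover have "(\<integral>x. \<psi> x \<partial>lborel) = 0"
      unfolding \<psi>_def using int1 \<open>I \<noteq> 0\<close> by (simp del: One_nat_def add: b_def[symmetric] I_def[symmetric])
    ultimately obtain \<phi> where "\<phi> \<in> test_functions" "deriv \<phi> = \<psi>" by (rule test_antiderivative)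
    then have "0 = (\<integral>x. \<psi> x *\<^sub>R d x \<partial>lborel)" using zero by force
    also have "\<dots> = (\<integral>x. bump s t n x *\<^sub>R d x - (b / I) *\<^sub>R (bump 0 1 1 x *\<^sub>R d x) \<partial>lborel)"
      by (simp add: \<psi>_def scaleR_diff_left)
    also have "\<dots> = (\<integral>x. bump s t n x *\<^sub>R d x \<partial>lborel) - (b / I) *\<^sub>R (\<integral>x. bump 0 1 1 x *\<^sub>R d x \<partial>lborel)"
      by (subst Bochner_Integration.integral_diff)
        (auto simp del: scaleR_scaleR intro!: integrable_bump_scaleR d integrable_scaleR_right)
    also have "\<dots> = (\<integral>x. bump s t n x *\<^sub>R d x \<partial>lborel) - b *\<^sub>R c" by (simp add: c_def)
    also have "b *\<^sub>R c = (\<integral>x. bump s t n x *\<^sub>R c \<partial>lborel)" using int1 by (simp add: b_def)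
    also have "(\<integral>x. bump s t n x *\<^sub>R d x \<partial>lborel) - \<dots> = (\<integral>x. bump s t n x *\<^sub>R (d x - c) \<partial>lborel)"
      unfolding scaleR_diff_right
      by (rule Bochner_Integration.integral_diff[symmetric]) (intro integrable_bump_scaleR d set_integrable_const_Icc borel_measurable_const)+
    finally show "(\<integral>x. bump s t n x *\<^sub>R (d x - c) \<partial>lborel) = 0" by simp
  qed
  then have "AE x in lborel. d x = c" by simp
  then show thesis by (rule that)
qed

lemma primitive_exists:
  fixes g :: "real \<Rightarrow> 'a::euclidean_space"
  assumes g: "g \<in> borel_measurable borel" "\<And>a b. set_integrable lborel {a..b} g"
  obtains G where "is_primitive G g"
proof -
  define G where "G x = (if 0 \<le> x then LBINT y:{0..x}. g y else - (LBINT y:{x..0}. g y))" for x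
  have "is_primitive G g"
  proof (rule is_primitiveI[OF g])
    fix a b :: real assume "a \<le> b"
    then consider "0 \<le> a" | "a < 0" "0 \<le> b" | "b < 0" by linarith
    then show "(LBINT x:{a..b}. g x) = G b - G a"
    proof cases
      case 1
      then show ?thesis using set_integral_Icc_split[OF g(2), of 0 a b] \<open>a \<le> b\<close> by (simp add: G_def)
    next
      case 2
      then show ?thesis using set_integral_Icc_split[OF g(2), of a 0 b] by (simp add: G_def)
    next
      case 3
      then show ?thesis using set_integral_Icc_split[OF g(2), of a b 0] \<open>a \<le> b\<close> by (simp add: G_def)
    qed
  qed
  then show thesis by (rule that)
qed

section \<open>Sobolev functions\<close>

lemma square_integrable_measurable: "square_integrable f \<Longrightarrow> f \<in> borel_measurable borel"
  by (simp add: square_integrable_def)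

lemma L2_eq_refl: "square_integrable f \<Longrightarrow> L2_eq f f"
  by (simp add: L2_eq_def)

lemma abs_L2_eqI:
  assumes "square_integrable f" "square_integrable g" "AE x in lborel. f x = g x"
  shows "abs_L2 f = abs_L2 g"
  using assms Quotient_rel_abs[OF Quotient_L2, of f g] by (simp add: L2_eq_def)

lemma abs_L2_eqD:
  assumes "square_integrable f" "square_integrable g" "abs_L2 f = abs_L2 g"
  shows "AE x in lborel. f x = g x"
  using assms Quotient_rel[OF Quotient_L2, of f g] by (simp add: L2_eq_def)

lemma abs_rep_L2: "abs_L2 (rep_L2 f) = f"
  by (rule Quotient_abs_rep[OF Quotient_L2])

lemma L2_cases:
  obtains F where "f = abs_L2 F" "square_integrable F"
  using abs_rep_L2[of f] square_integrable_rep[of f] by metis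

lemma cinner_abs_L2:
  "square_integrable f \<Longrightarrow> square_integrable g \<Longrightarrow>
    cinner (abs_L2 f) (abs_L2 g) = (\<integral>x. cdot (f x) (g x) \<partial>lborel)"
  by (intro cinner_L2.abs_eq L2_eq_refl)

lemma norm_abs_L2:
  assumes "square_integrable f"
  shows "(norm (abs_L2 f))\<^sup>2 = (\<integral>x. (norm (f x))\<^sup>2 \<partial>lborel)"
  using assms by (simp add: power2_norm_eq_inner inner_L2.abs_eq L2_eq_refl)

lemma has_weak_derivative_abs_L2:
  "square_integrable f \<Longrightarrow> square_integrable g \<Longrightarrow>
    has_weak_derivative (abs_L2 f) (abs_L2 g) \<longleftrightarrow>
    (\<forall>\<phi>\<in>test_functions. (\<integral>x. deriv \<phi> x *\<^sub>R f x \<partial>lborel) = - (\<integral>x. \<phi> x *\<^sub>R g x \<partial>lborel))"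
  by (intro has_weak_derivative.abs_eq L2_eq_refl)

lemma square_integrable_locally:
  assumes "square_integrable f"
  shows "set_integrable lborel {a..b} f"
  unfolding set_integrable_def
proof (rule Bochner_Integration.integrable_bound)
  note [measurable] = square_integrable_measurable[OF assms]
  show "integrable lborel (\<lambda>x. indicator {a..b} x *\<^sub>R (1::real) + (norm (f x))\<^sup>2)"
    using assms set_integrable_const_Icc[of a b "1::real"]
    by (intro Bochner_Integration.integrable_add) (simp_all add: square_integrable_def set_integrable_def)
  have *: "t \<le> 1 + t\<^sup>2" for t :: real
    using zero_le_power2[of "t - 1/2"] by (simp add: power2_diff) (simp add: power2_eq_square)
  then show "AE x in lborel. norm (indicat_real {a..b} x *\<^sub>R f x)
      \<le> norm (indicator {a..b} x *\<^sub>R (1::real) + (norm (f x))\<^sup>2)"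
    by (auto simp: indicator_def)
  show "(\<lambda>x. indicat_real {a..b} x *\<^sub>R f x) \<in> borel_measurable lborel" by measurable
qed

lemma integrable_test_scaleR:
  assumes "\<phi> \<in> test_functions" "square_integrable f"
  shows "integrable lborel (\<lambda>x. \<phi> x *\<^sub>R f x)" "integrable lborel (\<lambda>x. deriv \<phi> x *\<^sub>R f x)"
proof -
  obtain N where s: "smooth \<phi>" and N: "N > 0" "\<And>x. x \<notin> {-N..N} \<Longrightarrow> \<phi> x = 0" "\<And>x. x \<notin> {-N..N} \<Longrightarrow> deriv \<phi> x = 0"
    using test_functionE[OF assms(1)] by metis
  show "integrable lborel (\<lambda>x. \<phi> x *\<^sub>R f x)"
    by (rule integrable_smooth_scaleR[OF s N(2)])
      (auto intro: square_integrable_measurable square_integrable_locally assms)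
  show "integrable lborel (\<lambda>x. deriv \<phi> x *\<^sub>R f x)"
    by (rule integrable_smooth_scaleR[OF smooth_deriv[OF s] N(3)])
      (auto intro: square_integrable_measurable square_integrable_locally assms)
qed

lemma primitive_imp_weak_derivative:
  assumes "square_integrable F" "square_integrable G" "is_primitive F G"
  shows "has_weak_derivative (abs_L2 F) (abs_L2 G)"
  unfolding has_weak_derivative_abs_L2[OF assms(1,2)]
  using test_function_by_parts[OF _ assms(3)] by blast

text \<open>The difference between a function and a primitive of its weak derivative is orthogonal to
  the derivatives of all test functions, hence constant.\<close>

lemma weak_derivative_imp_primitive:
  assumes f: "square_integrable f" and g: "square_integrable g"
    and "has_weak_derivative (abs_L2 f) (abs_L2 g)"
  obtains F where "is_primitive F g" "square_integrable F" "abs_L2 F = abs_L2 f"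
proof -
  have wd: "(\<integral>x. deriv \<phi> x *\<^sub>R f x \<partial>lborel) = - (\<integral>x. \<phi> x *\<^sub>R g x \<partial>lborel)" if "\<phi> \<in> test_functions" for \<phi>
    using assms that by (simp add: has_weak_derivative_abs_L2)
  obtain G where G: "is_primitive G g"
    by (rule primitive_exists[OF square_integrable_measurable[OF g] square_integrable_locally[OF g]])
  have cG: "continuous_on UNIV G" by (rule primitive_continuous[OF G])
  have mG [measurable]: "G \<in> borel_measurable borel" using cG by (rule borel_measurable_continuous_onI)
  have iG: "set_integrable lborel {a..b} G" for a b
    by (intro borel_integrable_atLeastAtMost' continuous_on_subset[OF cG]) simp
  note [measurable] = square_integrable_measurable[OF f]
  obtain c where c: "AE x in lborel. f x - G x = c"
  proof (rule du_Bois_Reymond[of "\<lambda>x. f x - G x"])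
    show "set_integrable lborel {a..b} (\<lambda>x. f x - G x)" for a b
      by (intro set_integral_diff(1) square_integrable_locally f iG)
    fix \<phi> assume \<phi>: "\<phi> \<in> test_functions"
    obtain N where s: "smooth \<phi>" and N: "\<And>x. x \<notin> {-N..N} \<Longrightarrow> deriv \<phi> x = 0"
      using test_functionE[OF \<phi>] by metis
    have "integrable lborel (\<lambda>x. deriv \<phi> x *\<^sub>R G x)"
      by (rule integrable_smooth_scaleR[OF smooth_deriv[OF s] N mG iG])
    then show "(\<integral>x. deriv \<phi> x *\<^sub>R (f x - G x) \<partial>lborel) = 0"
      using integrable_test_scaleR(2)[OF \<phi> f] wd[OF \<phi>] test_function_by_parts[OF \<phi> G]
      by (simp add: scaleR_diff_right)
  qed simp
  define F where "F x = G x + c" for x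
  have F: "is_primitive F g"
    using primitive_add[OF G primitive_const[of c]] by (simp add: F_def[abs_def])
  have ae: "AE x in lborel. F x = f x" using c by eventually_elim (auto simp: F_def algebra_simps)
  have [measurable]: "F \<in> borel_measurable borel" unfolding F_def[abs_def] by measurable
  have "integrable lborel (\<lambda>x. (norm (F x))\<^sup>2) \<longleftrightarrow> integrable lborel (\<lambda>x. (norm (f x))\<^sup>2)"
    by (rule integrable_cong_AE) (measurable, use ae in eventually_elim, simp)
  then have sF: "square_integrable F" using f by (simp add: square_integrable_def)
  show thesis using F sF abs_L2_eqI[OF sF f ae] by (rule that)
qed

lemma has_weak_derivative_unique:
  assumes "has_weak_derivative f g" "has_weak_derivative f h"
  shows "g = h"
proof -
  obtain F where F: "f = abs_L2 F" "square_integrable F" by (rule L2_cases)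
  obtain G where G: "g = abs_L2 G" "square_integrable G" by (rule L2_cases)
  obtain H where H: "h = abs_L2 H" "square_integrable H" by (rule L2_cases)
  note FGH = F(1) G(1) H(1) and sq = F(2) G(2) H(2)
  have "AE x in lborel. G x - H x = 0"
  proof (rule fundamental_lemma)
    show "(\<lambda>x. G x - H x) \<in> borel_measurable borel"
      using sq by (intro borel_measurable_diff square_integrable_measurable)
    show "set_integrable lborel {a..b} (\<lambda>x. G x - H x)" for a b
      by (intro set_integral_diff(1) square_integrable_locally sq)
    show "(\<integral>x. bump s t n x *\<^sub>R (G x - H x) \<partial>lborel) = 0" for s t n
    proof -
      have "- (\<integral>x. bump s t n x *\<^sub>R G x \<partial>lborel) = - (\<integral>x. bump s t n x *\<^sub>R H x \<partial>lborel)"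
        using assms[unfolded FGH] sq bump_test_function[of s t n]
        by (simp add: has_weak_derivative_abs_L2)
      then show ?thesis
        using integrable_test_scaleR(1)[OF bump_test_function] sq by (simp add: scaleR_diff_right)
    qed
  qed
  then show ?thesis unfolding FGH using sq by (intro abs_L2_eqI) auto
qed

lemma weak_derivative_eq: "has_weak_derivative f g \<Longrightarrow> weak_derivative f = g"
  unfolding weak_derivative_def by (rule the_equality) (auto intro: has_weak_derivative_unique)

text \<open>Test vectors turn the weak derivative into a family of conditions on inner products, which
  can be compared with orthogonality relations and pass to limits.\<close>

definition test_vector :: "(real \<Rightarrow> real) \<Rightarrow> 2 \<Rightarrow> L2" where
  "test_vector u i = abs_L2 (\<lambda>x. axis i (complex_of_real (u x)))"

lemma bounded_linear_axis_of_real: "bounded_linear (\<lambda>u. axis i (complex_of_real u) :: complex^2)"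
proof (rule bounded_linear_intro[where K = 1])
  show "norm (axis i (complex_of_real u) :: complex^2) \<le> norm u * 1" for u
    by (rule power2_le_imp_le[OF _ mult_nonneg_nonneg])
      (use exhaust_2[of i] in \<open>auto simp: norm_vec2 axis_def\<close>)
qed (simp_all add: vec_eq_iff forall_2 axis_def scaleR_conv_of_real[where 'a = complex])

lemma square_integrable_axis:
  assumes "smooth u" "\<And>x. x \<notin> {-N..N} \<Longrightarrow> u x = 0"
  shows "square_integrable (\<lambda>x. axis i (complex_of_real (u x)))"
  unfolding square_integrable_def
proof
  note [measurable] = smooth_measurable[OF assms(1)]
  show "(\<lambda>x. axis i (complex_of_real (u x))) \<in> borel_measurable lborel"
    by (rule measurable_vec2) (simp add: axis_def)
  have "(norm (axis i (complex_of_real (u x)) :: complex^2))\<^sup>2 = u x *\<^sub>R u x" for x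
    using exhaust_2[of i] by (auto simp: norm_vec2 axis_def) (simp_all add: power2_eq_square)
  moreover have "integrable lborel (\<lambda>x. u x *\<^sub>R u x)"
    by (rule integrable_smooth_scaleR[OF assms(1) assms(2) smooth_measurable[OF assms(1)], where N = N])
      (assumption, intro borel_integrable_atLeastAtMost' continuous_on_subset[OF smooth_continuous[OF assms(1)]] subset_UNIV)
  ultimately show "integrable lborel (\<lambda>x. (norm (axis i (complex_of_real (u x))))\<^sup>2)"
    by simp
qed

lemma square_integrable_test:
  assumes "\<phi> \<in> test_functions"
  shows "square_integrable (\<lambda>x. axis i (complex_of_real (\<phi> x)))"
    "square_integrable (\<lambda>x. axis i (complex_of_real (deriv \<phi> x)))"
proof -
  obtain N where s: "smooth \<phi>" and N: "N > 0" "\<And>x. x \<notin> {-N..N} \<Longrightarrow> \<phi> x = 0" "\<And>x. x \<notin> {-N..N} \<Longrightarrow> deriv \<phi> x = 0"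
    using test_functionE[OF assms] by metis
  show "square_integrable (\<lambda>x. axis i (complex_of_real (\<phi> x)))"
    by (rule square_integrable_axis[OF s N(2)])
  show "square_integrable (\<lambda>x. axis i (complex_of_real (deriv \<phi> x)))"
    by (rule square_integrable_axis[OF smooth_deriv[OF s] N(3)])
qed

lemma cinner_test_vector:
  assumes u: "square_integrable (\<lambda>x. axis i (complex_of_real (u x)))"
    and f: "square_integrable f" and int: "integrable lborel (\<lambda>x. u x *\<^sub>R f x)"
  shows "cinner (test_vector u i) (abs_L2 f) = (\<integral>x. u x *\<^sub>R f x \<partial>lborel) $ i"
proof -
  have "cdot (axis i (complex_of_real (u x))) (f x) = (u x *\<^sub>R f x) $ i" for x
    using exhaust_2[of i] by (auto simp: cdot_2 axis_def scaleR_conv_of_real[where 'a = complex])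
  then have "cinner (test_vector u i) (abs_L2 f) = (\<integral>x. (u x *\<^sub>R f x) $ i \<partial>lborel)"
    unfolding test_vector_def cinner_abs_L2[OF u f] by simp
  also have "\<dots> = (\<integral>x. u x *\<^sub>R f x \<partial>lborel) $ i"
    by (rule integral_bounded_linear[OF bounded_linear_vec_nth int])
  finally show ?thesis .
qed

lemma has_weak_derivative_iff_cinner:
  "has_weak_derivative f g \<longleftrightarrow>
    (\<forall>\<phi>\<in>test_functions. \<forall>i. cinner (test_vector (deriv \<phi>) i) f = - cinner (test_vector \<phi> i) g)"
proof -
  obtain F where F: "f = abs_L2 F" "square_integrable F" by (rule L2_cases)
  obtain G where G: "g = abs_L2 G" "square_integrable G" by (rule L2_cases)
  note FG = F(1) G(1) and sq = F(2) G(2)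
  have "cinner (test_vector (deriv \<phi>) i) f = (\<integral>x. deriv \<phi> x *\<^sub>R F x \<partial>lborel) $ i"
    "cinner (test_vector \<phi> i) g = (\<integral>x. \<phi> x *\<^sub>R G x \<partial>lborel) $ i" if "\<phi> \<in> test_functions" for \<phi> i
    unfolding FG using sq square_integrable_test[OF that] integrable_test_scaleR[OF that]
    by (simp_all add: cinner_test_vector)
  then show ?thesis unfolding FG using sq
    by (simp add: has_weak_derivative_abs_L2 vec_eq_iff)
qed

lemma test_function_weak_derivative:
  assumes "\<phi> \<in> test_functions"
  shows "has_weak_derivative (test_vector \<phi> i) (test_vector (deriv \<phi>) i)"
  unfolding test_vector_def
proof (rule primitive_imp_weak_derivative[OF square_integrable_test[OF assms]])
  have "smooth \<phi>" using assms test_functionE by metis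
  then show "is_primitive (\<lambda>x. axis i (complex_of_real (\<phi> x))) (\<lambda>x. axis i (complex_of_real (deriv \<phi> x)))"
    by (intro primitive_bounded_linear[OF bounded_linear_axis_of_real] smooth_primitive)
qed

section \<open>The Dirac operator as a first-order system\<close>

text \<open>\<open>K\<close> has a limit at infinity because \<open>k\<close> is integrable, and the limit is zero because \<open>K\<close>
  is integrable.\<close>

lemma primitive_tendsto_zero:
  fixes K k :: "real \<Rightarrow> 'a::euclidean_space"
  assumes prim: "is_primitive K k" and K: "integrable lborel K" and k: "integrable lborel k"
  shows "(LBINT x:{a..}. k x) = - K a"
proof -
  have ks: "set_integrable lborel {a..} k"
    unfolding set_integrable_def by (rule integrable_mult_indicator[OF _ k]) simp
  define L where "L = (LBINT x:{a..}. k x) + K a"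
  have "((\<lambda>b. (LBINT x:{a..b}. k x) + K a) \<longlongrightarrow> L) at_top"
    unfolding L_def by (intro tendsto_add tendsto_const tendsto_set_lebesgue_integral_at_top ks) simp
  then have lim: "(K \<longlongrightarrow> L) at_top"
    by (rule Lim_transform_eventually)
      (use eventually_ge_at_top[of a] in \<open>eventually_elim, simp add: primitive_integral[OF prim]\<close>)
  have "L = 0"
  proof (rule ccontr)
    assume "L \<noteq> 0"
    then have "\<forall>\<^sub>F b in at_top. norm L / 2 < norm (K b)"
      by (intro order_tendstoD(1)[OF tendsto_norm[OF lim]]) simp
    then obtain B where B: "\<And>b. b \<ge> B \<Longrightarrow> norm L / 2 < norm (K b)"
      by (auto simp: eventually_at_top_linorder)
    obtain n :: nat where n: "(\<integral>x. norm (K x) \<partial>lborel) < real n * (norm L / 2)"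
      using \<open>L \<noteq> 0\<close> ex_less_of_nat_mult[of "norm L / 2"] by auto
    have "real n * (norm L / 2) = (LBINT x:{B..B + real n}. norm L / 2)"
      by (simp add: set_integral_const)
    also have "\<dots> \<le> (\<integral>x. norm (K x) \<partial>lborel)"
      unfolding set_lebesgue_integral_def
    proof (rule integral_mono)
      show "integrable lborel (\<lambda>x. indicat_real {B..B + real n} x *\<^sub>R (norm L / 2))"
        using set_integrable_const_Icc[of B "B + real n" "norm L / 2"] by (simp add: set_integrable_def)
      show "integrable lborel (\<lambda>x. norm (K x))" using K by simp
      show "indicat_real {B..B + real n} x *\<^sub>R (norm L / 2) \<le> norm (K x)" for x
        using B[of x] by (cases "x \<in> {B..B + real n}") auto
    qed
    finally show False using n by simp
  qed
  then show ?thesis by (simp add: L_def add_eq_0_iff2)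
qed

lemma integrable_reflect_iff:
  fixes k :: "real \<Rightarrow> 'a::euclidean_space"
  shows "integrable lborel (\<lambda>x. k (- x)) \<longleftrightarrow> integrable lborel k"
  using lborel_integrable_real_affine_iff[of "-1" k 0] by simp

lemma set_integral_reflect_atLeast:
  fixes k :: "real \<Rightarrow> 'a::euclidean_space"
  shows "(LBINT x:{a..}. k (- x)) = (LBINT x:{..-a}. k x)"
proof -
  have "(LBINT x:{..-a}. k x) = (\<integral>x. indicator {..-a} (0 + (-1) * x) *\<^sub>R k (0 + (-1) * x) \<partial>lborel)"
    unfolding set_lebesgue_integral_def
    by (subst lborel_integral_real_affine[of "-1" _ 0]) auto
  also have "\<dots> = (LBINT x:{a..}. k (- x))"
    unfolding set_lebesgue_integral_def
    by (intro Bochner_Integration.integral_cong refl) (auto simp: indicator_def)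
  finally show ?thesis ..
qed

lemma primitive_integral_UNIV:
  fixes K k :: "real \<Rightarrow> 'a::euclidean_space"
  assumes prim: "is_primitive K k" and K: "integrable lborel K" and k: "integrable lborel k"
  shows "(\<integral>x. k x \<partial>lborel) = 0"
proof -
  have "(LBINT x:{0..}. - k (- x)) = - K (- 0)"
    using K k integrable_reflect_iff[of k] integrable_reflect_iff[of K]
    by (intro primitive_tendsto_zero[OF primitive_reflect[OF prim]]) auto
  then have "(LBINT x:{..0}. k x) = K 0"
    using set_integral_reflect_atLeast[of 0 "\<lambda>x. - k x"] by (simp add: set_lebesgue_integral_def)
  moreover have "(LBINT x:{0..}. k x) = - K 0" by (rule primitive_tendsto_zero[OF assms])
  moreover have "(LBINT x:{..0} \<union> {0..}. k x) = (LBINT x:{..0}. k x) + (LBINT x:{0..}. k x)"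
  proof (rule set_integral_Un_AE)
    have "AE x in lborel. x \<noteq> (0::real)" by (rule AE_lborel_singleton)
    then show "AE x in lborel. \<not> (x \<in> {..0} \<and> x \<in> {0::real..})" by eventually_elim auto
    show "set_integrable lborel {..0} k" "set_integrable lborel {0..} k"
      unfolding set_integrable_def by (rule integrable_mult_indicator[OF _ k], simp)+
  qed auto
  moreover have "{..0} \<union> {0..} = (UNIV :: real set)" by auto
  ultimately show ?thesis by (simp add: set_lebesgue_integral_def)
qed

definition L2_scalar :: "(real \<Rightarrow> complex) \<Rightarrow> bool" where
  "L2_scalar f \<longleftrightarrow> f \<in> borel_measurable borel \<and> integrable lborel (\<lambda>x. (cmod (f x))\<^sup>2)"

lemma L2_scalar_component:
  assumes f: "square_integrable f"
  shows "L2_scalar (\<lambda>x. f x $ i)"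
  unfolding L2_scalar_def
proof
  show m: "(\<lambda>x. f x $ i) \<in> borel_measurable borel"
    by (intro measurable_vec_nth square_integrable_measurable f)
  show "integrable lborel (\<lambda>x. (cmod (f x $ i))\<^sup>2)"
  proof (rule Bochner_Integration.integrable_bound)
    show "integrable lborel (\<lambda>x. (norm (f x))\<^sup>2)" using f by (simp add: square_integrable_def)
    show "(\<lambda>x. (cmod (f x $ i))\<^sup>2) \<in> borel_measurable lborel" using m by simp
  qed (simp add: power_mono Finite_Cartesian_Product.norm_nth_le)
qed

lemma integrable_L2_product:
  fixes prod :: "complex \<Rightarrow> complex \<Rightarrow> 'a::euclidean_space"
  assumes bil: "bounded_bilinear prod" and prod: "\<And>a b. norm (prod a b) \<le> cmod a * cmod b"
    and f: "L2_scalar f" and g: "L2_scalar g"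
  shows "integrable lborel (\<lambda>x. prod (f x) (g x))"
proof (rule Bochner_Integration.integrable_bound)
  show "integrable lborel (\<lambda>x. (cmod (f x))\<^sup>2 + (cmod (g x))\<^sup>2)" using f g by (simp add: L2_scalar_def)
  have "norm (prod (f x) (g x)) \<le> (cmod (f x))\<^sup>2 + (cmod (g x))\<^sup>2" for x
  proof -
    have "0 \<le> cmod (f x) * cmod (g x)" by simp
    then show ?thesis using prod[of "f x" "g x"]
      sum_squares_bound[of "cmod (f x)" "cmod (g x)"] unfolding mult.assoc by linarith
  qed
  then show "AE x in lborel. norm (prod (f x) (g x)) \<le> norm ((cmod (f x))\<^sup>2 + (cmod (g x))\<^sup>2)" by simp
  show "(\<lambda>x. prod (f x) (g x)) \<in> borel_measurable lborel"
    using bilinear_measurable[OF bil, of f g] f g by (simp add: L2_scalar_def)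
qed

lemmas integrable_mult_scalar = integrable_L2_product[OF bounded_bilinear_mult eq_refl[OF norm_mult]]

lemmas integrable_component_product =
  integrable_mult_scalar[OF L2_scalar_component L2_scalar_component]

lemma vector_measurable:
  assumes "u \<in> borel_measurable borel" "v \<in> borel_measurable borel"
  shows "(\<lambda>x. vector [u x, v x] :: complex^2) \<in> borel_measurable borel"
proof (rule measurable_vec2)
  show "(\<lambda>x. (vector [u x, v x] :: complex^2) $ i) \<in> borel_measurable borel" for i
    using assms exhaust_2[of i] by auto
qed

lemma vec2_eq_iff: "(v :: complex^2) = w \<longleftrightarrow> v $ 1 = w $ 1 \<and> v $ 2 = w $ 2"
  by (simp add: vec_eq_iff forall_2)

lemma square_integrable_vector_mult:
  assumes f: "square_integrable f" and "a \<in> borel_measurable borel" "b \<in> borel_measurable borel"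
    and ab: "\<And>x. cmod (a x) \<le> M" "\<And>x. cmod (b x) \<le> M"
  shows "square_integrable (\<lambda>x. vector [a x * f x $ 2, b x * f x $ 1])"
proof (rule square_integrable_bound[OF f])
  note [measurable] = square_integrable_measurable[OF f] assms(2,3)
  have "(\<lambda>x. vector [a x * f x $ 2, b x * f x $ 1] :: complex^2) \<in> borel_measurable borel"
    by (rule vector_measurable) measurable
  then show "(\<lambda>x. vector [a x * f x $ 2, b x * f x $ 1] :: complex^2) \<in> borel_measurable lborel" by simp
  fix x
  have M: "0 \<le> M" using ab(1)[of x] norm_ge_zero order_trans by blast
  have "(norm (vector [a x * f x $ 2, b x * f x $ 1] :: complex^2))\<^sup>2
      = (cmod (a x) * cmod (f x $ 2))\<^sup>2 + (cmod (b x) * cmod (f x $ 1))\<^sup>2"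
    by (simp add: norm_vec2 norm_mult)
  also have "\<dots> \<le> (M * cmod (f x $ 2))\<^sup>2 + (M * cmod (f x $ 1))\<^sup>2"
    using ab by (intro add_mono power_mono mult_right_mono) auto
  also have "\<dots> = (M * norm (f x))\<^sup>2" by (simp add: norm_vec2 power_mult_distrib algebra_simps)
  finally show "norm (vector [a x * f x $ 2, b x * f x $ 1] :: complex^2) \<le> M * norm (f x)"
    by (rule power2_le_imp_le) (simp add: M)
qed

text \<open>The equation \<open>(L - z) F = H\<close> solved for the derivative of \<open>F\<close>.\<close>

definition dirac_rhs :: "real \<Rightarrow> complex \<Rightarrow> (real \<Rightarrow> complex^2) \<Rightarrow> (real \<Rightarrow> complex^2) \<Rightarrow> real \<Rightarrow> complex^2" where
  "dirac_rhs m z F H x = vector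
     [(of_real m + (z - \<i> * of_real (sgn x))) * F x $ 2 + H x $ 2,
      (of_real m - (z - \<i> * of_real (sgn x))) * F x $ 1 - H x $ 1]"

definition dirac_solution :: "real \<Rightarrow> complex \<Rightarrow> (real \<Rightarrow> complex^2) \<Rightarrow> (real \<Rightarrow> complex^2) \<Rightarrow> bool" where
  "dirac_solution m z F H \<longleftrightarrow>
     square_integrable F \<and> square_integrable H \<and> is_primitive F (dirac_rhs m z F H)"

lemma square_integrable_dirac_rhs:
  assumes "square_integrable F" "square_integrable H"
  shows "square_integrable (dirac_rhs m z F H)"
proof -
  have b: "cmod (of_real m + (z - \<i> * of_real (sgn x))) \<le> \<bar>m\<bar> + (cmod z + 1)"
    "cmod (of_real m - (z - \<i> * of_real (sgn x))) \<le> \<bar>m\<bar> + (cmod z + 1)" for x :: real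
  proof -
    have "cmod (\<i> * of_real (sgn x)) \<le> 1" by (simp add: norm_mult sgn_if)
    then have "cmod (z - \<i> * of_real (sgn x)) \<le> cmod z + 1"
      using norm_triangle_ineq4[of z "\<i> * of_real (sgn x)"] by linarith
    then show "cmod (of_real m + (z - \<i> * of_real (sgn x))) \<le> \<bar>m\<bar> + (cmod z + 1)"
      "cmod (of_real m - (z - \<i> * of_real (sgn x))) \<le> \<bar>m\<bar> + (cmod z + 1)"
      using norm_triangle_ineq[of "of_real m" "z - \<i> * of_real (sgn x)"]
        norm_triangle_ineq4[of "of_real m" "z - \<i> * of_real (sgn x)"] by (simp_all del: norm_of_real add: norm_of_real)
  qed
  have "square_integrable (\<lambda>x. vector [(of_real m + (z - \<i> * of_real (sgn x))) * F x $ 2,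
      (of_real m - (z - \<i> * of_real (sgn x))) * F x $ 1])"
    by (rule square_integrable_vector_mult[OF assms(1) _ _ b]) measurable
  moreover have "square_integrable (\<lambda>x. vector [1 * H x $ 2, (- 1) * H x $ 1])"
    by (rule square_integrable_vector_mult[OF assms(2), where M = 1]) auto
  ultimately have "square_integrable (\<lambda>x. vector [(of_real m + (z - \<i> * of_real (sgn x))) * F x $ 2,
      (of_real m - (z - \<i> * of_real (sgn x))) * F x $ 1] + vector [1 * H x $ 2, (- 1) * H x $ 1])"
    by (rule square_integrable_add)
  then show ?thesis
    by (rule back_subst[where P = square_integrable]) (simp add: fun_eq_iff dirac_rhs_def vec2_eq_iff)
qed

lemma dirac_solution_components:
  "dirac_solution m z F H \<Longrightarrow> is_primitive (\<lambda>x. F x $ i) (\<lambda>x. dirac_rhs m z F H x $ i)"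
  unfolding dirac_solution_def by (blast intro: primitive_bounded_linear[OF bounded_linear_vec_nth])

text \<open>The value of \<open>L - z\<close> at a function \<open>F\<close> with derivative \<open>G\<close>.\<close>

definition dirac_value :: "real \<Rightarrow> complex \<Rightarrow> (real \<Rightarrow> complex^2) \<Rightarrow> (real \<Rightarrow> complex^2) \<Rightarrow> real \<Rightarrow> complex^2" where
  "dirac_value m z F G x = vector
     [of_real m * F x $ 1 - G x $ 2 + \<i> * of_real (sgn x) * F x $ 1 - z * F x $ 1,
      G x $ 1 - of_real m * F x $ 2 + \<i> * of_real (sgn x) * F x $ 2 - z * F x $ 2]"

lemma app_shift_abs_L2:
  assumes F: "square_integrable F" and G: "square_integrable G"
    and FG: "has_weak_derivative (abs_L2 F) (abs_L2 G)"
  shows "square_integrable (dirac_value m z F G)"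
    "app (shift_op (dirac_op m) z) (abs_L2 F) = abs_L2 (dirac_value m z F G)"
proof -
  let ?E = "\<lambda>x. vector [complex_of_real m * F x $ 1 - G x $ 2,
                      G x $ 1 - complex_of_real m * F x $ 2]
             + (\<i> * complex_of_real (sgn x)) *s F x :: complex^2"
  have E: "dirac_expression m (abs_L2 F) (abs_L2 G) = abs_L2 ?E"
    by (rule dirac_expression.abs_eq) (use F G in \<open>simp_all add: L2_eq_refl\<close>)
  have "L2_eq ?E ?E"
    using dirac_expression.rsp F G unfolding rel_fun_def by (auto simp: L2_eq_refl)
  then have sE: "square_integrable ?E" by (simp add: L2_eq_def)
  have z: "z *\<^sub>C abs_L2 F = abs_L2 (\<lambda>x. z *s F x)"
    by (intro scaleC_L2.abs_eq L2_eq_refl F)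
  have H: "dirac_value m z F G = (\<lambda>x. ?E x - z *s F x)"
    by (simp add: dirac_value_def fun_eq_iff vec2_eq_iff)
  show "square_integrable (dirac_value m z F G)"
    unfolding H by (intro square_integrable_diff sE square_integrable_smult F)
  show "app (shift_op (dirac_op m) z) (abs_L2 F) = abs_L2 (dirac_value m z F G)"
    unfolding H
    by (simp add: shift_op_def dirac_op_def weak_derivative_eq[OF FG] E z diff_abs_L2[OF sE square_integrable_smult[OF F]])
qed

lemma Dom_shift [simp]: "Dom (shift_op (dirac_op m) z) = H1"
  by (simp add: shift_op_def dirac_op_def)

lemma weak_derivative_imp_app:
  assumes "square_integrable F" "square_integrable H"
    and wd: "has_weak_derivative (abs_L2 F) (abs_L2 (dirac_rhs m z F H))"
  shows "abs_L2 F \<in> H1" "app (shift_op (dirac_op m) z) (abs_L2 F) = abs_L2 H"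
proof -
  show "abs_L2 F \<in> H1" using wd by (auto simp: H1_def)
  have "dirac_value m z F (dirac_rhs m z F H) = H"
    by (simp add: fun_eq_iff vec2_eq_iff dirac_rhs_def dirac_value_def algebra_simps)
  then show "app (shift_op (dirac_op m) z) (abs_L2 F) = abs_L2 H"
    using app_shift_abs_L2(2)[OF assms(1) square_integrable_dirac_rhs[OF assms(1,2)] wd] by simp
qed

lemma dirac_solution_imp_app:
  assumes "dirac_solution m z F H"
  shows "abs_L2 F \<in> H1" "app (shift_op (dirac_op m) z) (abs_L2 F) = abs_L2 H"
proof -
  have sq: "square_integrable F" "square_integrable H" and prim: "is_primitive F (dirac_rhs m z F H)"
    using assms by (auto simp: dirac_solution_def)
  note wd = primitive_imp_weak_derivative[OF sq(1) square_integrable_dirac_rhs[OF sq] prim]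
  show "abs_L2 F \<in> H1" "app (shift_op (dirac_op m) z) (abs_L2 F) = abs_L2 H"
    by (rule weak_derivative_imp_app[OF sq wd])+
qed

lemma app_imp_dirac_solution:
  assumes u: "u \<in> H1" and H: "square_integrable H" and app: "app (shift_op (dirac_op m) z) u = abs_L2 H"
  obtains F where "u = abs_L2 F" "dirac_solution m z F H"
proof -
  obtain g where wd: "has_weak_derivative u g" using u by (auto simp: H1_def)
  obtain f where f: "u = abs_L2 f" "square_integrable f" by (rule L2_cases)
  obtain G where G: "g = abs_L2 G" "square_integrable G" by (rule L2_cases)
  obtain F where F: "is_primitive F G" "square_integrable F" "abs_L2 F = abs_L2 f"
    using wd f G weak_derivative_imp_primitive by metis
  have FG: "has_weak_derivative (abs_L2 F) (abs_L2 G)" using wd f G F by simp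
  note * = app_shift_abs_L2[OF F(2) G(2) FG, of m z]
  have "AE x in lborel. H x = dirac_value m z F G x"
    using app f F * by (intro abs_L2_eqD[OF H]) auto
  then have "AE x in lborel. G x = dirac_rhs m z F H x"
    by eventually_elim (simp add: vec2_eq_iff dirac_rhs_def dirac_value_def algebra_simps)
  then have "is_primitive F (dirac_rhs m z F H)"
    by (intro primitive_cong_AE[OF F(1)] square_integrable_measurable square_integrable_dirac_rhs F H)
  then show thesis using F f H by (intro that[of F]) (auto simp: dirac_solution_def)
qed

lift_definition cnj_L2 :: "L2 \<Rightarrow> L2" is "\<lambda>f x. \<chi> i. cnj (f x $ i)"
proof -
  have "square_integrable (\<lambda>x. \<chi> i. cnj (f x $ i))" if f: "square_integrable f" for f :: "real \<Rightarrow> complex^2"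
  proof (rule square_integrable_bound[OF f, where C = 1])
    note [measurable] = square_integrable_measurable[OF f]
    show "(\<lambda>x. \<chi> i. cnj (f x $ i)) \<in> borel_measurable lborel" by (rule measurable_vec2) simp
    show "norm (\<chi> i. cnj (f x $ i)) \<le> 1 * norm (f x)" for x
      by (rule power2_le_imp_le) (simp_all add: norm_vec2)
  qed
  then show "L2_eq f g \<Longrightarrow> L2_eq (\<lambda>x. \<chi> i. cnj (f x $ i)) (\<lambda>x. \<chi> i. cnj (g x $ i))"
    for f g :: "real \<Rightarrow> complex^2" by (auto simp: L2_eq_def)
qed

lemma cnj_abs_L2: "square_integrable f \<Longrightarrow> cnj_L2 (abs_L2 f) = abs_L2 (\<lambda>x. \<chi> i. cnj (f x $ i))"
  by (rule cnj_L2.abs_eq) (rule L2_eq_refl)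

lemma square_integrable_cnj:
  "square_integrable f \<Longrightarrow> square_integrable (\<lambda>x. \<chi> i. cnj (f x $ i))"
  using cnj_L2.rsp unfolding rel_fun_def L2_eq_def by blast

lemma cinner_cnj_L2:
  assumes "square_integrable f" "square_integrable g"
  shows "cinner (cnj_L2 (abs_L2 f)) (abs_L2 g) = (\<integral>x. f x $ 1 * g x $ 1 + f x $ 2 * g x $ 2 \<partial>lborel)"
  by (simp add: cnj_abs_L2 cinner_abs_L2 square_integrable_cnj assms cdot_2)

lemma cinner_cnj_cnj: "cinner (cnj_L2 f) (cnj_L2 g) = cinner g f"
proof -
  obtain F where F: "f = abs_L2 F" "square_integrable F" by (rule L2_cases)
  obtain G where G: "g = abs_L2 G" "square_integrable G" by (rule L2_cases)
  have "cinner (cnj_L2 f) (cnj_L2 g) = (\<integral>x. cdot (G x) (F x) \<partial>lborel)"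
    using F G by (simp add: cnj_abs_L2[of G] cinner_cnj_L2 square_integrable_cnj cdot_2 mult.commute)
  then show ?thesis using F G by (simp add: cinner_abs_L2)
qed

text \<open>The difference of the two integrands is the derivative of the Wronskian
  \<open>W\<^sub>1 U\<^sub>2 - W\<^sub>2 U\<^sub>1\<close>, which vanishes at both ends.\<close>

lemma dirac_symmetric:
  fixes m :: real and z :: complex
  assumes u: "u \<in> H1" and w: "w \<in> H1"
  defines "S \<equiv> app (shift_op (dirac_op m) z)"
  shows "cinner (cnj_L2 (S w)) u = cinner (cnj_L2 w) (S u)"
proof -
  obtain P where P: "S w = abs_L2 P" "square_integrable P" by (rule L2_cases)
  obtain Q where Q: "S u = abs_L2 Q" "square_integrable Q" by (rule L2_cases)
  obtain W where W: "w = abs_L2 W" "dirac_solution m z W P"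
    using app_imp_dirac_solution[OF w P(2)] P(1) by (auto simp: S_def)
  obtain U where U: "u = abs_L2 U" "dirac_solution m z U Q"
    using app_imp_dirac_solution[OF u Q(2)] Q(1) by (auto simp: S_def)
  have sq: "square_integrable W" "square_integrable U" using W(2) U(2) by (auto simp: dirac_solution_def)
  note cW = dirac_solution_components[OF W(2)] and cU = dirac_solution_components[OF U(2)]
  note prod = primitive_product[OF bounded_bilinear_mult]
  have "is_primitive (\<lambda>x. W x $ 1 * U x $ 2 - W x $ 2 * U x $ 1)
    (\<lambda>x. (P x $ 1 * U x $ 1 + P x $ 2 * U x $ 2) - (W x $ 1 * Q x $ 1 + W x $ 2 * Q x $ 2))"
    by (rule back_subst[where P = "is_primitive _", OF primitive_diff[OF prod[OF cW cU] prod[OF cW cU]]])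
      (simp add: fun_eq_iff dirac_rhs_def algebra_simps)
  then have "(\<integral>x. (P x $ 1 * U x $ 1 + P x $ 2 * U x $ 2) - (W x $ 1 * Q x $ 1 + W x $ 2 * Q x $ 2) \<partial>lborel) = 0"
    by (rule primitive_integral_UNIV)
      (intro Bochner_Integration.integrable_add Bochner_Integration.integrable_diff integrable_component_product sq P Q)+
  then have "(\<integral>x. P x $ 1 * U x $ 1 + P x $ 2 * U x $ 2 \<partial>lborel) - (\<integral>x. W x $ 1 * Q x $ 1 + W x $ 2 * Q x $ 2 \<partial>lborel) = 0"
    by (subst (asm) Bochner_Integration.integral_diff)
      (intro Bochner_Integration.integrable_add integrable_component_product sq P Q)+
  then show ?thesis
    unfolding P(1) Q(1) unfolding W(1) U(1) using sq P(2) Q(2) by (simp add: cinner_cnj_L2)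
qed

text \<open>Written out, the hypothesis is the definition of the weak derivative for both components.
  In this form it passes to limits, which makes the operator closed, and it is implied by
  orthogonality to the range, which identifies the orthogonal complement of the range.\<close>

lemma weak_equation_imp_app:
  assumes weak: "\<And>\<phi> i. \<phi> \<in> test_functions \<Longrightarrow>
    cinner (cnj_L2 (app (shift_op (dirac_op m) z) (test_vector \<phi> i))) u = cinner (cnj_L2 (test_vector \<phi> i)) w"
  shows "u \<in> H1" "app (shift_op (dirac_op m) z) u = w"
proof -
  obtain F where F: "u = abs_L2 F" "square_integrable F" by (rule L2_cases)
  obtain H where H: "w = abs_L2 H" "square_integrable H" by (rule L2_cases)
  let ?G = "dirac_rhs m z F H"
  have G: "square_integrable ?G" by (rule square_integrable_dirac_rhs[OF F(2) H(2)])
  have "has_weak_derivative (abs_L2 F) (abs_L2 ?G)"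
    unfolding has_weak_derivative_iff_cinner
  proof (intro ballI allI)
    fix \<phi> i assume \<phi>: "\<phi> \<in> test_functions"
    note sq = square_integrable_test[OF \<phi>]
    let ?T = "\<lambda>i x. axis i (complex_of_real (\<phi> x)) :: complex^2"
    let ?D = "\<lambda>i x. axis i (complex_of_real (deriv \<phi> x)) :: complex^2"
    note S = app_shift_abs_L2[OF sq test_function_weak_derivative[OF \<phi>, unfolded test_vector_def], where m = m and z = z]
    note prod = integrable_component_product
    have eq: "(\<integral>x. dirac_value m z (?T j) (?D j) x $ 1 * F x $ 1 + dirac_value m z (?T j) (?D j) x $ 2 * F x $ 2 \<partial>lborel)
        = (\<integral>x. ?T j x $ 1 * H x $ 1 + ?T j x $ 2 * H x $ 2 \<partial>lborel)" (is "(\<integral>x. ?l j x \<partial>lborel) = (\<integral>x. ?r j x \<partial>lborel)") for j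
      using weak[OF \<phi>, of j] unfolding test_vector_def S(2) F(1) H(1)
      by (simp only: cinner_cnj_L2[OF S(1) F(2)] cinner_cnj_L2[OF sq(1) H(2)])
    have int: "integrable lborel (?l j)" "integrable lborel (?r j)" for j
      by (intro Bochner_Integration.integrable_add prod S F sq H)+
    have key: "(\<integral>x. ?l j x - ?r j x \<partial>lborel) = 0" for j
      using eq[of j] int[of j] by (subst Bochner_Integration.integral_diff) auto
    have "(\<integral>x. cdot (?D i x) (F x) + cdot (?T i x) (?G x) \<partial>lborel) = 0"
    \<comment> \<open>Each component of the derivative occurs in the equation with the other index.\<close>
    proof (cases "i = 1")
      case True
      have pt: "cdot (?D i x) (F x) + cdot (?T i x) (?G x) = - (?l 2 x - ?r 2 x)" for x
        using True by (simp add: cdot_2 axis_def dirac_rhs_def dirac_value_def algebra_simps)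
      show ?thesis by (simp only: pt Bochner_Integration.integral_minus key minus_zero)
    next
      case False
      then have i: "i = 2" using exhaust_2 by blast
      have pt: "cdot (?D i x) (F x) + cdot (?T i x) (?G x) = ?l 1 x - ?r 1 x" for x
        using i by (simp add: cdot_2 axis_def dirac_rhs_def dirac_value_def algebra_simps)
      show ?thesis by (simp only: pt key)
    qed
    then have "cinner (test_vector (deriv \<phi>) i) (abs_L2 F) + cinner (test_vector \<phi> i) (abs_L2 ?G) = 0"
      unfolding test_vector_def cinner_abs_L2[OF sq(2) F(2)] cinner_abs_L2[OF sq(1) G]
      by (subst Bochner_Integration.integral_add[symmetric]) (intro integrable_cdot sq F G)+
    then show "cinner (test_vector (deriv \<phi>) i) (abs_L2 F) = - cinner (test_vector \<phi> i) (abs_L2 ?G)"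
      by (simp add: eq_neg_iff_add_eq_0)
  qed
  then show "u \<in> H1" "app (shift_op (dirac_op m) z) u = w"
    using weak_derivative_imp_app[OF F(2) H(2)] F H by auto
qed

lemma dirac_solution_add:
  assumes "dirac_solution m z F H" "dirac_solution m z F' H'"
  shows "dirac_solution m z (\<lambda>x. F x + F' x) (\<lambda>x. H x + H' x)"
proof -
  have "is_primitive (\<lambda>x. F x + F' x) (\<lambda>x. dirac_rhs m z F H x + dirac_rhs m z F' H' x)"
    using assms by (intro primitive_add) (auto simp: dirac_solution_def)
  moreover have "(\<lambda>x. dirac_rhs m z F H x + dirac_rhs m z F' H' x) = dirac_rhs m z (\<lambda>x. F x + F' x) (\<lambda>x. H x + H' x)"
    by (simp add: fun_eq_iff vec2_eq_iff dirac_rhs_def algebra_simps)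
  ultimately show ?thesis using assms by (simp add: dirac_solution_def square_integrable_add)
qed

lemma bounded_linear_smult: "bounded_linear (\<lambda>v. c *s (v :: complex^2))"
  by (rule bounded_linear_intro[where K = "cmod c"])
    (auto simp: norm_smult vec2_eq_iff algebra_simps)

lemma dirac_solution_smult:
  assumes "dirac_solution m z F H"
  shows "dirac_solution m z (\<lambda>x. c *s F x) (\<lambda>x. c *s H x)"
proof -
  have "is_primitive (\<lambda>x. c *s F x) (\<lambda>x. c *s dirac_rhs m z F H x)"
    using assms by (intro primitive_bounded_linear[OF bounded_linear_smult]) (auto simp: dirac_solution_def)
  moreover have "(\<lambda>x. c *s dirac_rhs m z F H x) = dirac_rhs m z (\<lambda>x. c *s F x) (\<lambda>x. c *s H x)"
    by (simp add: fun_eq_iff vec2_eq_iff dirac_rhs_def algebra_simps)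
  ultimately show ?thesis using assms by (simp add: dirac_solution_def square_integrable_smult)
qed

lemma dirac_solution_exists:
  assumes "u \<in> H1"
  obtains F H where "u = abs_L2 F" "app (shift_op (dirac_op m) z) u = abs_L2 H" "dirac_solution m z F H"
proof -
  obtain H where H: "app (shift_op (dirac_op m) z) u = abs_L2 H" "square_integrable H" by (rule L2_cases)
  then show thesis using app_imp_dirac_solution[OF assms H(2) H(1)] that by metis
qed

lemma plus_abs_L2: "square_integrable f \<Longrightarrow> square_integrable g \<Longrightarrow> abs_L2 f + abs_L2 g = abs_L2 (\<lambda>x. f x + g x)"
  by (intro plus_L2.abs_eq L2_eq_refl)

lemma scaleC_abs_L2: "square_integrable f \<Longrightarrow> c *\<^sub>C abs_L2 f = abs_L2 (\<lambda>x. c *s f x)"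
  by (intro scaleC_L2.abs_eq L2_eq_refl)

global_interpretation dirac: conjugation_symmetric_op "shift_op (dirac_op m) z" cnj_L2 for m z
proof
  let ?S = "shift_op (dirac_op m) z"
  have add: "u + v \<in> H1" "app ?S (u + v) = app ?S u + app ?S v" if uv: "u \<in> H1" "v \<in> H1" for u v
  proof -
    obtain F H where F: "u = abs_L2 F" "app ?S u = abs_L2 H" "dirac_solution m z F H"
      by (rule dirac_solution_exists[OF uv(1)])
    obtain F' H' where F': "v = abs_L2 F'" "app ?S v = abs_L2 H'" "dirac_solution m z F' H'"
      by (rule dirac_solution_exists[OF uv(2)])
    have "square_integrable F" "square_integrable F'" "square_integrable H" "square_integrable H'"
      using F(3) F'(3) by (auto simp: dirac_solution_def)
    then show "u + v \<in> H1" "app ?S (u + v) = app ?S u + app ?S v"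
      using dirac_solution_imp_app[OF dirac_solution_add[OF F(3) F'(3)]]
      unfolding F(2) F'(2) unfolding F(1) F'(1) by (simp_all add: plus_abs_L2)
  qed
  have scale: "c *\<^sub>C u \<in> H1" "app ?S (c *\<^sub>C u) = c *\<^sub>C app ?S u" if u: "u \<in> H1" for c u
  proof -
    obtain F H where F: "u = abs_L2 F" "app ?S u = abs_L2 H" "dirac_solution m z F H"
      by (rule dirac_solution_exists[OF u])
    then have "square_integrable F" "square_integrable H" by (auto simp: dirac_solution_def)
    then show "c *\<^sub>C u \<in> H1" "app ?S (c *\<^sub>C u) = c *\<^sub>C app ?S u"
      using dirac_solution_imp_app[OF dirac_solution_smult[OF F(3)]]
      unfolding F(2) unfolding F(1) by (simp_all add: scaleC_abs_L2)
  qed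
  have "has_weak_derivative 0 0" by (simp add: has_weak_derivative_iff_cinner)
  then have "0 \<in> H1" by (auto simp: H1_def)
  then show "complex_vector.subspace (Dom ?S)"
    using add(1) scale(1) by (simp add: complex_vector.subspace_def)
  show "app ?S (u + v) = app ?S u + app ?S v" if "u \<in> Dom ?S" "v \<in> Dom ?S" for u v using add that by simp
  show "app ?S (c *\<^sub>C u) = c *\<^sub>C app ?S u" if "u \<in> Dom ?S" for c u using scale that by simp
  show "cnj_L2 (cnj_L2 x) = x" for x
  proof -
    obtain F where F: "x = abs_L2 F" "square_integrable F" by (rule L2_cases)
    then show ?thesis by (simp add: cnj_abs_L2 square_integrable_cnj)
  qed
  show "cnj_L2 (x - y) = cnj_L2 x - cnj_L2 y" for x y
  proof -
    obtain F where F: "x = abs_L2 F" "square_integrable F" by (rule L2_cases)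
    obtain G where G: "y = abs_L2 G" "square_integrable G" by (rule L2_cases)
    have "(\<lambda>x. \<chi> i. cnj ((F x - G x) $ i)) = (\<lambda>x. (\<chi> i. cnj (F x $ i)) - (\<chi> i. cnj (G x $ i)))"
      by (simp add: fun_eq_iff vec_eq_iff)
    then show ?thesis using F G by (simp add: diff_abs_L2 cnj_abs_L2 square_integrable_cnj square_integrable_diff)
  qed
  show "cnj_L2 (c *\<^sub>C x) = cnj c *\<^sub>C cnj_L2 x" for c x
  proof -
    obtain F where F: "x = abs_L2 F" "square_integrable F" by (rule L2_cases)
    have "(\<lambda>x. \<chi> i. cnj ((c *s F x) $ i)) = (\<lambda>x. cnj c *s (\<chi> i. cnj (F x $ i)))"
      by (simp add: fun_eq_iff vec_eq_iff)
    then show ?thesis using F by (simp add: scaleC_abs_L2 cnj_abs_L2 square_integrable_cnj square_integrable_smult)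
  qed
  show "norm (cnj_L2 x) = norm x" for x
  proof -
    have "complex_of_real ((norm (cnj_L2 x))\<^sup>2) = complex_of_real ((norm x)\<^sup>2)"
      using cinner_cnj_cnj[of x x] by (simp add: cinner_self)
    then have "(norm (cnj_L2 x))\<^sup>2 = (norm x)\<^sup>2" by (simp only: of_real_eq_iff)
    then show ?thesis by (simp add: power2_eq_iff_nonneg)
  qed
  show "cinner (cnj_L2 (app ?S w)) u = cinner (cnj_L2 w) (app ?S u)" if "u \<in> Dom ?S" "w \<in> Dom ?S" for u w
    using that dirac_symmetric by simp
  have test: "test_vector \<phi> i \<in> H1" if "\<phi> \<in> test_functions" for \<phi> i
    using test_function_weak_derivative[OF that] by (auto simp: H1_def)
  show "u \<in> Dom ?S \<and> app ?S u = w"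
    if f: "\<And>n. f n \<in> Dom ?S" "f \<longlonglongrightarrow> u" "(\<lambda>n. app ?S (f n)) \<longlonglongrightarrow> w" for f u w
  proof -
    have "cinner (cnj_L2 (app ?S (test_vector \<phi> i))) u = cinner (cnj_L2 (test_vector \<phi> i)) w"
      if "\<phi> \<in> test_functions" for \<phi> i
    proof (rule LIMSEQ_unique)
      show "(\<lambda>n. cinner (cnj_L2 (app ?S (test_vector \<phi> i))) (f n)) \<longlonglongrightarrow>
          cinner (cnj_L2 (app ?S (test_vector \<phi> i))) u" by (rule tendsto_cinner_right[OF f(2)])
      show "(\<lambda>n. cinner (cnj_L2 (app ?S (test_vector \<phi> i))) (f n)) \<longlonglongrightarrow> cinner (cnj_L2 (test_vector \<phi> i)) w"
        using tendsto_cinner_right[OF f(3)] f(1) test[OF that] by (simp add: dirac_symmetric)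
    qed
    from weak_equation_imp_app[OF this] show ?thesis by simp
  qed
  show "cnj_L2 v \<in> ker_op ?S" if v: "\<And>u. u \<in> Dom ?S \<Longrightarrow> cinner v (app ?S u) = 0" for v
  proof -
    have "cinner (cnj_L2 (app ?S (test_vector \<phi> i))) (cnj_L2 v) = cinner (cnj_L2 (test_vector \<phi> i)) 0"
      if "\<phi> \<in> test_functions" for \<phi> i
      using v test[OF that] by (simp add: cinner_cnj_cnj)
    from weak_equation_imp_app[OF this] show ?thesis by (simp add: ker_op_def)
  qed
qed

section \<open>Half-line systems\<close>

lemma cmod_combination_square: "(cmod (a * x + b * y))\<^sup>2 \<le> 2 * (cmod a)\<^sup>2 * (cmod x)\<^sup>2 + 2 * (cmod b)\<^sup>2 * (cmod y)\<^sup>2"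
proof -
  have "(cmod (a * x + b * y))\<^sup>2 \<le> (cmod a * cmod x + cmod b * cmod y)\<^sup>2"
    by (intro power_mono) (simp_all add: norm_triangle_le norm_mult)
  also have "\<dots> \<le> 2 * (cmod a * cmod x)\<^sup>2 + 2 * (cmod b * cmod y)\<^sup>2"
    using sum_squares_bound[of "cmod a * cmod x" "cmod b * cmod y"]
    by (simp add: power2_sum)
  finally show ?thesis by (simp add: power_mult_distrib)
qed

lemma L2_scalar_linear:
  assumes f: "L2_scalar f" and g: "L2_scalar g"
  shows "L2_scalar (\<lambda>x. a * f x + b * g x)"
  unfolding L2_scalar_def
proof
  have [measurable]: "f \<in> borel_measurable borel" "g \<in> borel_measurable borel"
    using f g by (auto simp: L2_scalar_def)
  show m: "(\<lambda>x. a * f x + b * g x) \<in> borel_measurable borel" by measurable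
  show "integrable lborel (\<lambda>x. (cmod (a * f x + b * g x))\<^sup>2)"
  proof (rule Bochner_Integration.integrable_bound)
    show "integrable lborel (\<lambda>x. 2 * (cmod a)\<^sup>2 * (cmod (f x))\<^sup>2 + 2 * (cmod b)\<^sup>2 * (cmod (g x))\<^sup>2)"
      using f g by (intro Bochner_Integration.integrable_add integrable_mult_right) (auto simp: L2_scalar_def)
  qed (use m cmod_combination_square in auto)
qed

lemma L2_scalar_uminus: "L2_scalar f \<Longrightarrow> L2_scalar (\<lambda>x. - f x)"
  using L2_scalar_linear[of f f "-1" 0] by simp

lemma L2_scalar_reflect: "L2_scalar f \<Longrightarrow> L2_scalar (\<lambda>x. f (- x))"
  using integrable_reflect_iff[of "\<lambda>x. (cmod (f x))\<^sup>2"]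
    measurable_compose[of uminus borel borel f borel] by (simp add: L2_scalar_def)

lemmas integrable_inner_scalar = integrable_L2_product[OF bounded_bilinear_inner, unfolded real_norm_def, OF Cauchy_Schwarz_ineq2]

lemma set_integrable_UNIV_subset:
  fixes f :: "real \<Rightarrow> 'a::euclidean_space"
  shows "integrable lborel f \<Longrightarrow> A \<in> sets borel \<Longrightarrow> set_integrable lborel A f"
  unfolding set_integrable_def by (rule integrable_mult_indicator) auto

lemma half_line_integral:
  fixes K k :: "real \<Rightarrow> 'a::euclidean_space"
  assumes "is_primitive K k" "integrable lborel K" "integrable lborel k"
  shows "(LBINT x:{0<..}. k x) = - K 0"
proof -
  have "(LBINT x:{0<..}. k x) = (LBINT x:{0..}. k x)"
    by (rule set_integral_discrete_difference[of "{0}"]) auto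
  then show ?thesis using primitive_tendsto_zero[OF assms] by simp
qed

text \<open>The system \<open>u' = \<alpha>v + g\<close>, \<open>v' = \<beta>u + k\<close>. The equations, not the functions, are restricted to the
  half-line, so that solutions on the line and their reflections can be used directly.\<close>

definition half_line_system ::
    "complex \<Rightarrow> complex \<Rightarrow> (real \<Rightarrow> complex) \<Rightarrow> (real \<Rightarrow> complex) \<Rightarrow> (real \<Rightarrow> complex) \<Rightarrow> (real \<Rightarrow> complex) \<Rightarrow> bool" where
  "half_line_system \<alpha> \<beta> g k u v \<longleftrightarrow> L2_scalar u \<and> L2_scalar v \<and>
     (\<exists>u' v'. is_primitive u u' \<and> is_primitive v v' \<and> L2_scalar u' \<and> L2_scalar v' \<and>
        (\<forall>x>0. u' x = \<alpha> * v x + g x \<and> v' x = \<beta> * u x + k x))"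

lemma half_line_systemI:
  assumes "L2_scalar u" "L2_scalar v" "L2_scalar u'" "L2_scalar v'" "is_primitive u u'" "is_primitive v v'"
    and "\<And>x. x > 0 \<Longrightarrow> u' x = \<alpha> * v x + g x" "\<And>x. x > 0 \<Longrightarrow> v' x = \<beta> * u x + k x"
  shows "half_line_system \<alpha> \<beta> g k u v"
  unfolding half_line_system_def using assms by blast

lemma dirac_right_half_line:
  assumes "dirac_solution m z F H"
  shows "half_line_system (of_real m + (z - \<i>)) (of_real m - (z - \<i>))
    (\<lambda>x. H x $ 2) (\<lambda>x. - H x $ 1) (\<lambda>x. F x $ 1) (\<lambda>x. F x $ 2)"
proof -
  have sq: "square_integrable F" "square_integrable (dirac_rhs m z F H)"
    using assms square_integrable_dirac_rhs by (auto simp: dirac_solution_def)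
  note L = L2_scalar_component
  show ?thesis
    by (rule half_line_systemI[OF L[OF sq(1)] L[OF sq(1)] L[OF sq(2)] L[OF sq(2)]
          dirac_solution_components[OF assms] dirac_solution_components[OF assms]])
      (simp_all add: dirac_rhs_def)
qed

text \<open>The left half-line becomes a right one under the reflection \<open>x \<mapsto> -x\<close>; the sign change of the
  second component restores the form of the system.\<close>

lemma dirac_left_half_line:
  assumes "dirac_solution m z F H"
  shows "half_line_system (of_real m + (z + \<i>)) (of_real m - (z + \<i>))
    (\<lambda>x. - H (- x) $ 2) (\<lambda>x. - H (- x) $ 1) (\<lambda>x. F (- x) $ 1) (\<lambda>x. - F (- x) $ 2)"
proof -
  let ?G = "dirac_rhs m z F H"
  have sq: "square_integrable F" "square_integrable ?G"
    using assms square_integrable_dirac_rhs by (auto simp: dirac_solution_def)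
  note refl = primitive_reflect[OF dirac_solution_components[OF assms]]
  note L = L2_scalar_reflect[OF L2_scalar_component[OF sq(1)]]
    and L' = L2_scalar_reflect[OF L2_scalar_component[OF sq(2)]]
  have "is_primitive (\<lambda>x. - F (- x) $ 2) (\<lambda>x. ?G (- x) $ 2)"
    using primitive_cmult[OF refl[of 2], of "-1"] by simp
  from half_line_systemI[OF L L2_scalar_uminus[OF L] L2_scalar_uminus[OF L'] L' refl[of 1] this]
  show ?thesis by (simp add: dirac_rhs_def algebra_simps)
qed

lemma primitive_linear_combination:
  fixes f F g G :: "real \<Rightarrow> complex"
  assumes "is_primitive F f" "is_primitive G g"
  shows "is_primitive (\<lambda>x. a * F x + b * G x) (\<lambda>x. a * f x + b * g x)"
  by (intro primitive_add primitive_cmult assms)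

lemma primitive_norm_square:
  fixes U V :: "real \<Rightarrow> complex"
  assumes "is_primitive U V"
  shows "is_primitive (\<lambda>x. (cmod (U x))\<^sup>2) (\<lambda>x. 2 * (V x \<bullet> U x))"
  by (rule back_subst[where P = "is_primitive _", OF back_subst[where P = "\<lambda>F. is_primitive F _",
        OF primitive_product[OF bounded_bilinear_inner assms assms]]])
    (simp_all add: fun_eq_iff power2_norm_eq_inner inner_commute)

text \<open>The energy identity for the scalar equation \<open>U' = \<nu> U + g\<close>: a solution in \<open>L2\<close> is controlled
  by \<open>g\<close> alone, together with its initial value, if \<open>Re \<nu> > 0\<close>, and by \<open>g\<close> and its initial value
  if \<open>Re \<nu> < 0\<close>.\<close>

lemma half_line_energy:
  fixes \<nu> :: complex
  assumes prim: "is_primitive U V" and U: "L2_scalar U" and V: "L2_scalar V"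
  defines "N \<equiv> LBINT x:{0<..}. (cmod (U x))\<^sup>2" and "M \<equiv> LBINT x:{0<..}. (cmod (V x - \<nu> * U x))\<^sup>2"
  shows "Re \<nu> > 0 \<Longrightarrow> Re \<nu> * N + (cmod (U 0))\<^sup>2 \<le> M / Re \<nu>"
    and "Re \<nu> < 0 \<Longrightarrow> - Re \<nu> * N \<le> (cmod (U 0))\<^sup>2 + M / (- Re \<nu>)"
proof -
  have g: "L2_scalar (\<lambda>x. V x - \<nu> * U x)" using L2_scalar_linear[OF V U, of 1 "-\<nu>"] by simp
  have iN: "set_integrable lborel {0<..} (\<lambda>x. (cmod (U x))\<^sup>2)"
    and iM: "set_integrable lborel {0<..} (\<lambda>x. (cmod (V x - \<nu> * U x))\<^sup>2)"
    using U g by (auto simp: L2_scalar_def intro!: set_integrable_UNIV_subset)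
  have iUV: "integrable lborel (\<lambda>x. 2 * (V x \<bullet> U x))"
    by (intro integrable_mult_right integrable_inner_scalar U V)
  have eq: "(LBINT x:{0<..}. 2 * (V x \<bullet> U x)) = - (cmod (U 0))\<^sup>2"
    using half_line_integral[OF primitive_norm_square[OF prim] _ iUV] U by (simp add: L2_scalar_def)
  have iUV': "set_integrable lborel {0<..} (\<lambda>x. 2 * (V x \<bullet> U x))"
    by (rule set_integrable_UNIV_subset[OF iUV]) simp
  have VU: "2 * (V x \<bullet> U x) = 2 * Re \<nu> * (cmod (U x))\<^sup>2 + 2 * ((V x - \<nu> * U x) \<bullet> U x)" for x
  proof -
    have "(\<nu> * U x) \<bullet> U x = Re \<nu> * (cmod (U x))\<^sup>2"
      unfolding cmod_power2 by (simp add: inner_complex_def algebra_simps power2_eq_square)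
    then show ?thesis by (simp add: inner_diff_left)
  qed
  have young: "2 * \<bar>a \<bullet> b\<bar> \<le> c * (cmod b)\<^sup>2 + (cmod a)\<^sup>2 / c" if "c > 0" for a b :: complex and c :: real
  proof -
    have "0 \<le> (c * cmod b - cmod a)\<^sup>2 / c" using that by simp
    also have "\<dots> = c * (cmod b)\<^sup>2 + (cmod a)\<^sup>2 / c - 2 * (cmod a * cmod b)"
      using that by (simp add: power2_diff field_simps power2_eq_square)
    finally show ?thesis using Cauchy_Schwarz_ineq2[of a b] by linarith
  qed
  show "Re \<nu> * N + (cmod (U 0))\<^sup>2 \<le> M / Re \<nu>" if c: "Re \<nu> > 0"
  proof -
    have "Re \<nu> * N - M / Re \<nu> = (LBINT x:{0<..}. Re \<nu> * (cmod (U x))\<^sup>2 - (cmod (V x - \<nu> * U x))\<^sup>2 / Re \<nu>)"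
      unfolding N_def M_def using iN iM by (subst set_integral_diff(2)) auto
    also have "\<dots> \<le> (LBINT x:{0<..}. 2 * (V x \<bullet> U x))"
    proof (rule set_integral_mono)
      fix x
      show "Re \<nu> * (cmod (U x))\<^sup>2 - (cmod (V x - \<nu> * U x))\<^sup>2 / Re \<nu> \<le> 2 * (V x \<bullet> U x)"
        using young[OF c, of "V x - \<nu> * U x" "U x"] VU[of x]
          abs_ge_minus_self[of "(V x - \<nu> * U x) \<bullet> U x"] by linarith
    qed (use iN iM iUV' in auto)
    finally show ?thesis using eq by linarith
  qed
  show "- Re \<nu> * N \<le> (cmod (U 0))\<^sup>2 + M / (- Re \<nu>)" if c: "Re \<nu> < 0"
  proof -
    define d where "d = - Re \<nu>"
    have d: "d > 0" "Re \<nu> = - d" using c by (simp_all add: d_def)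
    have "(LBINT x:{0<..}. 2 * (V x \<bullet> U x)) \<le> (LBINT x:{0<..}. (cmod (V x - \<nu> * U x))\<^sup>2 / d - d * (cmod (U x))\<^sup>2)"
    proof (rule set_integral_mono)
      fix x
      show "2 * (V x \<bullet> U x) \<le> (cmod (V x - \<nu> * U x))\<^sup>2 / d - d * (cmod (U x))\<^sup>2"
        using young[OF d(1), of "V x - \<nu> * U x" "U x"] VU[of x, unfolded d(2)]
          abs_ge_self[of "(V x - \<nu> * U x) \<bullet> U x"] by (simp only: mult_minus_right mult_minus_left)
    qed (use iN iM iUV' in auto)
    also have "\<dots> = M / d - d * N"
      unfolding N_def M_def using iN iM by (subst set_integral_diff(2)) auto
    finally have "d * N \<le> (cmod (U 0))\<^sup>2 + M / d" using eq by linarith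
    then show ?thesis by (simp only: d_def)
  qed
qed

definition half_line_mass :: "(real \<Rightarrow> complex) \<Rightarrow> (real \<Rightarrow> complex) \<Rightarrow> real" where
  "half_line_mass u v = (LBINT x:{0<..}. (cmod (u x))\<^sup>2 + (cmod (v x))\<^sup>2)"

text \<open>With \<open>\<mu>\<^sup>2 = \<alpha>\<beta>\<close>, the combinations \<open>\<plusminus>\<mu>u + \<alpha>v\<close> decouple the system into scalar equations
  with rates \<open>\<plusminus>\<mu>\<close>.\<close>

lemma half_line_estimate:
  assumes \<mu>: "\<mu>\<^sup>2 = \<alpha> * \<beta>" "Re \<mu> > 0"
  shows "\<exists>C\<ge>0. \<forall>g k u v. half_line_system \<alpha> \<beta> g k u v \<longrightarrow> L2_scalar g \<longrightarrow> L2_scalar k \<longrightarrow>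
    (cmod (\<mu> * u 0 + \<alpha> * v 0))\<^sup>2 \<le> C * half_line_mass g k \<and>
    half_line_mass u v \<le>
      C * ((cmod (u 0))\<^sup>2 + (cmod (v 0))\<^sup>2 + half_line_mass g k)"
proof -
  define c where "c = Re \<mu>"
  define D where "D = 2 * (cmod \<mu>)\<^sup>2 + 2 * (cmod \<alpha>)\<^sup>2"
  define E where "E = 1 / (2 * (cmod \<mu>)\<^sup>2) + 1 / (2 * (cmod \<alpha>)\<^sup>2)"
  have c: "c > 0" and \<mu>0: "\<mu> \<noteq> 0" using \<mu> by (auto simp: c_def)
  then have \<alpha>0: "\<alpha> \<noteq> 0" using \<mu>(1) by auto
  have D: "D \<ge> 0" and E: "E \<ge> 0" by (simp_all add: D_def E_def)
  define C where "C = D / c + E * (2 * D / c\<^sup>2 + D / c)"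
  have CD: "D / c \<le> C" using D E c by (simp add: C_def)
  have CE: "E * (2 * D / c\<^sup>2) \<le> C" "E * (D / c) \<le> C" using D E c by (simp_all add: C_def distrib_left)
  have C0: "C \<ge> 0" using D E c by (simp add: C_def)
  have "(cmod (\<mu> * u 0 + \<alpha> * v 0))\<^sup>2 \<le> C * half_line_mass g k \<and>
    half_line_mass u v \<le>
      C * ((cmod (u 0))\<^sup>2 + (cmod (v 0))\<^sup>2 + half_line_mass g k)"
    if sys: "half_line_system \<alpha> \<beta> g k u v" and g: "L2_scalar g" and k: "L2_scalar k" for g k u v
  proof -
    obtain u' v' where p: "is_primitive u u'" "is_primitive v v'" and L: "L2_scalar u" "L2_scalar v" "L2_scalar u'" "L2_scalar v'"
      and eq: "\<And>x. x > 0 \<Longrightarrow> u' x = \<alpha> * v x + g x" "\<And>x. x > 0 \<Longrightarrow> v' x = \<beta> * u x + k x"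
      using sys by (auto simp: half_line_system_def)
    define M where "M = half_line_mass g k"
    define P where "P x = \<mu> * u x + \<alpha> * v x" for x
    define R where "R x = (- \<mu>) * u x + \<alpha> * v x" for x
    define NP where "NP = (LBINT x:{0<..}. (cmod (P x))\<^sup>2)"
    define NR where "NR = (LBINT x:{0<..}. (cmod (R x))\<^sup>2)"
    have iM: "set_integrable lborel {0<..} (\<lambda>x. (cmod (g x))\<^sup>2 + (cmod (k x))\<^sup>2)"
      using g k by (intro set_integrable_UNIV_subset) (auto simp: L2_scalar_def)
    have LP: "L2_scalar P" "L2_scalar R" unfolding P_def[abs_def] R_def[abs_def] by (rule L2_scalar_linear[OF L(1,2)])+
    have LP': "L2_scalar (\<lambda>x. \<mu> * u' x + \<alpha> * v' x)" "L2_scalar (\<lambda>x. (- \<mu>) * u' x + \<alpha> * v' x)"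
      by (rule L2_scalar_linear[OF L(3,4)])+
    have pP: "is_primitive P (\<lambda>x. \<mu> * u' x + \<alpha> * v' x)" "is_primitive R (\<lambda>x. (- \<mu>) * u' x + \<alpha> * v' x)"
      unfolding P_def[abs_def] R_def[abs_def] by (rule primitive_linear_combination[OF p])+
    have sq: "\<mu> * \<mu> = \<alpha> * \<beta>" using \<mu>(1) by (simp add: power2_eq_square)
    have gP: "(cmod ((\<mu> * u' x + \<alpha> * v' x) - \<mu> * P x))\<^sup>2 \<le> D * ((cmod (g x))\<^sup>2 + (cmod (k x))\<^sup>2)"
      "(cmod (((- \<mu>) * u' x + \<alpha> * v' x) - (- \<mu>) * R x))\<^sup>2 \<le> D * ((cmod (g x))\<^sup>2 + (cmod (k x))\<^sup>2)" if "x > 0" for x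
    proof -
      have 1: "(\<mu> * u' x + \<alpha> * v' x) - \<mu> * P x = \<mu> * g x + \<alpha> * k x + (\<alpha> * \<beta> - \<mu> * \<mu>) * u x"
        using eq[OF that] by (simp add: P_def algebra_simps)
      have 2: "((- \<mu>) * u' x + \<alpha> * v' x) - (- \<mu>) * R x = (- \<mu>) * g x + \<alpha> * k x + (\<alpha> * \<beta> - \<mu> * \<mu>) * u x"
        using eq[OF that] by (simp add: R_def algebra_simps)
      have "2 * (cmod \<mu>)\<^sup>2 * (cmod (g x))\<^sup>2 + 2 * (cmod \<alpha>)\<^sup>2 * (cmod (k x))\<^sup>2 \<le> D * ((cmod (g x))\<^sup>2 + (cmod (k x))\<^sup>2)"
        by (simp add: D_def algebra_simps)
      then show "(cmod ((\<mu> * u' x + \<alpha> * v' x) - \<mu> * P x))\<^sup>2 \<le> D * ((cmod (g x))\<^sup>2 + (cmod (k x))\<^sup>2)"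
        "(cmod (((- \<mu>) * u' x + \<alpha> * v' x) - (- \<mu>) * R x))\<^sup>2 \<le> D * ((cmod (g x))\<^sup>2 + (cmod (k x))\<^sup>2)"
        unfolding 1 2 sq using cmod_combination_square[of \<mu> "g x" \<alpha> "k x"] cmod_combination_square[of "- \<mu>" "g x" \<alpha> "k x"]
        by simp_all
    qed
    have MP: "(LBINT x:{0<..}. (cmod (w x - \<nu> * W x))\<^sup>2) \<le> D * M"
      if "L2_scalar w" "L2_scalar W" "\<And>x. x > 0 \<Longrightarrow> (cmod (w x - \<nu> * W x))\<^sup>2 \<le> D * ((cmod (g x))\<^sup>2 + (cmod (k x))\<^sup>2)" for w W \<nu>
    proof -
      have "L2_scalar (\<lambda>x. w x - \<nu> * W x)" using L2_scalar_linear[OF that(1,2), of 1 "-\<nu>"] by simp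
      then have "(LBINT x:{0<..}. (cmod (w x - \<nu> * W x))\<^sup>2) \<le> (LBINT x:{0<..}. D * ((cmod (g x))\<^sup>2 + (cmod (k x))\<^sup>2))"
        using that(3) by (intro set_integral_mono set_integrable_mult_right iM)
          (auto simp: L2_scalar_def intro: set_integrable_UNIV_subset)
      then show ?thesis by (simp add: M_def half_line_mass_def)
    qed
    have "c * NP + (cmod (P 0))\<^sup>2 \<le> (LBINT x:{0<..}. (cmod ((\<mu> * u' x + \<alpha> * v' x) - \<mu> * P x))\<^sup>2) / c"
      unfolding NP_def c_def using \<mu>(2) by (intro half_line_energy(1) pP LP LP')
    also have "\<dots> \<le> D * M / c"
      using c by (intro divide_right_mono MP LP LP' gP) auto
    finally have 1: "c * NP + (cmod (P 0))\<^sup>2 \<le> D * M / c" .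
    have "c * NR \<le> (cmod (R 0))\<^sup>2 + (LBINT x:{0<..}. (cmod (((- \<mu>) * u' x + \<alpha> * v' x) - (- \<mu>) * R x))\<^sup>2) / c"
      using half_line_energy(2)[OF pP(2) LP(2) LP'(2), of "- \<mu>"] \<mu>(2) by (simp add: NR_def c_def)
    also have "\<dots> \<le> (cmod (R 0))\<^sup>2 + D * M / c"
      using c by (intro add_left_mono divide_right_mono MP LP LP' gP) auto
    also have "(cmod (R 0))\<^sup>2 \<le> D * ((cmod (u 0))\<^sup>2 + (cmod (v 0))\<^sup>2)"
      unfolding R_def by (rule order_trans[OF cmod_combination_square]) (simp add: D_def algebra_simps)
    finally have 2: "c * NR \<le> D * ((cmod (u 0))\<^sup>2 + (cmod (v 0))\<^sup>2) + D * M / c" by simp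
    have M0: "M \<ge> 0" unfolding M_def half_line_mass_def set_lebesgue_integral_def by (intro integral_nonneg_AE) auto
    have NP0: "NP \<ge> 0" unfolding NP_def set_lebesgue_integral_def by (intro integral_nonneg_AE) auto
    have "(cmod (P 0))\<^sup>2 \<le> D / c * M" using 1 NP0 c by (simp add: add_increasing2 order_trans[rotated])
    also have "\<dots> \<le> C * M" using CD M0 by (rule mult_right_mono)
    finally have A: "(cmod (\<mu> * u 0 + \<alpha> * v 0))\<^sup>2 \<le> C * M" by (simp add: P_def)
    have uv: "(cmod (u x))\<^sup>2 + (cmod (v x))\<^sup>2 \<le> E * ((cmod (P x))\<^sup>2 + (cmod (R x))\<^sup>2)" for x
    proof -
      have *: "2 * \<mu> * u x = 1 * P x + (-1) * R x" "2 * \<alpha> * v x = 1 * P x + 1 * R x"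
        by (simp_all add: P_def R_def)
      have "(cmod (2 * \<mu> * u x))\<^sup>2 \<le> 2 * ((cmod (P x))\<^sup>2 + (cmod (R x))\<^sup>2)"
        "(cmod (2 * \<alpha> * v x))\<^sup>2 \<le> 2 * ((cmod (P x))\<^sup>2 + (cmod (R x))\<^sup>2)"
        unfolding * using cmod_combination_square[of 1 "P x" "-1" "R x"] cmod_combination_square[of 1 "P x" 1 "R x"]
        by (simp_all only: norm_one norm_minus_cancel power_one mult_1_right distrib_left mult.assoc)
      then have "(cmod (u x))\<^sup>2 \<le> ((cmod (P x))\<^sup>2 + (cmod (R x))\<^sup>2) / (2 * (cmod \<mu>)\<^sup>2)"
        "(cmod (v x))\<^sup>2 \<le> ((cmod (P x))\<^sup>2 + (cmod (R x))\<^sup>2) / (2 * (cmod \<alpha>)\<^sup>2)"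
        using \<mu>0 \<alpha>0 by (simp_all add: norm_mult power_mult_distrib pos_le_divide_eq mult_ac)
      then show ?thesis by (simp add: E_def distrib_right)
    qed
    have iuv: "set_integrable lborel {0<..} (\<lambda>x. (cmod (u x))\<^sup>2 + (cmod (v x))\<^sup>2)"
      and iPR: "set_integrable lborel {0<..} (\<lambda>x. (cmod (P x))\<^sup>2)" "set_integrable lborel {0<..} (\<lambda>x. (cmod (R x))\<^sup>2)"
      using L LP by (auto intro!: set_integrable_UNIV_subset simp: L2_scalar_def)
    have "half_line_mass u v \<le> (LBINT x:{0<..}. E * ((cmod (P x))\<^sup>2 + (cmod (R x))\<^sup>2))"
      unfolding half_line_mass_def using uv iuv iPR by (intro set_integral_mono) auto
    also have "\<dots> = E * (NP + NR)" using iPR by (simp add: NP_def NR_def set_integral_add(2))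
    also have "\<dots> \<le> E * (2 * D / c\<^sup>2 * M + D / c * ((cmod (u 0))\<^sup>2 + (cmod (v 0))\<^sup>2))"
    proof (rule mult_left_mono[OF _ E])
      have "c * NP \<le> D * M / c" using 1 zero_le_power2[of "cmod (P 0)"] by linarith
      then have "NP \<le> D * M / c\<^sup>2" using c by (simp add: field_simps power2_eq_square)
      moreover have "NR \<le> (D * ((cmod (u 0))\<^sup>2 + (cmod (v 0))\<^sup>2) + D * M / c) / c"
        using 2 c by (simp add: pos_le_divide_eq mult.commute)
      moreover have "(D * ((cmod (u 0))\<^sup>2 + (cmod (v 0))\<^sup>2) + D * M / c) / c = D / c * ((cmod (u 0))\<^sup>2 + (cmod (v 0))\<^sup>2) + D * M / c\<^sup>2"
        by (simp add: add_divide_distrib power2_eq_square)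
      ultimately show "NP + NR \<le> 2 * D / c\<^sup>2 * M + D / c * ((cmod (u 0))\<^sup>2 + (cmod (v 0))\<^sup>2)" by simp
    qed
    also have "\<dots> = (E * (2 * D / c\<^sup>2)) * M + (E * (D / c)) * ((cmod (u 0))\<^sup>2 + (cmod (v 0))\<^sup>2)"
      by (simp add: algebra_simps)
    also have "\<dots> \<le> C * M + C * ((cmod (u 0))\<^sup>2 + (cmod (v 0))\<^sup>2)"
      using CE M0 by (intro add_mono mult_right_mono) auto
    finally show ?thesis using A by (simp add: M_def algebra_simps)
  qed
  then show ?thesis using C0 by blast
qed

text \<open>Gronwall's argument: \<open>\<bar>u\<bar>\<^sup>2 + \<bar>v\<bar>\<^sup>2\<close>, damped by a suitable exponential, does not increase.\<close>

lemma half_line_unique: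
  assumes sys: "half_line_system \<alpha> \<beta> (\<lambda>_. 0) (\<lambda>_. 0) u v" and 0: "u 0 = 0" "v 0 = 0" and t: "t > 0"
  shows "u t = 0" "v t = 0"
proof -
  obtain u' v' where p: "is_primitive u u'" "is_primitive v v'"
    and eq: "\<And>x. x > 0 \<Longrightarrow> u' x = \<alpha> * v x" "\<And>x. x > 0 \<Longrightarrow> v' x = \<beta> * u x"
    using sys by (auto simp: half_line_system_def)
  define K where "K = cmod \<alpha> + cmod \<beta>"
  define Y where "Y x = (cmod (u x))\<^sup>2 + (cmod (v x))\<^sup>2" for x
  define y where "y x = 2 * (u' x \<bullet> u x) + 2 * (v' x \<bullet> v x)" for x
  have "is_primitive Y y" unfolding Y_def[abs_def] y_def[abs_def]
    by (intro primitive_add primitive_norm_square p)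
  moreover have "is_primitive (\<lambda>x. exp (- K * x)) (\<lambda>x. - K * exp (- K * x))"
    by (rule primitive_derivative)
      (auto intro!: derivative_eq_intros continuous_intros simp flip: has_real_derivative_iff_has_vector_derivative)
  ultimately have "is_primitive (\<lambda>x. exp (- K * x) * Y x) (\<lambda>x. (- K * exp (- K * x)) * Y x + exp (- K * x) * y x)"
    by (intro primitive_product[OF bounded_bilinear_mult])
  note prim = this
  have "(LBINT x:{0..t}. (- K * exp (- K * x)) * Y x + exp (- K * x) * y x) \<le> (LBINT x:{0..t}. 0)"
  proof (rule set_integral_mono_AE)
    show "set_integrable lborel {0..t} (\<lambda>x. (- K * exp (- K * x)) * Y x + exp (- K * x) * y x)"
      by (rule primitive_integrable[OF prim])
    have "AE x in lborel. x \<noteq> (0::real)" by (rule AE_lborel_singleton)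
    then show "AE x \<in> {0..t} in lborel. (- K * exp (- K * x)) * Y x + exp (- K * x) * y x \<le> 0"
    proof eventually_elim
      case (elim x)
      show ?case
      proof
        assume "x \<in> {0..t}"
        with elim have x: "x > 0" by simp
        have "y x \<le> K * Y x"
        proof -
          have "u' x \<bullet> u x \<le> cmod \<alpha> * (cmod (v x) * cmod (u x))" "v' x \<bullet> v x \<le> cmod \<beta> * (cmod (v x) * cmod (u x))"
            using norm_cauchy_schwarz[of "u' x" "u x"] norm_cauchy_schwarz[of "v' x" "v x"]
            by (simp_all add: eq[OF x] norm_mult mult_ac)
          then have "y x \<le> K * (2 * (cmod (v x) * cmod (u x)))"
            by (simp add: y_def K_def algebra_simps)
          also have "\<dots> \<le> K * Y x"
            using sum_squares_bound[of "cmod (v x)" "cmod (u x)"]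
            by (intro mult_left_mono) (simp_all add: Y_def K_def mult.assoc)
          finally show ?thesis .
        qed
        then have "exp (- K * x) * y x \<le> exp (- K * x) * (K * Y x)" by (intro mult_left_mono) auto
        then show "(- K * exp (- K * x)) * Y x + exp (- K * x) * y x \<le> 0" by (simp add: mult_ac)
      qed
    qed
  qed (simp add: set_integrable_def)
  then have "exp (- K * t) * Y t - exp (- K * 0) * Y 0 \<le> 0"
    using primitive_integral[OF prim, of 0 t] t by simp
  then have "Y t \<le> 0" using 0 by (simp add: Y_def mult_le_0_iff)
  then show "u t = 0" "v t = 0" by (simp_all add: Y_def add_nonneg_eq_0_iff power2_eq_square
      sum_squares_le_zero_iff)
qed

text \<open>The quadratic form \<open>\<alpha>v\<^sup>2 - \<beta>u\<^sup>2\<close> is constant along homogeneous solutions, hence zero for a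
  solution in \<open>L2\<close>.\<close>

lemma half_line_invariant:
  assumes sys: "half_line_system \<alpha> \<beta> (\<lambda>_. 0) (\<lambda>_. 0) u v"
  shows "\<alpha> * (v 0)\<^sup>2 = \<beta> * (u 0)\<^sup>2"
proof -
  obtain u' v' where p: "is_primitive u u'" "is_primitive v v'" and L: "L2_scalar u" "L2_scalar v" "L2_scalar u'" "L2_scalar v'"
    and eq: "\<And>x. x > 0 \<Longrightarrow> u' x = \<alpha> * v x" "\<And>x. x > 0 \<Longrightarrow> v' x = \<beta> * u x"
    using sys by (auto simp: half_line_system_def)
  define q where "q x = \<alpha> * (v' x * v x + v x * v' x) + (- \<beta>) * (u' x * u x + u x * u' x)" for x
  have "is_primitive (\<lambda>x. \<alpha> * (v x * v x) + (- \<beta>) * (u x * u x)) q"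
    unfolding q_def[abs_def]
    by (intro primitive_linear_combination primitive_product[OF bounded_bilinear_mult] p)
  moreover have "integrable lborel (\<lambda>x. \<alpha> * (v x * v x) + (- \<beta>) * (u x * u x))" "integrable lborel q"
    unfolding q_def[abs_def]
    by (intro Bochner_Integration.integrable_add integrable_mult_right integrable_mult_scalar L)+
  ultimately have "(LBINT x:{0<..}. q x) = - (\<alpha> * (v 0 * v 0) + (- \<beta>) * (u 0 * u 0))"
    by (rule half_line_integral)
  moreover have "(LBINT x:{0<..}. q x) = (LBINT x:{0::real<..}. 0)"
    by (intro set_lebesgue_integral_cong) (auto simp: q_def eq)
  ultimately show ?thesis by (simp add: power2_eq_square)
qed

text \<open>The solutions rotate with constant norm, which is zero for a solution in \<open>L2\<close>.\<close>

lemma half_line_rotation: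
  assumes sys: "half_line_system (complex_of_real r) (- complex_of_real r) (\<lambda>_. 0) (\<lambda>_. 0) u v"
  shows "u 0 = 0" "v 0 = 0"
proof -
  obtain u' v' where p: "is_primitive u u'" "is_primitive v v'" and L: "L2_scalar u" "L2_scalar v" "L2_scalar u'" "L2_scalar v'"
    and eq: "\<And>x. x > 0 \<Longrightarrow> u' x = of_real r * v x" "\<And>x. x > 0 \<Longrightarrow> v' x = - of_real r * u x"
    using sys by (auto simp: half_line_system_def)
  have "is_primitive (\<lambda>x. (cmod (u x))\<^sup>2 + (cmod (v x))\<^sup>2) (\<lambda>x. 2 * (u' x \<bullet> u x) + 2 * (v' x \<bullet> v x))"
    by (intro primitive_add primitive_norm_square p)
  moreover have "integrable lborel (\<lambda>x. (cmod (u x))\<^sup>2 + (cmod (v x))\<^sup>2)"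
    using L by (intro Bochner_Integration.integrable_add) (auto simp: L2_scalar_def)
  moreover have "integrable lborel (\<lambda>x. 2 * (u' x \<bullet> u x) + 2 * (v' x \<bullet> v x))"
    by (intro Bochner_Integration.integrable_add integrable_mult_right integrable_inner_scalar L)
  ultimately have "(LBINT x:{0<..}. 2 * (u' x \<bullet> u x) + 2 * (v' x \<bullet> v x)) = - ((cmod (u 0))\<^sup>2 + (cmod (v 0))\<^sup>2)"
    by (rule half_line_integral)
  then have "(cmod (u 0))\<^sup>2 + (cmod (v 0))\<^sup>2 = - (LBINT x:{0<..}. 2 * (u' x \<bullet> u x) + 2 * (v' x \<bullet> v x))"
    by linarith
  moreover have "(LBINT x:{0<..}. 2 * (u' x \<bullet> u x) + 2 * (v' x \<bullet> v x)) = (LBINT x:{0::real<..}. 0)"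
    by (intro set_lebesgue_integral_cong) (auto simp: eq inner_complex_def algebra_simps)
  ultimately have "(cmod (u 0))\<^sup>2 + (cmod (v 0))\<^sup>2 = 0"
    by (simp only: set_lebesgue_integral_zero minus_zero)
  then have "(cmod (u 0))\<^sup>2 = 0" "(cmod (v 0))\<^sup>2 = 0"
    by (simp_all only: add_nonneg_eq_0_iff zero_le_power2)
  then show "u 0 = 0" "v 0 = 0" by simp_all
qed

text \<open>A resonant source: for an imaginary rate, a bounded exponential divided by \<open>1 + x\<close> is square
  integrable, but it makes the amplitude of the solution grow logarithmically.\<close>

lemma half_line_not_solvable:
  assumes \<kappa>: "\<alpha> * \<beta> = - (complex_of_real \<kappa>)\<^sup>2"
  shows "\<exists>g k. L2_scalar g \<and> L2_scalar k \<and> (\<forall>u v. \<not> half_line_system \<alpha> \<beta> g k u v)"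
proof -
  \<comment> \<open>a left eigenvector of the coefficient matrix for the eigenvalue \<open>\<i>\<kappa>\<close>\<close>
  obtain a b where ab: "b * \<beta> = \<i> * of_real \<kappa> * a" "a * \<alpha> = \<i> * of_real \<kappa> * b" "(a, b) \<noteq> (0, 0)"
  proof (cases "\<alpha> = 0")
    case True
    then have "\<kappa> = 0" using \<kappa> by simp
    then show thesis using that[of 0 1] True by simp
  next
    case False
    then show thesis using that[of \<alpha> "\<i> * of_real \<kappa>"] \<kappa> by (simp add: power2_eq_square algebra_simps)
  qed
  define n where "n = (cmod a)\<^sup>2 + (cmod b)\<^sup>2"
  have n: "n > 0" using ab(3) by (auto simp: n_def add_pos_nonneg add_nonneg_pos)
  define e where "e x = exp (\<i> * of_real (\<kappa> * x))" for x :: real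
  define h where "h x = (if x > 0 then e x * of_real (1 / (1 + x)) else 0)" for x :: real
  have ne: "cmod (e x) = 1" for x by (simp add: e_def norm_exp_eq_Re)
  have [measurable]: "e \<in> borel_measurable borel"
    unfolding e_def[abs_def] by (intro borel_measurable_continuous_onI continuous_intros)
  have mh: "h \<in> borel_measurable borel" unfolding h_def[abs_def] by measurable
  have "L2_scalar h"
  proof -
    have "(\<integral>\<^sup>+x. ennreal (1 / (1 + x)\<^sup>2) * indicator {0..} x \<partial>lborel) = ennreal (0 - (- (1 / (1 + 0))))"
    proof (rule nn_integral_FTC_atLeast)
      show "((\<lambda>x. - (1 / (1 + x))) has_real_derivative 1 / (1 + x)\<^sup>2) (at x)" if "0 \<le> x" for x :: real
        using that by (auto intro!: derivative_eq_intros simp: power2_eq_square)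
      show "((\<lambda>x::real. - (1 / (1 + x))) \<longlongrightarrow> 0) at_top" by real_asymp
    qed auto
    moreover have "(\<integral>\<^sup>+x. ennreal ((cmod (h x))\<^sup>2) \<partial>lborel) \<le> (\<integral>\<^sup>+x. ennreal (1 / (1 + x)\<^sup>2) * indicator {0..} x \<partial>lborel)"
    proof (rule nn_integral_mono)
      fix x :: real
      have "(cmod (h x))\<^sup>2 = 1 / (1 + x)\<^sup>2" if "x > 0"
      proof -
        have "cmod (h x) = \<bar>1 / (1 + x)\<bar>" using that unfolding h_def by (simp only: norm_mult ne norm_of_real if_True mult_1_left)
        then show ?thesis by (simp add: power_divide)
      qed
      then show "ennreal ((cmod (h x))\<^sup>2) \<le> ennreal (1 / (1 + x)\<^sup>2) * indicator {0..} x"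
        by (cases "x > 0") (simp_all add: h_def)
    qed
    ultimately have "(\<integral>\<^sup>+x. ennreal ((cmod (h x))\<^sup>2) \<partial>lborel) < \<infinity>" by (auto intro: le_less_trans)
    then show ?thesis using mh by (auto simp: L2_scalar_def intro!: integrableI_nonneg)
  qed
  define g where "g x = (cnj a / of_real n) * h x" for x
  define k where "k x = (cnj b / of_real n) * h x" for x
  have L: "L2_scalar g" "L2_scalar k"
    unfolding g_def[abs_def] k_def[abs_def]
    using L2_scalar_linear[OF \<open>L2_scalar h\<close> \<open>L2_scalar h\<close>, of "cnj a / of_real n" 0]
      L2_scalar_linear[OF \<open>L2_scalar h\<close> \<open>L2_scalar h\<close>, of "cnj b / of_real n" 0] by simp_all
  have gk: "a * g x + b * k x = h x" for x
  proof -
    have "a * cnj a + b * cnj b = of_real n"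
      by (simp add: n_def complex_norm_square[symmetric] flip: of_real_power)
    then have 1: "(a * cnj a + b * cnj b) / of_real n = 1" using n by simp
    have "a * g x + b * k x = ((a * cnj a + b * cnj b) / of_real n) * h x"
      using n by (simp add: g_def k_def field_simps)
    then show ?thesis unfolding 1 by simp
  qed
  have "\<not> half_line_system \<alpha> \<beta> g k u v" for u v
  proof
    assume "half_line_system \<alpha> \<beta> g k u v"
    then obtain u' v' where p: "is_primitive u u'" "is_primitive v v'" and Lu: "L2_scalar u" "L2_scalar v" "L2_scalar u'" "L2_scalar v'"
      and eq: "\<And>x. x > 0 \<Longrightarrow> u' x = \<alpha> * v x + g x" "\<And>x. x > 0 \<Longrightarrow> v' x = \<beta> * u x + k x"
      by (auto simp: half_line_system_def)
    define P where "P x = a * u x + b * v x" for x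
    define P' where "P' x = a * u' x + b * v' x" for x
    have pP: "is_primitive P P'" unfolding P_def[abs_def] P'_def[abs_def] by (rule primitive_linear_combination[OF p])
    have LP: "L2_scalar P" "L2_scalar P'"
      unfolding P_def[abs_def] P'_def[abs_def] using L2_scalar_linear Lu by auto
    have P': "P' x = \<i> * of_real \<kappa> * P x + h x" if "x > 0" for x
    proof -
      have "P' x = (a * \<alpha>) * v x + (b * \<beta>) * u x + (a * g x + b * k x)"
        using eq[OF that] by (simp add: P'_def algebra_simps)
      then show ?thesis unfolding ab(1,2) gk by (simp add: P_def algebra_simps)
    qed
    \<comment> \<open>The integrating factor turns the amplitude into a primitive of \<open>1 / (1 + x)\<close>.\<close>
    define e' where "e' x = exp (- (\<i> * of_real \<kappa>) * of_real x)" for x :: real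
    have e'e: "e' x * e x = 1" for x by (simp add: e_def e'_def flip: exp_add) 
    have ne': "cmod (e' x) = 1" for x by (simp add: e'_def norm_exp_eq_Re)
    have pe: "is_primitive e' (\<lambda>x. - (\<i> * of_real \<kappa>) * e' x)"
    proof (rule primitive_derivative)
      show "(e' has_vector_derivative - (\<i> * of_real \<kappa>) * e' x) (at x)" for x
        unfolding e'_def[abs_def]
        by (rule has_vector_derivative_real_field)
          (auto intro!: derivative_eq_intros)
      show "continuous_on UNIV (\<lambda>x. - (\<i> * of_real \<kappa>) * e' x)"
        unfolding e'_def[abs_def] by (intro continuous_intros)
    qed
    note pQ = primitive_product[OF bounded_bilinear_mult pe pP]
    have Q: "e' t * P t - P 0 = of_real (ln (1 + t))" if t: "t > 0" for t
    proof -
      have "(LBINT x:{0..t}. - (\<i> * of_real \<kappa>) * e' x * P x + e' x * P' x) = (LBINT x:{0..t}. complex_of_real (1 / (1 + x)))"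
      proof (rule set_lebesgue_integral_cong_AE)
        show "(\<lambda>x. - (\<i> * of_real \<kappa>) * e' x * P x + e' x * P' x) \<in> borel_measurable lborel"
          using primitive_measurable[OF pQ] by simp
        have "AE x in lborel. x \<noteq> (0::real)" by (rule AE_lborel_singleton)
        then show "AE x \<in> {0..t} in lborel. - (\<i> * of_real \<kappa>) * e' x * P x + e' x * P' x = complex_of_real (1 / (1 + x))"
        proof eventually_elim
          case (elim x)
          show ?case
          proof
            assume "x \<in> {0..t}"
            with elim have x: "x > 0" by simp
            have "- (\<i> * of_real \<kappa>) * e' x * P x + e' x * P' x = e' x * h x"
              unfolding P'[OF x] by (simp add: algebra_simps)
            also have "\<dots> = (e' x * e x) * complex_of_real (1 / (1 + x))" using x by (simp add: h_def)
            finally show "- (\<i> * of_real \<kappa>) * e' x * P x + e' x * P' x = complex_of_real (1 / (1 + x))"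
              by (simp add: e'e)
          qed
        qed
      qed auto
      also have "\<dots> = complex_of_real (LBINT x:{0..t}. 1 / (1 + x))" by (rule set_integral_complex_of_real)
      also have "(LBINT x:{0..t}. 1 / (1 + x)) = ln (1 + t) - ln (1 + 0)"
        unfolding set_lebesgue_integral_def
      proof (rule integral_FTC_Icc)
        show "((\<lambda>x. ln (1 + x)) has_vector_derivative 1 / (1 + x)) (at x within {0..t})" if "0 \<le> x" for x
          using that by (auto intro!: derivative_eq_intros simp flip: has_real_derivative_iff_has_vector_derivative)
        show "continuous_on {0..t} (\<lambda>x. 1 / (1 + x))" by (auto intro!: continuous_intros)
      qed (use t in auto)
      also have "(LBINT x:{0..t}. - (\<i> * of_real \<kappa>) * e' x * P x + e' x * P' x) = e' t * P t - e' 0 * P 0"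
        using t by (intro primitive_integral[OF pQ]) simp
      finally show ?thesis by (simp add: e'_def)
    qed
    define B where "B = (\<integral>x. \<bar>2 * (P' x \<bullet> P x)\<bar> \<partial>lborel)"
    have iPP: "integrable lborel (\<lambda>x. 2 * (P' x \<bullet> P x))"
      by (intro integrable_mult_right integrable_inner_scalar LP)
    have bound: "(cmod (P t))\<^sup>2 \<le> B" for t
    proof -
      have "(LBINT x:{t..}. 2 * (P' x \<bullet> P x)) = - (cmod (P t))\<^sup>2"
        using LP by (intro primitive_tendsto_zero primitive_norm_square pP iPP) (simp add: L2_scalar_def)
      then have "(cmod (P t))\<^sup>2 = \<bar>LBINT x:{t..}. 2 * (P' x \<bullet> P x)\<bar>" by simp
      also have "\<dots> \<le> (\<integral>x. \<bar>indicator {t..} x *\<^sub>R (2 * (P' x \<bullet> P x))\<bar> \<partial>lborel)"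
        unfolding set_lebesgue_integral_def by (rule integral_abs_bound)
      also have "\<dots> \<le> B" unfolding B_def
        using iPP set_integrable_UNIV_subset[OF iPP, of "{t..}"]
        by (intro integral_mono integrable_abs) (auto simp: set_integrable_def indicator_def)
      finally show ?thesis .
    qed
    \<comment> \<open>a time at which the logarithm exceeds the bound on the amplitude\<close>
    define t where "t = exp (sqrt B + sqrt B + 1)"
    have "B \<ge> 0" using bound[of 0] zero_le_power2 order_trans by blast
    have PB: "cmod (P x) \<le> sqrt B" for x using bound by (rule real_le_rsqrt)
    have "sqrt B + sqrt B + 1 < ln (1 + t)"
      by (subst exp_less_cancel_iff[symmetric]) (simp add: t_def add_pos_pos)
    also have "\<dots> = cmod (of_real (ln (1 + t)))" by (simp add: t_def)
    also have "\<dots> = cmod (e' t * P t - P 0)" by (subst Q) (simp_all add: t_def)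
    also have "\<dots> \<le> cmod (e' t * P t) + cmod (P 0)" by (rule norm_triangle_ineq4)
    also have "\<dots> \<le> sqrt B + sqrt B" using PB[of t] PB[of 0] by (simp add: norm_mult ne')
    finally show False by simp
  qed
  then show ?thesis using L by blast
qed

section \<open>Estimates off the singular lines\<close>

lemma integral_split_reflect:
  fixes k :: "real \<Rightarrow> 'a::euclidean_space"
  assumes "integrable lborel k"
  shows "(\<integral>x. k x \<partial>lborel) = (LBINT x:{0<..}. k x) + (LBINT x:{0<..}. k (- x))"
proof -
  have "(LBINT x:{..0} \<union> {0<..}. k x) = (LBINT x:{..0}. k x) + (LBINT x:{0<..}. k x)"
    by (rule set_integral_Un) (auto intro: set_integrable_UNIV_subset assms)
  moreover have "{..0} \<union> {0<..} = (UNIV :: real set)" by auto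
  moreover have "(LBINT x:{..0}. k x) = (LBINT x:{0..}. k (- x))"
    using set_integral_reflect_atLeast[of 0 k] by simp
  moreover have "(LBINT x:{0..}. k (- x)) = (LBINT x:{0<..}. k (- x))"
    by (rule set_integral_discrete_difference[of "{0}"]) auto
  ultimately show ?thesis by (simp add: set_lebesgue_integral_def)
qed

definition mass :: "(real \<Rightarrow> complex^2) \<Rightarrow> real" where
  "mass F = (\<integral>x. (norm (F x))\<^sup>2 \<partial>lborel)"

lemma mass_nonneg: "mass F \<ge> 0"
  by (simp add: mass_def)

lemma norm_abs_L2_mass: "square_integrable F \<Longrightarrow> norm (abs_L2 F) = sqrt (mass F)"
  using norm_abs_L2[of F] by (simp add: mass_def flip: real_sqrt_unique)

lemma mass_split:
  assumes "square_integrable F"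
  shows "mass F = half_line_mass (\<lambda>x. F x $ 1) (\<lambda>x. F x $ 2)
    + half_line_mass (\<lambda>x. F (- x) $ 1) (\<lambda>x. F (- x) $ 2)"
  using integral_split_reflect[of "\<lambda>x. (norm (F x))\<^sup>2"] assms
  by (simp add: mass_def half_line_mass_def square_integrable_def norm_vec2)

text \<open>Both half-lines at once: each side controls, by the source alone, the combination of the
  components at the origin that belongs to its growing direction.\<close>

lemma dirac_estimate:
  assumes "\<mu>\<^sup>2 = (of_real m + (z - \<i>)) * (of_real m - (z - \<i>))" "Re \<mu> > 0"
    and "\<nu>\<^sup>2 = (of_real m + (z + \<i>)) * (of_real m - (z + \<i>))" "Re \<nu> > 0"
  obtains C where "C \<ge> 0"
    "\<And>F H. dirac_solution m z F H \<Longrightarrow> (cmod (\<mu> * F 0 $ 1 + (of_real m + (z - \<i>)) * F 0 $ 2))\<^sup>2 \<le> C * mass H"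
    "\<And>F H. dirac_solution m z F H \<Longrightarrow> (cmod (\<nu> * F 0 $ 1 - (of_real m + (z + \<i>)) * F 0 $ 2))\<^sup>2 \<le> C * mass H"
    "\<And>F H. dirac_solution m z F H \<Longrightarrow> mass F \<le> C * ((cmod (F 0 $ 1))\<^sup>2 + (cmod (F 0 $ 2))\<^sup>2 + mass H)"
proof -
  obtain A where A: "A \<ge> 0" and A': "\<And>g k u v. half_line_system (of_real m + (z - \<i>)) (of_real m - (z - \<i>)) g k u v \<Longrightarrow> L2_scalar g \<Longrightarrow> L2_scalar k \<Longrightarrow>
    (cmod (\<mu> * u 0 + (of_real m + (z - \<i>)) * v 0))\<^sup>2 \<le> A * half_line_mass g k \<and>
    half_line_mass u v \<le>
      A * ((cmod (u 0))\<^sup>2 + (cmod (v 0))\<^sup>2 + half_line_mass g k)"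
    using half_line_estimate[OF assms(1,2)] by blast
  obtain B where B: "B \<ge> 0" and B': "\<And>g k u v. half_line_system (of_real m + (z + \<i>)) (of_real m - (z + \<i>)) g k u v \<Longrightarrow> L2_scalar g \<Longrightarrow> L2_scalar k \<Longrightarrow>
    (cmod (\<nu> * u 0 + (of_real m + (z + \<i>)) * v 0))\<^sup>2 \<le> B * half_line_mass g k \<and>
    half_line_mass u v \<le>
      B * ((cmod (u 0))\<^sup>2 + (cmod (v 0))\<^sup>2 + half_line_mass g k)"
    using half_line_estimate[OF assms(3,4)] by blast
  have main: "(cmod (\<mu> * F 0 $ 1 + (of_real m + (z - \<i>)) * F 0 $ 2))\<^sup>2 \<le> (A + B) * mass H \<and>
     (cmod (\<nu> * F 0 $ 1 - (of_real m + (z + \<i>)) * F 0 $ 2))\<^sup>2 \<le> (A + B) * mass H \<and>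
     mass F \<le> (A + B) * ((cmod (F 0 $ 1))\<^sup>2 + (cmod (F 0 $ 2))\<^sup>2 + mass H)"
    if sol: "dirac_solution m z F H" for F H
  proof -
    have sq: "square_integrable F" "square_integrable H" using sol by (auto simp: dirac_solution_def)
    define hr where "hr = half_line_mass (\<lambda>x. H x $ 2) (\<lambda>x. H x $ 1)"
    define hl where "hl = half_line_mass (\<lambda>x. H (- x) $ 2) (\<lambda>x. H (- x) $ 1)"
    define fr where "fr = half_line_mass (\<lambda>x. F x $ 1) (\<lambda>x. F x $ 2)"
    define fl where "fl = half_line_mass (\<lambda>x. F (- x) $ 1) (\<lambda>x. F (- x) $ 2)"
    define s where "s = (cmod (F 0 $ 1))\<^sup>2 + (cmod (F 0 $ 2))\<^sup>2"
    note L = L2_scalar_component[OF sq(2)]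
    have r: "(cmod (\<mu> * F 0 $ 1 + (of_real m + (z - \<i>)) * F 0 $ 2))\<^sup>2 \<le> A * hr" "fr \<le> A * (s + hr)"
      using A'[OF dirac_right_half_line[OF sol] L L2_scalar_uminus[OF L]]
      unfolding hr_def fr_def s_def half_line_mass_def by (simp_all only: norm_minus_cancel)
    have l: "(cmod (\<nu> * F 0 $ 1 - (of_real m + (z + \<i>)) * F 0 $ 2))\<^sup>2 \<le> B * hl" "fl \<le> B * (s + hl)"
      using B'[OF dirac_left_half_line[OF sol] L2_scalar_uminus[OF L2_scalar_reflect[OF L]] L2_scalar_uminus[OF L2_scalar_reflect[OF L]]]
      unfolding hl_def fl_def s_def half_line_mass_def by (simp_all only: norm_minus_cancel minus_zero mult_minus_right add_uminus_conv_diff)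
    have h: "mass H = hr + hl" "mass F = fr + fl"
      unfolding mass_split[OF sq(1)] mass_split[OF sq(2)] hr_def hl_def fr_def fl_def by (simp_all add: half_line_mass_def add.commute)
    have nn: "hr \<ge> 0" "hl \<ge> 0" "s \<ge> 0"
      unfolding hr_def hl_def s_def half_line_mass_def set_lebesgue_integral_def by (auto intro!: integral_nonneg_AE)
    have "A * hr \<le> (A + B) * mass H" "B * hl \<le> (A + B) * mass H"
      using A B nn by (auto simp: h intro!: mult_mono)
    moreover have "A * (s + hr) + B * (s + hl) \<le> A * (s + mass H) + B * (s + mass H)"
      using A B nn by (intro add_mono mult_left_mono) (auto simp: h)
    ultimately show ?thesis using r l by (simp add: h s_def[symmetric] distrib_right)
  qed
  show thesis by (rule that[of "A + B"]) (use A B main in auto)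
qed

lemma abs_L2_zero: "abs_L2 (\<lambda>_. 0) = 0"
  using scaleC_abs_L2[OF square_integrable_zero, of 0] by simp

text \<open>For \<open>H = 0\<close> the estimate leaves only the multiples of \<open>K0\<close> in the kernel; so it is an estimate
  modulo the kernel.\<close>

lemma kernel_from_estimate:
  assumes K0: "dirac_solution m z K0 (\<lambda>_. 0)"
    and est: "\<And>F H. dirac_solution m z F H \<Longrightarrow> \<exists>c. mass (\<lambda>x. F x - c *s K0 x) \<le> D * mass H"
  shows "dirac.bounded_below_mod_ker m z"
    and "ker_op (shift_op (dirac_op m) z) = complex_vector.span {abs_L2 K0}"
proof -
  let ?S = "shift_op (dirac_op m) z"
  have sK: "square_integrable K0" using K0 by (simp add: dirac_solution_def)
  have kK: "c *\<^sub>C abs_L2 K0 \<in> ker_op ?S" for c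
    using dirac_solution_imp_app[OF K0] dirac.subspace_ker[of m z]
    by (intro complex_vector.subspace_scale) (simp_all add: ker_op_def abs_L2_zero)
  have main: "\<exists>c. norm (u - c *\<^sub>C abs_L2 K0) \<le> sqrt \<bar>D\<bar> * norm (app ?S u)" if u: "u \<in> H1" for u
  proof -
    obtain F H where F: "u = abs_L2 F" "app ?S u = abs_L2 H" "dirac_solution m z F H"
      by (rule dirac_solution_exists[OF u])
    then have sq: "square_integrable F" "square_integrable H" by (auto simp: dirac_solution_def)
    obtain c where c: "mass (\<lambda>x. F x - c *s K0 x) \<le> D * mass H" using est[OF F(3)] by blast
    also have "\<dots> \<le> \<bar>D\<bar> * mass H" using mass_nonneg by (intro mult_right_mono) auto
    finally have "sqrt (mass (\<lambda>x. F x - c *s K0 x)) \<le> sqrt \<bar>D\<bar> * sqrt (mass H)"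
      unfolding real_sqrt_mult[symmetric] by (rule real_sqrt_le_mono)
    moreover have "u - c *\<^sub>C abs_L2 K0 = abs_L2 (\<lambda>x. F x - c *s K0 x)"
      using sq sK by (simp add: F(1) scaleC_abs_L2 diff_abs_L2 square_integrable_smult)
    ultimately show ?thesis
      using sq sK unfolding F(2)
      by (intro exI[of _ c]) (simp add: norm_abs_L2_mass square_integrable_diff square_integrable_smult)
  qed
  show "dirac.bounded_below_mod_ker m z"
    unfolding dirac.bounded_below_mod_ker_def
  proof (intro exI ballI)
    fix u assume "u \<in> Dom ?S"
    then show "\<exists>k\<in>ker_op ?S. norm (u - k) \<le> sqrt \<bar>D\<bar> * norm (app ?S u)"
      using main[of u] kK by auto
  qed
  show "ker_op ?S = complex_vector.span {abs_L2 K0}"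
    unfolding complex_vector.span_singleton
  proof (intro equalityI subsetI)
    fix u assume "u \<in> ker_op ?S"
    then have "u \<in> H1" "app ?S u = 0" by (auto simp: ker_op_def)
    then show "u \<in> range (\<lambda>c. c *\<^sub>C abs_L2 K0)" using main[of u] by auto
  qed (use kK in auto)
qed

lemma dirac_solution_zero: "dirac_solution m z (\<lambda>_. 0) (\<lambda>_. 0)"
proof -
  have "dirac_rhs m z (\<lambda>_. 0) (\<lambda>_. 0) = (\<lambda>_. 0)"
    by (simp add: fun_eq_iff dirac_rhs_def vec2_eq_iff)
  then show ?thesis by (simp add: dirac_solution_def square_integrable_zero primitive_const)
qed

text \<open>The two combinations controlled at the origin are independent, so Cramer's rule bounds the
  value there, and with it the solution.\<close>

lemma nondegenerate_estimate:
  assumes \<mu>: "\<mu>\<^sup>2 = (of_real m + (z - \<i>)) * (of_real m - (z - \<i>))" "Re \<mu> > 0"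
    and \<nu>: "\<nu>\<^sup>2 = (of_real m + (z + \<i>)) * (of_real m - (z + \<i>))" "Re \<nu> > 0"
    and det: "\<mu> * (of_real m + (z + \<i>)) + \<nu> * (of_real m + (z - \<i>)) \<noteq> 0"
  shows "dirac.bounded_below_mod_ker m z" "ker_op (shift_op (dirac_op m) z) = {0}"
proof -
  obtain C where C: "C \<ge> 0" and
    est: "\<And>F H. dirac_solution m z F H \<Longrightarrow> (cmod (\<mu> * F 0 $ 1 + (of_real m + (z - \<i>)) * F 0 $ 2))\<^sup>2 \<le> C * mass H"
    "\<And>F H. dirac_solution m z F H \<Longrightarrow> (cmod (\<nu> * F 0 $ 1 - (of_real m + (z + \<i>)) * F 0 $ 2))\<^sup>2 \<le> C * mass H"
    "\<And>F H. dirac_solution m z F H \<Longrightarrow> mass F \<le> C * ((cmod (F 0 $ 1))\<^sup>2 + (cmod (F 0 $ 2))\<^sup>2 + mass H)"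
    using dirac_estimate[OF \<mu> \<nu>] by blast
  define b where "b = of_real m + (z - \<i>)"
  define d where "d = of_real m + (z + \<i>)"
  define \<Delta> where "\<Delta> = \<mu> * d + \<nu> * b"
  have \<Delta>: "\<Delta> \<noteq> 0" using det by (simp add: \<Delta>_def b_def d_def)
  define E where "E = 2 * (cmod (d / \<Delta>))\<^sup>2 + 2 * (cmod (b / \<Delta>))\<^sup>2 + (2 * (cmod (\<nu> / \<Delta>))\<^sup>2 + 2 * (cmod (- \<mu> / \<Delta>))\<^sup>2)"
  have "mass F \<le> C * (E * C + 1) * mass H" if sol: "dirac_solution m z F H" for F H
  proof -
    define p where "p = \<mu> * F 0 $ 1 + b * F 0 $ 2"
    define r where "r = \<nu> * F 0 $ 1 - d * F 0 $ 2"
    have pr: "(cmod p)\<^sup>2 \<le> C * mass H" "(cmod r)\<^sup>2 \<le> C * mass H"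
      using est(1,2)[OF sol] by (simp_all add: p_def r_def b_def d_def)
    have "F 0 $ 1 = (d / \<Delta>) * p + (b / \<Delta>) * r"
    proof -
      have "d * p + b * r = \<Delta> * F 0 $ 1" by (simp add: p_def r_def \<Delta>_def algebra_simps)
      then show ?thesis using \<Delta> by (simp add: field_simps)
    qed
    moreover have "F 0 $ 2 = (\<nu> / \<Delta>) * p + (- \<mu> / \<Delta>) * r"
    proof -
      have "\<nu> * p - \<mu> * r = \<Delta> * F 0 $ 2" by (simp add: p_def r_def \<Delta>_def algebra_simps)
      then show ?thesis using \<Delta> by (simp add: field_simps)
    qed
    ultimately have "(cmod (F 0 $ 1))\<^sup>2 \<le> 2 * (cmod (d / \<Delta>))\<^sup>2 * (cmod p)\<^sup>2 + 2 * (cmod (b / \<Delta>))\<^sup>2 * (cmod r)\<^sup>2"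
      "(cmod (F 0 $ 2))\<^sup>2 \<le> 2 * (cmod (\<nu> / \<Delta>))\<^sup>2 * (cmod p)\<^sup>2 + 2 * (cmod (- \<mu> / \<Delta>))\<^sup>2 * (cmod r)\<^sup>2"
      using cmod_combination_square by metis+
    moreover have "2 * (cmod (d / \<Delta>))\<^sup>2 * (cmod p)\<^sup>2 \<le> 2 * (cmod (d / \<Delta>))\<^sup>2 * (C * mass H)"
      "2 * (cmod (b / \<Delta>))\<^sup>2 * (cmod r)\<^sup>2 \<le> 2 * (cmod (b / \<Delta>))\<^sup>2 * (C * mass H)"
      "2 * (cmod (\<nu> / \<Delta>))\<^sup>2 * (cmod p)\<^sup>2 \<le> 2 * (cmod (\<nu> / \<Delta>))\<^sup>2 * (C * mass H)"
      "2 * (cmod (- \<mu> / \<Delta>))\<^sup>2 * (cmod r)\<^sup>2 \<le> 2 * (cmod (- \<mu> / \<Delta>))\<^sup>2 * (C * mass H)"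
      using pr by (simp_all add: mult_left_mono)
    ultimately have "(cmod (F 0 $ 1))\<^sup>2 + (cmod (F 0 $ 2))\<^sup>2 \<le> E * (C * mass H)"
      unfolding E_def distrib_right by linarith
    then have "C * ((cmod (F 0 $ 1))\<^sup>2 + (cmod (F 0 $ 2))\<^sup>2 + mass H) \<le> C * (E * (C * mass H) + mass H)"
      using C by (intro mult_left_mono) auto
    then show ?thesis using est(3)[OF sol] by (simp add: algebra_simps)
  qed
  then have "\<exists>c. mass (\<lambda>x. F x - c *s 0) \<le> C * (E * C + 1) * mass H" if "dirac_solution m z F H" for F H
    using that by simp
  from kernel_from_estimate[OF dirac_solution_zero this]
  show "dirac.bounded_below_mod_ker m z" "ker_op (shift_op (dirac_op m) z) = {0}"
    by (simp_all add: abs_L2_zero)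
qed

text \<open>The principal root fails only if \<open>m\<^sup>2 - w\<^sup>2\<close> is a nonpositive real number, that is, if \<open>w\<close> is
  real with \<open>\<bar>w\<bar> \<ge> m\<close>.\<close>

lemma root_exists:
  assumes "m \<ge> 0" "\<not> (Im w = 0 \<and> \<bar>Re w\<bar> \<ge> m)"
  obtains \<mu> where "\<mu>\<^sup>2 = (of_real m + w) * (of_real m - w)" "Re \<mu> > 0"
proof -
  define \<mu> where "\<mu> = csqrt ((of_real m + w) * (of_real m - w))"
  have sq: "\<mu>\<^sup>2 = (of_real m + w) * (of_real m - w)" by (simp add: \<mu>_def)
  have "Re \<mu> \<noteq> 0"
  proof
    assume "Re \<mu> = 0"
    then have "Re ((of_real m + w) * (of_real m - w)) = - (Im \<mu>)\<^sup>2" "Im ((of_real m + w) * (of_real m - w)) = 0"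
      unfolding sq[symmetric] by (simp_all add: power2_eq_square)
    then have re: "(Re w)\<^sup>2 = m\<^sup>2 + (Im \<mu>)\<^sup>2 + (Im w)\<^sup>2" and im: "Re w * Im w = 0"
      by (simp_all add: power2_eq_square algebra_simps)
    have "Im w = 0"
    proof (rule ccontr)
      assume "Im w \<noteq> 0"
      then have "Re w = 0" using im by simp
      then have "(Im w)\<^sup>2 = - m\<^sup>2 - (Im \<mu>)\<^sup>2" using re by simp
      also have "\<dots> \<le> 0" by simp
      finally show False using \<open>Im w \<noteq> 0\<close> by simp
    qed
    moreover have "m \<le> \<bar>Re w\<bar>"
      using re assms(1) by (intro power2_le_imp_le[of m]) simp_all
    ultimately show False using assms(2) by simp
  qed
  moreover have "Re \<mu> \<ge> 0" unfolding \<mu>_def using csqrt_principal[of "(of_real m + w) * (of_real m - w)"] by auto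
  ultimately show thesis using sq by (intro that[of \<mu>]) auto
qed

text \<open>If the determinant vanished, the squares of its two terms would agree, and this reduces to
  \<open>4\<i>m = 0\<close>.\<close>

lemma massive_regular:
  assumes m: "m > 0" and z: "\<not> (\<bar>Re z\<bar> \<ge> m \<and> \<bar>Im z\<bar> = 1)"
  shows "dirac.bounded_below_mod_ker m z" "ker_op (shift_op (dirac_op m) z) = {0}"
proof -
  obtain \<mu> where \<mu>: "\<mu>\<^sup>2 = (of_real m + (z - \<i>)) * (of_real m - (z - \<i>))" "Re \<mu> > 0"
    by (rule root_exists[of m "z - \<i>"]) (use m z in auto)
  obtain \<nu> where \<nu>: "\<nu>\<^sup>2 = (of_real m + (z + \<i>)) * (of_real m - (z + \<i>))" "Re \<nu> > 0"
    by (rule root_exists[of m "z + \<i>"]) (use m z in auto)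
  define b where "b = of_real m + (z - \<i>)"
  define d where "d = of_real m + (z + \<i>)"
  have b0: "b \<noteq> 0" and d0: "d \<noteq> 0" using \<mu> \<nu> by (auto simp: b_def d_def)
  have "\<mu> * d + \<nu> * b \<noteq> 0"
  proof
    assume "\<mu> * d + \<nu> * b = 0"
    then have "(\<mu> * d)\<^sup>2 = (\<nu> * b)\<^sup>2" by (simp add: add_eq_0_iff2)
    then have "(b * (of_real m - (z - \<i>))) * d\<^sup>2 = (d * (of_real m - (z + \<i>))) * b\<^sup>2"
      using \<mu>(1) \<nu>(1) by (simp add: power_mult_distrib b_def d_def)
    then have "(b * d) * ((of_real m - (z - \<i>)) * d) = (b * d) * ((of_real m - (z + \<i>)) * b)"
      by (simp add: power2_eq_square mult_ac)
    then have "(of_real m - (z - \<i>)) * d = (of_real m - (z + \<i>)) * b" using b0 d0 by simp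
    then have "4 * \<i> * of_real m = 0" by (simp add: b_def d_def algebra_simps)
    then show False using m by simp
  qed
  then show "dirac.bounded_below_mod_ker m z" "ker_op (shift_op (dirac_op m) z) = {0}"
    using nondegenerate_estimate[OF \<mu> \<nu>] by (simp_all add: b_def d_def)
qed

text \<open>For \<open>m = 0\<close> the rates are \<open>\<plusminus>\<i>w\<close>; outside the strip the one with positive real part has the
  same sign on both sides, and the two terms of the determinant add up.\<close>

lemma massless_regular:
  assumes z: "\<bar>Im z\<bar> > 1"
  shows "dirac.bounded_below_mod_ker 0 z" "ker_op (shift_op (dirac_op 0) z) = {0}"
proof -
  define s where "s = (if Im z > 1 then - \<i> else \<i>)"
  have s2: "s * s = -1" "s \<noteq> 0" by (simp_all add: s_def)
  have "(s * (z - \<i>))\<^sup>2 = (s * s) * (z - \<i>)\<^sup>2" "(s * (z + \<i>))\<^sup>2 = (s * s) * (z + \<i>)\<^sup>2"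
    by (simp_all only: power2_eq_square mult_ac)
  then have 1: "(s * (z - \<i>))\<^sup>2 = (of_real 0 + (z - \<i>)) * (of_real 0 - (z - \<i>))"
    "(s * (z + \<i>))\<^sup>2 = (of_real 0 + (z + \<i>)) * (of_real 0 - (z + \<i>))"
    by (simp_all add: s2 power2_eq_square del: mult_minus_right, simp_all add: algebra_simps)
  have 2: "Re (s * (z - \<i>)) > 0" "Re (s * (z + \<i>)) > 0" using z by (auto simp: s_def)
  have nz: "s * (z - \<i>) \<noteq> 0" "s * (z + \<i>) \<noteq> 0" using 2 by (metis less_irrefl zero_complex.sel(1))+
  have "(s * (z - \<i>)) * (of_real 0 + (z + \<i>)) + (s * (z + \<i>)) * (of_real 0 + (z - \<i>))
      = 2 * (s * (z - \<i>)) * (z + \<i>)" by (simp add: algebra_simps)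
  then have 3: "(s * (z - \<i>)) * (of_real 0 + (z + \<i>)) + (s * (z + \<i>)) * (of_real 0 + (z - \<i>)) \<noteq> 0"
    using nz by simp
  show "dirac.bounded_below_mod_ker 0 z" "ker_op (shift_op (dirac_op 0) z) = {0}"
    by (rule nondegenerate_estimate[OF 1(1) 2(1) 1(2) 2(2) 3])+
qed

section \<open>The kernel in the massless strip\<close>

lemma primitive_exp_abs: "is_primitive (\<lambda>x::real. exp (- \<bar>x\<bar>)) (\<lambda>x. - sgn x * exp (- \<bar>x\<bar>))"
proof (rule is_primitiveI)
  show "(\<lambda>x::real. - sgn x * exp (- \<bar>x\<bar>)) \<in> borel_measurable borel" by measurable
  fix a b :: real assume ab: "a \<le> b"
  show int: "set_integrable lborel {a..b} (\<lambda>x. - sgn x * exp (- \<bar>x\<bar>))"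
    by (rule set_integrable_bound[OF set_integrable_const_Icc[of a b "1::real"]])
      (auto simp: set_borel_measurable_def abs_mult sgn_if)
  have "((\<lambda>x. - sgn x * exp (- \<bar>x\<bar>)) has_integral (exp (- \<bar>b\<bar>) - exp (- \<bar>a\<bar>))) {a..b}"
  proof (rule fundamental_theorem_of_calculus_interior_strong[of "{0}"])
    fix x :: real assume x: "x \<in> {a<..<b} - {0}"
    have "(abs has_real_derivative sgn x) (at x)"
    proof (cases "x > 0")
      case True
      have "((\<lambda>x. x) has_real_derivative sgn x) (at x)" using True by simp
      then show ?thesis
        by (rule has_field_derivative_transform_within_open[where S = "{0<..}"]) (use True in auto)
    next
      case False
      then have "((\<lambda>x. - x) has_real_derivative sgn x) (at x)"
        using x by (auto intro!: derivative_eq_intros)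
      then show ?thesis
        by (rule has_field_derivative_transform_within_open[where S = "{..<0}"]) (use x False in auto)
    qed
    from DERIV_chain2[OF DERIV_exp DERIV_minus[OF this]]
    show "((\<lambda>x. exp (- \<bar>x\<bar>)) has_vector_derivative - sgn x * exp (- \<bar>x\<bar>)) (at x)"
      by (simp add: mult.commute flip: has_real_derivative_iff_has_vector_derivative)
  qed (auto simp: ab intro!: continuous_intros)
  then show "(LBINT x:{a..b}. - sgn x * exp (- \<bar>x\<bar>)) = exp (- \<bar>b\<bar>) - exp (- \<bar>a\<bar>)"
    by (rule set_borel_integral_eq_integral(2)[OF int, THEN trans, OF integral_unique])
qed

lemma integrable_exp_abs:
  assumes "d > 0"
  shows "integrable lborel (\<lambda>x::real. exp (- d * \<bar>x\<bar>))"
proof -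
  define f where "f x = (if x \<ge> 0 then exp (- d * x) else 0)" for x
  have [measurable]: "f \<in> borel_measurable borel" unfolding f_def[abs_def] by measurable
  have "(\<integral>\<^sup>+x. ennreal (exp (- d * x)) * indicator {0..} x \<partial>lborel) = ennreal (0 - (- (exp (- d * 0) / d)))"
  proof (rule nn_integral_FTC_atLeast)
    show "((\<lambda>x. - (exp (- d * x) / d)) has_real_derivative exp (- d * x)) (at x)" for x
      using assms by (auto intro!: derivative_eq_intros)
    show "((\<lambda>x. - (exp (- d * x) / d)) \<longlongrightarrow> 0) at_top" using assms by real_asymp
  qed auto
  moreover have "(\<integral>\<^sup>+x. ennreal (f x) \<partial>lborel) = (\<integral>\<^sup>+x. ennreal (exp (- d * x)) * indicator {0..} x \<partial>lborel)"
    by (intro nn_integral_cong) (simp add: f_def indicator_def)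
  ultimately have "(\<integral>\<^sup>+x. ennreal (f x) \<partial>lborel) < \<infinity>" by simp
  then have f: "integrable lborel f" by (intro integrableI_nonneg) (auto simp: f_def)
  have "integrable lborel (\<lambda>x. f x + f (- x))"
    using f integrable_reflect_iff[of f] by (intro Bochner_Integration.integrable_add) auto
  then show ?thesis
    by (rule Bochner_Integration.integrable_bound) (auto simp: f_def)
qed

text \<open>The function \<open>exp (- \<i>zx - \<bar>x\<bar>)\<close>, split so that only a real factor has a corner.\<close>

definition kernel_scalar :: "complex \<Rightarrow> real \<Rightarrow> complex" where
  "kernel_scalar z x = exp (- \<bar>x\<bar>) *\<^sub>R exp (- (\<i> * z) * of_real x)"

lemma kernel_scalar_primitive:
  "is_primitive (kernel_scalar z) (\<lambda>x. (- (\<i> * z) - of_real (sgn x)) * kernel_scalar z x)"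
proof -
  have "is_primitive (\<lambda>x. exp (- (\<i> * z) * of_real x)) (\<lambda>x. - (\<i> * z) * exp (- (\<i> * z) * of_real x))"
  proof (rule primitive_derivative)
    show "((\<lambda>x. exp (- (\<i> * z) * of_real x)) has_vector_derivative - (\<i> * z) * exp (- (\<i> * z) * of_real x)) (at x)" for x
      by (rule has_vector_derivative_real_field) (auto intro!: derivative_eq_intros)
  qed (intro continuous_intros)
  from primitive_product[OF bounded_bilinear_scaleR primitive_exp_abs this]
  have "is_primitive (kernel_scalar z) (\<lambda>x. (- sgn x * exp (- \<bar>x\<bar>)) *\<^sub>R exp (- (\<i> * z) * of_real x)
      + exp (- \<bar>x\<bar>) *\<^sub>R (- (\<i> * z) * exp (- (\<i> * z) * of_real x)))"
    by (simp add: kernel_scalar_def[abs_def])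
  then show ?thesis
    by (rule back_subst[where P = "is_primitive _"])
      (simp add: fun_eq_iff kernel_scalar_def scaleR_conv_of_real algebra_simps)
qed

lemma kernel_solution:
  assumes "\<bar>Im z\<bar> < 1"
  shows "dirac_solution 0 z (\<lambda>x. vector [kernel_scalar z x, - \<i> * kernel_scalar z x]) (\<lambda>_. 0)"
  unfolding dirac_solution_def
proof (intro conjI)
  let ?T = "\<lambda>e::complex. vector [e, - \<i> * e] :: complex^2"
  have T: "bounded_linear ?T"
  proof (rule bounded_linear_intro[where K = 2])
    show "norm (?T e) \<le> norm e * 2" for e
      by (rule power2_le_imp_le) (simp_all add: norm_vec2 norm_mult power_mult_distrib)
  qed (simp_all add: vec2_eq_iff algebra_simps)
  have c: "continuous_on UNIV (\<lambda>x. ?T (kernel_scalar z x))"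
    by (intro primitive_continuous[OF primitive_bounded_linear[OF T kernel_scalar_primitive]])
  show "square_integrable (\<lambda>x. ?T (kernel_scalar z x))"
    unfolding square_integrable_def
  proof
    show m: "(\<lambda>x. ?T (kernel_scalar z x)) \<in> borel_measurable lborel"
      using borel_measurable_continuous_onI[OF c] by simp
    define d where "d = 2 * (1 - \<bar>Im z\<bar>)"
    have d: "d > 0" using assms by (simp add: d_def)
    show "integrable lborel (\<lambda>x. (norm (?T (kernel_scalar z x)))\<^sup>2)"
    proof (rule Bochner_Integration.integrable_bound)
      show "integrable lborel (\<lambda>x. 2 * exp (- d * \<bar>x\<bar>))"
        by (intro integrable_mult_right integrable_exp_abs d)
      have "(norm (?T (kernel_scalar z x)))\<^sup>2 \<le> 2 * exp (- d * \<bar>x\<bar>)" for x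
      proof -
        have "(norm (?T (kernel_scalar z x)))\<^sup>2 = 2 * (exp (- \<bar>x\<bar>) * exp (Im z * x))\<^sup>2"
          by (simp add: norm_vec2 norm_mult kernel_scalar_def norm_exp_eq_Re power_mult_distrib)
        also have "(exp (- \<bar>x\<bar>) * exp (Im z * x))\<^sup>2 = exp (2 * (Im z * x - \<bar>x\<bar>))"
          by (simp add: power2_eq_square flip: exp_add)
        also have "\<dots> \<le> exp (- d * \<bar>x\<bar>)"
        proof -
          have "Im z * x \<le> \<bar>Im z\<bar> * \<bar>x\<bar>" using abs_ge_self[of "Im z * x"] by (simp add: abs_mult)
          then show ?thesis by (simp add: d_def algebra_simps)
        qed
        finally show ?thesis by simp
      qed
      then show "AE x in lborel. norm ((norm (?T (kernel_scalar z x)))\<^sup>2) \<le> norm (2 * exp (- d * \<bar>x\<bar>))" by simp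
      show "(\<lambda>x. (norm (?T (kernel_scalar z x)))\<^sup>2) \<in> borel_measurable lborel" using m by measurable
    qed
  qed
  show "square_integrable (\<lambda>_. 0)" by (rule square_integrable_zero)
  have "is_primitive (\<lambda>x. ?T (kernel_scalar z x)) (\<lambda>x. ?T ((- (\<i> * z) - of_real (sgn x)) * kernel_scalar z x))"
    by (rule primitive_bounded_linear[OF T kernel_scalar_primitive])
  then show "is_primitive (\<lambda>x. ?T (kernel_scalar z x)) (dirac_rhs 0 z (\<lambda>x. ?T (kernel_scalar z x)) (\<lambda>_. 0))"
    by (rule back_subst[where P = "is_primitive _"])
      (simp add: fun_eq_iff dirac_rhs_def vec2_eq_iff algebra_simps)
qed

text \<open>In the strip, both boundary conditions at the origin control the same combination of the
  two components; a multiple of the kernel element removes the first component.\<close>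

lemma massless_strip:
  assumes z: "\<bar>Im z\<bar> < 1"
  obtains k where "dirac.bounded_below_mod_ker 0 z"
    "ker_op (shift_op (dirac_op 0) z) = complex_vector.span {k}" "k \<noteq> 0"
proof -
  let ?K = "\<lambda>x. vector [kernel_scalar z x, - \<i> * kernel_scalar z x] :: complex^2"
  note K = kernel_solution[OF z]
  have K0: "?K 0 $ 1 = 1" by (simp add: kernel_scalar_def)
  have 1: "(\<i> * (z - \<i>))\<^sup>2 = (of_real 0 + (z - \<i>)) * (of_real 0 - (z - \<i>))"
    "(- \<i> * (z + \<i>))\<^sup>2 = (of_real 0 + (z + \<i>)) * (of_real 0 - (z + \<i>))"
    by (simp_all add: power2_eq_square algebra_simps)
  have 2: "Re (\<i> * (z - \<i>)) > 0" "Re (- \<i> * (z + \<i>)) > 0" using z by auto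
  obtain C where C: "C \<ge> 0" and
    est: "\<And>F H. dirac_solution 0 z F H \<Longrightarrow> (cmod (\<i> * (z - \<i>) * F 0 $ 1 + (of_real 0 + (z - \<i>)) * F 0 $ 2))\<^sup>2 \<le> C * mass H"
    "\<And>F H. dirac_solution 0 z F H \<Longrightarrow> mass F \<le> C * ((cmod (F 0 $ 1))\<^sup>2 + (cmod (F 0 $ 2))\<^sup>2 + mass H)"
    by (rule dirac_estimate[OF 1(1) 2(1) 1(2) 2(2)]) metis
  define q where "q = (cmod (z - \<i>))\<^sup>2"
  have "z - \<i> \<noteq> 0" using 2(1) by auto
  then have q: "q > 0" by (simp add: q_def)
  have "\<exists>c. mass (\<lambda>x. F x - c *s ?K x) \<le> C * (C / q + 1) * mass H" if sol: "dirac_solution 0 z F H" for F H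
  proof (intro exI)
    define c where "c = F 0 $ 1"
    define G where "G x = F x - c *s ?K x" for x
    have "dirac_solution 0 z (\<lambda>x. F x + (- c) *s ?K x) (\<lambda>x. H x + (- c) *s 0)"
      by (intro dirac_solution_add dirac_solution_smult sol K)
    then have G: "dirac_solution 0 z G H" by (simp add: G_def[abs_def])
    have G0: "G 0 $ 1 = 0" using K0 by (simp add: G_def c_def)
    have "q * (cmod (G 0 $ 2))\<^sup>2 \<le> C * mass H"
      using est(1)[OF G] by (simp add: G0 norm_mult power_mult_distrib q_def)
    then have "(cmod (G 0 $ 2))\<^sup>2 \<le> C / q * mass H" using q by (simp add: field_simps)
    then have "C * ((cmod (G 0 $ 1))\<^sup>2 + (cmod (G 0 $ 2))\<^sup>2 + mass H) \<le> C * (C / q * mass H + mass H)"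
      using C by (intro mult_left_mono) (auto simp: G0)
    then show "mass (\<lambda>x. F x - c *s ?K x) \<le> C * (C / q + 1) * mass H"
      using est(2)[OF G] by (simp add: G_def[abs_def] algebra_simps)
  qed
  note * = kernel_from_estimate[OF K this]
  have "abs_L2 ?K \<noteq> 0"
  proof
    assume "abs_L2 ?K = 0"
    then have "AE x in lborel. ?K x = 0"
      using K by (intro abs_L2_eqD[of _ "\<lambda>_. 0", unfolded abs_L2_zero] square_integrable_zero) (auto simp: dirac_solution_def)
    moreover have "?K x \<noteq> 0" for x by (simp add: vec2_eq_iff kernel_scalar_def)
    ultimately have "AE x in (lborel :: real measure). False" by simp
    then show False by (simp only: eventually_False ae_filter_eq_bot_iff) simp
  qed
  with * show thesis by (rule that)
qed

section \<open>The singular lines\<close>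

text \<open>The value at the origin determines a homogeneous solution on both sides.\<close>

lemma ker_trivial:
  assumes "\<And>F. dirac_solution m z F (\<lambda>_. 0) \<Longrightarrow> F 0 $ 1 = 0 \<and> F 0 $ 2 = 0"
  shows "ker_op (shift_op (dirac_op m) z) = {0}"
proof -
  have "u = 0" if "u \<in> ker_op (shift_op (dirac_op m) z)" for u
  proof -
    have u: "u \<in> H1" "app (shift_op (dirac_op m) z) u = abs_L2 (\<lambda>_. 0)"
      using that by (auto simp: ker_op_def abs_L2_zero)
    obtain F where F: "u = abs_L2 F" "dirac_solution m z F (\<lambda>_. 0)"
      by (rule app_imp_dirac_solution[OF u(1) square_integrable_zero u(2)])
    have 0: "F 0 $ 1 = 0" "F 0 $ 2 = 0" using assms[OF F(2)] by auto
    have "half_line_system (of_real m + (z - \<i>)) (of_real m - (z - \<i>)) (\<lambda>_. 0) (\<lambda>_. 0) (\<lambda>x. F x $ 1) (\<lambda>x. F x $ 2)"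
      using dirac_right_half_line[OF F(2)] by simp
    from half_line_unique[OF this] have r: "F x $ 1 = 0" "F x $ 2 = 0" if "x > 0" for x using that 0 by auto
    have "half_line_system (of_real m + (z + \<i>)) (of_real m - (z + \<i>)) (\<lambda>_. 0) (\<lambda>_. 0) (\<lambda>x. F (- x) $ 1) (\<lambda>x. - F (- x) $ 2)"
      using dirac_left_half_line[OF F(2)] by simp
    from half_line_unique[OF this] have l: "F (- x) $ 1 = 0" "F (- x) $ 2 = 0" if "x > 0" for x using that 0 by auto
    have "F x = 0" for x
      using r[of x] l[of "- x"] 0 by (cases x "0::real" rule: linorder_cases) (auto simp: vec2_eq_iff)
    then have "F = (\<lambda>_. 0)" by blast
    then show ?thesis using F(1) abs_L2_zero by simp
  qed
  moreover have "0 \<in> ker_op (shift_op (dirac_op m) z)"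
    by (rule complex_vector.subspace_0[OF dirac.subspace_ker])
  ultimately show ?thesis by blast
qed

text \<open>On each side a quadratic form of \<open>F(0)\<close> vanishes; the two forms have no common zero but the
  origin, since \<open>m > 0\<close>.\<close>

lemma massive_injective:
  assumes m: "m > 0"
  shows "ker_op (shift_op (dirac_op m) z) = {0}"
proof (rule ker_trivial)
  fix F assume F: "dirac_solution m z F (\<lambda>_. 0)"
  define U where "U = (F 0 $ 1)\<^sup>2"
  define V where "V = (F 0 $ 2)\<^sup>2"
  have r: "(of_real m + (z - \<i>)) * V = (of_real m - (z - \<i>)) * U"
    using half_line_invariant[of _ _ "\<lambda>x. F x $ 1" "\<lambda>x. F x $ 2"] dirac_right_half_line[OF F]
    by (simp add: U_def V_def)
  have l: "(of_real m + (z + \<i>)) * V = (of_real m - (z + \<i>)) * U"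
    using half_line_invariant[of _ _ "\<lambda>x. F (- x) $ 1" "\<lambda>x. - F (- x) $ 2"] dirac_left_half_line[OF F]
    by (simp add: U_def V_def)
  have "2 * \<i> * (V + U) = ((of_real m + (z + \<i>)) * V - (of_real m - (z + \<i>)) * U)
      - ((of_real m + (z - \<i>)) * V - (of_real m - (z - \<i>)) * U)" by (simp add: algebra_simps)
  also have "\<dots> = 0" unfolding r l by simp
  finally have V: "V = - U" by (simp add: add_eq_0_iff2)
  have "2 * of_real m * U = 0" using r unfolding V by (simp add: algebra_simps)
  then have "U = 0" using m by simp
  then show "F 0 $ 1 = 0 \<and> F 0 $ 2 = 0" using V by (simp add: U_def V_def)
qed

text \<open>On one of the half-lines the coefficient \<open>z - \<i> sgn x\<close> is real.\<close>

lemma massless_injective: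
  assumes z: "\<bar>Im z\<bar> = 1"
  shows "ker_op (shift_op (dirac_op 0) z) = {0}"
proof (rule ker_trivial)
  fix F assume F: "dirac_solution 0 z F (\<lambda>_. 0)"
  show "F 0 $ 1 = 0 \<and> F 0 $ 2 = 0"
  proof (cases "Im z = 1")
    case True
    then have "z - \<i> = of_real (Re z)" by (simp add: complex_eq_iff)
    then have "half_line_system (of_real (Re z)) (- of_real (Re z)) (\<lambda>_. 0) (\<lambda>_. 0) (\<lambda>x. F x $ 1) (\<lambda>x. F x $ 2)"
      using dirac_right_half_line[OF F] by simp
    from half_line_rotation[OF this] show ?thesis by simp
  next
    case False
    then have "z + \<i> = of_real (Re z)" using z by (auto simp: complex_eq_iff)
    then have "half_line_system (of_real (Re z)) (- of_real (Re z)) (\<lambda>_. 0) (\<lambda>_. 0) (\<lambda>x. F (- x) $ 1) (\<lambda>x. - F (- x) $ 2)"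
      using dirac_left_half_line[OF F] by simp
    from half_line_rotation[OF this] show ?thesis by simp
  qed
qed

lemma square_integrable_scalars:
  assumes "L2_scalar a" "L2_scalar b"
  shows "square_integrable (\<lambda>x. vector [a x, b x])"
  using assms vector_measurable[of a b]
  by (simp add: square_integrable_def L2_scalar_def norm_vec2)

text \<open>The resonant source is placed on the half-line whose rates are imaginary.\<close>

lemma singular_not_surjective:
  assumes m: "m \<ge> 0" and z: "\<bar>Re z\<bar> \<ge> m" "\<bar>Im z\<bar> = 1"
  shows "ran_op (shift_op (dirac_op m) z) \<noteq> UNIV"
proof
  assume ran: "ran_op (shift_op (dirac_op m) z) = UNIV"
  have solve: "\<exists>F. dirac_solution m z F H" if H: "square_integrable H" for H
  proof -
    have "abs_L2 H \<in> ran_op (shift_op (dirac_op m) z)" using ran by simp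
    then obtain u where u: "u \<in> H1" "app (shift_op (dirac_op m) z) u = abs_L2 H"
      by (auto simp: ran_op_def)
    show ?thesis using app_imp_dirac_solution[OF u(1) H u(2)] by metis
  qed
  define \<kappa> where "\<kappa> = sqrt ((Re z)\<^sup>2 - m\<^sup>2)"
  have "m\<^sup>2 \<le> (Re z)\<^sup>2" using power_mono[OF z(1) m, of 2] by simp
  then have "(complex_of_real \<kappa>)\<^sup>2 = of_real ((Re z)\<^sup>2 - m\<^sup>2)" by (simp add: \<kappa>_def flip: of_real_power)
  then have "(of_real m + complex_of_real (Re z)) * (of_real m - of_real (Re z)) = - (complex_of_real \<kappa>)\<^sup>2"
    by (simp add: power2_eq_square algebra_simps)
  then obtain g k where L: "L2_scalar g" "L2_scalar k" and
    no: "\<And>u v. \<not> half_line_system (of_real m + of_real (Re z)) (of_real m - of_real (Re z)) g k u v"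
    using half_line_not_solvable by blast
  show False
  proof (cases "Im z = 1")
    case True
    then have w: "z - \<i> = of_real (Re z)" by (simp add: complex_eq_iff)
    obtain F where "dirac_solution m z F (\<lambda>x. vector [- k x, g x])"
      using solve[OF square_integrable_scalars[OF L2_scalar_uminus[OF L(2)] L(1)]] by blast
    from dirac_right_half_line[OF this] show False using no unfolding w by simp
  next
    case False
    then have w: "z + \<i> = of_real (Re z)" using z by (auto simp: complex_eq_iff)
    obtain F where "dirac_solution m z F (\<lambda>x. vector [- k (- x), - g (- x)])"
      using solve[OF square_integrable_scalars[OF L2_scalar_uminus[OF L2_scalar_reflect[OF L(2)]]
          L2_scalar_uminus[OF L2_scalar_reflect[OF L(1)]]]] by blast
    from dirac_left_half_line[OF this] show False using no unfolding w by simp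
  qed
qed

section \<open>The spectra\<close>

lemma Dom_dirac [simp]: "Dom (dirac_op m) = H1"
  by (simp add: dirac_op_def)

lemma fredholm_imp_semi_fredholm: "fredholm T \<Longrightarrow> semi_fredholm T"
  by (simp add: fredholm_def semi_fredholm_def)

lemma regular_point:
  assumes "dirac.bounded_below_mod_ker m z" "ker_op (shift_op (dirac_op m) z) = {0}"
  shows "z \<in> resolvent_set (dirac_op m)" "z \<notin> Spec_p (dirac_op m)" "z \<notin> Spec_c (dirac_op m)"
    "z \<notin> Spec_e1 (dirac_op m)" "z \<notin> Spec_e2 (dirac_op m)" "z \<notin> Spec_e3 (dirac_op m)" "z \<notin> Spec_e4 (dirac_op m)"
  using dirac.bounded_inverse[OF assms] dirac.inj_iff_ker[of m z] assms(2) fredholm_imp_semi_fredholm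
  by (auto simp: resolvent_set_def Spec_p_def Spec_c_def Spec_e1_def Spec_e2_def Spec_e3_def Spec_e4_def)

lemma strip_point:
  assumes z: "\<bar>Im z\<bar> < 1"
  shows "z \<notin> resolvent_set (dirac_op 0)" "z \<in> Spec_p (dirac_op 0)" "z \<notin> Spec_c (dirac_op 0)"
    "z \<notin> Spec_e1 (dirac_op 0)" "z \<notin> Spec_e2 (dirac_op 0)" "z \<notin> Spec_e3 (dirac_op 0)" "z \<notin> Spec_e4 (dirac_op 0)"
proof -
  obtain k where k: "dirac.bounded_below_mod_ker 0 z"
    "ker_op (shift_op (dirac_op 0) z) = complex_vector.span {k}" "k \<noteq> 0"
    by (rule massless_strip[OF z])
  have "k \<in> ker_op (shift_op (dirac_op 0) z)" unfolding k(2) by (simp add: complex_vector.span_base)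
  then have "ker_op (shift_op (dirac_op 0) z) \<noteq> {0}" using k(3) by auto
  then have "\<not> inj_on (app (shift_op (dirac_op 0) z)) H1"
    using dirac.inj_iff_ker[of 0 z] by simp
  then show "z \<notin> resolvent_set (dirac_op 0)" "z \<in> Spec_p (dirac_op 0)" "z \<notin> Spec_c (dirac_op 0)"
    by (auto simp: resolvent_set_def boundedly_invertible_def bij_betw_def Spec_p_def Spec_c_def)
  show "z \<notin> Spec_e1 (dirac_op 0)" "z \<notin> Spec_e2 (dirac_op 0)" "z \<notin> Spec_e3 (dirac_op 0)" "z \<notin> Spec_e4 (dirac_op 0)"
    using dirac.one_dimensional_kernel[OF k] fredholm_imp_semi_fredholm
    by (auto simp: Spec_e1_def Spec_e2_def Spec_e3_def Spec_e4_def)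
qed

lemma singular_point:
  assumes m: "m \<ge> 0" and z: "\<bar>Re z\<bar> \<ge> m" "\<bar>Im z\<bar> = 1"
  shows "z \<notin> resolvent_set (dirac_op m)" "z \<notin> Spec_p (dirac_op m)" "z \<in> Spec_c (dirac_op m)"
    "z \<in> Spec_e1 (dirac_op m)" "z \<in> Spec_e2 (dirac_op m)" "z \<in> Spec_e3 (dirac_op m)" "z \<in> Spec_e4 (dirac_op m)"
proof -
  have ker: "ker_op (shift_op (dirac_op m) z) = {0}"
    using m massive_injective massless_injective[OF z(2)] by (cases "m = 0") auto
  have ran: "ran_op (shift_op (dirac_op m) z) \<noteq> UNIV" by (rule singular_not_surjective[OF assms])
  have inj: "inj_on (app (shift_op (dirac_op m) z)) H1" using ker dirac.inj_iff_ker[of m z] by simp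
  note * = dirac.injective_not_surjective[OF ker ran] dirac.dense_ran[OF ker]
  show "z \<notin> resolvent_set (dirac_op m)"
    using ran by (auto simp: resolvent_set_def boundedly_invertible_def bij_betw_def ran_op_def)
  show "z \<notin> Spec_p (dirac_op m)" "z \<in> Spec_c (dirac_op m)"
    using inj ran * by (auto simp: Spec_p_def Spec_c_def)
  show "z \<in> Spec_e1 (dirac_op m)" "z \<in> Spec_e2 (dirac_op m)" "z \<in> Spec_e3 (dirac_op m)" "z \<in> Spec_e4 (dirac_op m)"
    using * by (auto simp: Spec_e1_def Spec_e2_def Spec_e3_def Spec_e4_def semi_fredholm_def fredholm_def)
qed

text \<open>On a connected set, \<open>\<bar>Im z\<bar>\<close> cannot pass from values below 1 to larger ones without
  attaining 1.\<close>

lemma strip_component: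
  assumes z: "\<bar>Im z\<bar> < 1" and w: "w \<in> connected_component_set (- {z. \<bar>Im z\<bar> = 1}) z"
  shows "\<bar>Im w\<bar> < 1"
proof (rule ccontr)
  assume "\<not> \<bar>Im w\<bar> < 1"
  obtain T where T: "connected T" "T \<subseteq> - {z. \<bar>Im z\<bar> = 1}" "z \<in> T" "w \<in> T"
    using w by (auto simp: connected_component_def)
  have "connected ((\<lambda>x. \<bar>Im x\<bar>) ` T)"
    by (intro connected_continuous_image continuous_intros T)
  then have "{\<bar>Im z\<bar>..\<bar>Im w\<bar>} \<subseteq> (\<lambda>x. \<bar>Im x\<bar>) ` T"
    using T(3,4) by (intro connected_contains_Icc) auto
  moreover have "1 \<in> {\<bar>Im z\<bar>..\<bar>Im w\<bar>}" using z \<open>\<not> \<bar>Im w\<bar> < 1\<close> by simp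
  ultimately have "1 \<in> (\<lambda>x. \<bar>Im x\<bar>) ` T" by blast
  then show False using T(2) by auto
qed

theorem mainTheorem1:
  fixes m :: real
  assumes "m \<ge> 0"
  shows "(m > 0 \<longrightarrow>
           Spec_p (dirac_op m) = {} \<and>
           Spec (dirac_op m) = Spec_c (dirac_op m) \<and>
           Spec_c (dirac_op m) = {z. \<bar>Re z\<bar> \<ge> m \<and> \<bar>Im z\<bar> = 1} \<and>
           Spec_e1 (dirac_op m) = Spec (dirac_op m) \<and>
           Spec_e2 (dirac_op m) = Spec (dirac_op m) \<and>
           Spec_e3 (dirac_op m) = Spec (dirac_op m) \<and>
           Spec_e4 (dirac_op m) = Spec (dirac_op m) \<and>
           Spec_e5 (dirac_op m) = Spec (dirac_op m))
       \<and> (m = 0 \<longrightarrow>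
           Spec_p (dirac_op m) = {z. \<bar>Im z\<bar> < 1} \<and>
           Spec_c (dirac_op m) = {z. \<bar>Im z\<bar> = 1} \<and>
           Spec (dirac_op m) = {z. \<bar>Im z\<bar> \<le> 1} \<and>
           Spec_e1 (dirac_op m) = {z. \<bar>Im z\<bar> = 1} \<and>
           Spec_e2 (dirac_op m) = {z. \<bar>Im z\<bar> = 1} \<and>
           Spec_e3 (dirac_op m) = {z. \<bar>Im z\<bar> = 1} \<and>
           Spec_e4 (dirac_op m) = {z. \<bar>Im z\<bar> = 1} \<and>
           Spec_e5 (dirac_op m) = Spec (dirac_op m))"
proof (intro conjI impI)
  let ?T = "dirac_op m"
  let ?L = "{z. \<bar>Re z\<bar> \<ge> m \<and> \<bar>Im z\<bar> = 1}"
  {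
    assume m: "m > 0"
    have reg: "z \<in> resolvent_set ?T" "z \<notin> Spec_p ?T" "z \<notin> Spec_c ?T"
      "z \<notin> Spec_e1 ?T" "z \<notin> Spec_e2 ?T" "z \<notin> Spec_e3 ?T" "z \<notin> Spec_e4 ?T" if "z \<notin> ?L" for z
      using regular_point[OF massive_regular[OF m]] that by auto
    have sing: "z \<notin> resolvent_set ?T" "z \<notin> Spec_p ?T" "z \<in> Spec_c ?T"
      "z \<in> Spec_e1 ?T" "z \<in> Spec_e2 ?T" "z \<in> Spec_e3 ?T" "z \<in> Spec_e4 ?T" if "z \<in> ?L" for z
      using singular_point[OF assms] that by auto
    have S: "Spec ?T = ?L" unfolding Spec_def using reg(1) sing(1) by blast
    have e1: "Spec_e1 ?T = ?L" using reg(4) sing(4) by blast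
    show "Spec_p ?T = {}" using reg(2) sing(2) by blast
    show "Spec_c ?T = ?L" using reg(3) sing(3) by blast
    then show "Spec ?T = Spec_c ?T" using S by simp
    show "Spec_e1 ?T = Spec ?T" using e1 S by simp
    show "Spec_e2 ?T = Spec ?T" unfolding S using reg(5) sing(5) by blast
    show "Spec_e3 ?T = Spec ?T" unfolding S using reg(6) sing(6) by blast
    show "Spec_e4 ?T = Spec ?T" unfolding S using reg(7) sing(7) by blast
    show "Spec_e5 ?T = Spec ?T"
    proof (intro equalityI subsetI)
      fix z assume z: "z \<in> Spec_e5 ?T"
      show "z \<in> Spec ?T"
      proof (rule ccontr)
        assume "z \<notin> Spec ?T"
        then have "z \<in> resolvent_set ?T" "z \<notin> Spec_e1 ?T" using e1 S by (auto simp: Spec_def)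
        moreover from this(2) have "z \<in> connected_component_set (- Spec_e1 ?T) z" by simp
        ultimately show False using z unfolding Spec_e5_def by blast
      qed
    qed (use e1 S in \<open>auto simp: Spec_e5_def\<close>)
  }
  {
    assume "m = 0"
    then have T: "?T = dirac_op 0" by simp
    have L: "\<bar>Re z\<bar> \<ge> 0" for z by simp
    note reg = regular_point[OF massless_regular]
    note sing = singular_point[OF order_refl L]
    note strip = strip_point
    have set_eq: "A = B" if "\<And>z. \<bar>Im z\<bar> < 1 \<Longrightarrow> z \<in> A \<longleftrightarrow> z \<in> B" "\<And>z. \<bar>Im z\<bar> = 1 \<Longrightarrow> z \<in> A \<longleftrightarrow> z \<in> B"
      "\<And>z. \<bar>Im z\<bar> > 1 \<Longrightarrow> z \<in> A \<longleftrightarrow> z \<in> B" for A B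
      using that by (metis linorder_less_linear subsetI subset_antisym)
    show e1: "Spec_e1 ?T = {z. \<bar>Im z\<bar> = 1}"
      unfolding T by (rule set_eq) (simp_all add: reg sing strip)
    show S: "Spec ?T = {z. \<bar>Im z\<bar> \<le> 1}"
      unfolding T by (rule set_eq) (simp_all add: Spec_def reg sing strip)
    show "Spec_p ?T = {z. \<bar>Im z\<bar> < 1}"
      unfolding T by (rule set_eq) (simp_all add: reg sing strip)
    show "Spec_c ?T = {z. \<bar>Im z\<bar> = 1}" "Spec_e2 ?T = {z. \<bar>Im z\<bar> = 1}"
      "Spec_e3 ?T = {z. \<bar>Im z\<bar> = 1}" "Spec_e4 ?T = {z. \<bar>Im z\<bar> = 1}"
      unfolding T by (rule set_eq; simp add: reg sing strip)+
    show "Spec_e5 ?T = Spec ?T"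
    proof (intro set_eqI)
      fix z
      consider "\<bar>Im z\<bar> < 1" | "\<bar>Im z\<bar> = 1" | "\<bar>Im z\<bar> > 1" by linarith
      then show "z \<in> Spec_e5 ?T \<longleftrightarrow> z \<in> Spec ?T"
      proof cases
        case 1
        have "resolvent_set ?T \<inter> connected_component_set (- Spec_e1 ?T) z = {}"
          unfolding e1 using strip_component[OF 1] strip(1) unfolding T by blast
        then show ?thesis using 1 by (simp add: Spec_e5_def S)
      next
        case 2
        then show ?thesis by (simp add: Spec_e5_def S e1)
      next
        case 3
        then have "z \<in> resolvent_set ?T" "z \<notin> Spec_e1 ?T" using reg(1)[OF 3 3] e1 unfolding T by auto
        moreover from this(2) have "z \<in> connected_component_set (- Spec_e1 ?T) z" by simp
        ultimately show ?thesis using 3 unfolding Spec_e5_def S by auto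
      qed
    qed
  }
qed

end
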